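(* Let $(T,\Sigma,\mu)$ be a complete $\sigma$-finite measure space, let $Z$ be a separable reflexive Banach space, let $1\le p<\infty$ with conjugate exponent $q$, let $S:T\rightrightarrows Z$ be a measurable multifunction with nonempty closed values, and let $x\in\mathsf{Sel}_p(S)$. Then (a) $\widehat{\mathbf N}_{\mathsf{Sel}_p(S)}(x)=\{\xi\in L^q(T,Z^* ):\xi(t)\in\widehat{\mathbf N}_{S(t)}(x(t))\text{ a.e.}\}$; (b) $\widehat\partial d_{\mathsf{Sel}_p(S)}(x)\subset\{\xi\in L^q(T,Z^* ):\|\xi\|_{L^q}\le1,\ \xi(t)\in\widehat{\mathbf N}_{S(t)}(x(t))\text{ a.e.}\}$.
   Context: $L^p(T,Z)$ is the Lebesgue--Bochner space; $q=\infty$ if $p=1$ and $1/p+1/q=1$ otherwise. Since $Z$ is reflexive, $[L^p(T,Z)]^*$ is identified with $L^q(T,Z^* )$ via $\langle\xi,v\rangle=\int_T\langle\xi(t),v(t)\rangle\,d\mu(t)$. A multifunction $S:T\rightrightarrows Z$ with nonempty closed values is measurable if $\{t: S(t)\cap U\neq\emptyset\}\in\Sigma$ for every open $U\subset Z$. $\mathsf{Sel}_p(S):=\{z\in L^p(T,Z): z(t)\in S(t)\text{ a.e.}\}$. Clarke tangent cone: for a Banach space $X$ with closed unit ball $\overline{\mathbf B}_X$, $C\subset X$ closed and $x\in C$, $\widehat{\mathbf T}_C(x)$ is the set of all $v\in X$ such that for every $\varepsilon>0$ there exist $\delta>0$, $\lambda>0$ such that $C\cap[y+\eta(v+\varepsilon\overline{\mathbf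 B}_X)]\ne\emptyset$ for every $y\in C\cap(x+\delta\overline{\mathbf B}_X)$ and every $\eta\in[0,\lambda]$. Clarke normal cone: $\widehat{\mathbf N}_C(x):=\{\xi\in X^*:\langle\xi,v\rangle\le0\ \forall v\in\widehat{\mathbf T}_C(x)\}$. $d_C$ is the distance function to $C$ and $\widehat\partial f$ is the Clarke subdifferential of a locally Lipschitz real-valued function $f$. *)

theory Defs
  imports
    "HOL-Analysis.Analysis"
    "HOL-Probability.Essential_Supremum"
    "HOL-Library.Function_Algebras"
begin

section \<open>Functions as a real vector space\<close>

instantiation "fun" :: (type, real_vector) real_vector
begin

definition scaleR_fun :: "real \<Rightarrow> ('a \<Rightarrow> 'b) \<Rightarrow> 'a \<Rightarrow> 'b" where
  "scaleR_fun r f = (\<lambda>t. r *\<^sub>R f t)"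

instance
  by standard (simp_all add: scaleR_fun_def plus_fun_def scaleR_add_right scaleR_add_left)

end

lemma scaleR_fun_apply [simp]: "(r *\<^sub>R f) t = r *\<^sub>R f t"
  by (simp add: scaleR_fun_def)


section \<open>Clarke's constructions\<close>

text \<open>
  A normed space is given by a linear subspace \<open>V\<close> of a real vector space and a seminorm \<open>N\<close>
  on it; it stands for the quotient of \<open>V\<close> by the null space of \<open>N\<close>. A type of class
  \<open>real_normed_vector\<close> is the case \<open>V = UNIV\<close>, \<open>N = norm\<close>. The Lebesgue-Bochner spaces are the
  case where \<open>V\<close> consists of the \<open>p\<close>-integrable functions and \<open>N\<close> is the \<open>p\<close>-norm, whose null
  space consists of the functions that vanish almost everywhere.
\<close>

definition clarke_tangent_cone ::
    "'v::real_vector set \<Rightarrow> ('v \<Rightarrow> real) \<Rightarrow> 'v set \<Rightarrow> 'v \<Rightarrow> 'v set" where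
  "clarke_tangent_cone V N C x =
     {v \<in> V. \<forall>\<epsilon>>0. \<exists>\<delta>>0. \<exists>\<kappa>>0. \<forall>y\<in>C. N (y - x) \<le> \<delta> \<longrightarrow>
        (\<forall>\<eta>\<in>{0..\<kappa>}. \<exists>b\<in>V. N b \<le> 1 \<and> y + \<eta> *\<^sub>R (v + \<epsilon> *\<^sub>R b) \<in> C)}"

text \<open>
  Functionals are undefined outside \<open>V\<close>, so that equality in the dual is equality on \<open>V\<close>.
  Boundedness forces them to vanish on the null space of \<open>N\<close>.
\<close>

definition dual_space :: "'v::real_vector set \<Rightarrow> ('v \<Rightarrow> real) \<Rightarrow> ('v \<Rightarrow> real) set" where
  "dual_space V N =
     {\<phi> \<in> extensional V.
        (\<forall>u\<in>V. \<forall>v\<in>V. \<phi> (u + v) = \<phi> u + \<phi> v) \<and>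
        (\<forall>r. \<forall>v\<in>V. \<phi> (r *\<^sub>R v) = r * \<phi> v) \<and>
        (\<exists>K. \<forall>v\<in>V. \<bar>\<phi> v\<bar> \<le> K * N v)}"

lemma dual_space_UNIV_norm: "dual_space UNIV norm = range blinfun_apply"
proof (intro set_eqI iffI)
  fix \<phi> :: "'a::real_normed_vector \<Rightarrow> real"
  assume "\<phi> \<in> dual_space UNIV norm"
  then obtain K where "\<And>u v. \<phi> (u + v) = \<phi> u + \<phi> v" "\<And>r v. \<phi> (r *\<^sub>R v) = r * \<phi> v"
      "\<And>v. \<bar>\<phi> v\<bar> \<le> K * norm v"
    by (auto simp: dual_space_def)
  then have "bounded_linear \<phi>"
    by (intro bounded_linear_intro[where K = K]) (simp_all add: mult.commute)
  then show "\<phi> \<in> range blinfun_apply"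
    by (metis bounded_linear_Blinfun_apply rangeI)
next
  fix \<phi> :: "'a::real_normed_vector \<Rightarrow> real"
  assume "\<phi> \<in> range blinfun_apply"
  then obtain \<psi> where "\<phi> = blinfun_apply \<psi>" by auto
  moreover have "\<forall>v. \<bar>blinfun_apply \<psi> v\<bar> \<le> norm \<psi> * norm v"
    using norm_blinfun[of \<psi>] by simp
  ultimately show "\<phi> \<in> dual_space UNIV norm"
    by (auto simp: dual_space_def blinfun.add_right blinfun.scaleR_right)
qed

definition clarke_normal_cone ::
    "'v::real_vector set \<Rightarrow> ('v \<Rightarrow> real) \<Rightarrow> 'v set \<Rightarrow> 'v \<Rightarrow> ('v \<Rightarrow> real) set" where
  "clarke_normal_cone V N C x =
     {\<phi> \<in> dual_space V N. \<forall>v\<in>clarke_tangent_cone V N C x. \<phi> v \<le> 0}"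

definition distance_function :: "('v::real_vector \<Rightarrow> real) \<Rightarrow> 'v set \<Rightarrow> 'v \<Rightarrow> real" where
  "distance_function N C y = (INF c\<in>C. N (y - c))"

definition seminorm_nhds ::
    "'v::real_vector set \<Rightarrow> ('v \<Rightarrow> real) \<Rightarrow> 'v \<Rightarrow> 'v filter" where
  "seminorm_nhds V N x = inf (filtercomap (\<lambda>y. N (y - x)) (nhds 0)) (principal V)"

text \<open>The upper limit of the difference quotients as \<open>y \<rightarrow> x\<close> and \<open>\<eta> \<down> 0\<close>.\<close>

definition clarke_derivative ::
    "'v::real_vector set \<Rightarrow> ('v \<Rightarrow> real) \<Rightarrow> ('v \<Rightarrow> real) \<Rightarrow> 'v \<Rightarrow> 'v \<Rightarrow> ereal" where
  "clarke_derivative V N f x v =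
     Limsup (seminorm_nhds V N x \<times>\<^sub>F at_right 0)
       (\<lambda>(y, \<eta>). ereal ((f (y + \<eta> *\<^sub>R v) - f y) / \<eta>))"

definition clarke_subdifferential ::
    "'v::real_vector set \<Rightarrow> ('v \<Rightarrow> real) \<Rightarrow> ('v \<Rightarrow> real) \<Rightarrow> 'v \<Rightarrow> ('v \<Rightarrow> real) set" where
  "clarke_subdifferential V N f x =
     {\<phi> \<in> dual_space V N. \<forall>v\<in>V. ereal (\<phi> v) \<le> clarke_derivative V N f x v}"


section \<open>Lebesgue-Bochner spaces\<close>

text \<open>
  Borel measurability agrees with strong measurability when the range space is separable. For a
  separable reflexive space this is the case for the space itself and for its dual.
\<close>

definition Lp_space :: "'t measure \<Rightarrow> ereal \<Rightarrow> ('t \<Rightarrow> 'b::real_normed_vector) set" where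
  "Lp_space M p =
     {f \<in> borel_measurable M.
        if p = \<infinity> then esssup M (\<lambda>t. ennreal (norm (f t))) < \<infinity>
        else integrable M (\<lambda>t. norm (f t) powr real_of_ereal p)}"

definition Lp_norm :: "'t measure \<Rightarrow> ereal \<Rightarrow> ('t \<Rightarrow> 'b::real_normed_vector) \<Rightarrow> real" where
  "Lp_norm M p f =
     (if p = \<infinity> then enn2real (esssup M (\<lambda>t. ennreal (norm (f t))))
      else (LINT t|M. norm (f t) powr real_of_ereal p) powr (1 / real_of_ereal p))"

definition conjugate_exponent :: "real \<Rightarrow> ereal \<Rightarrow> bool" where
  "conjugate_exponent p q \<longleftrightarrow> (if p = 1 then q = \<infinity> else 1 / ereal p + 1 / q = 1)"

definition reflexive_space :: "'z::real_normed_vector itself \<Rightarrow> bool" where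
  "reflexive_space _ \<longleftrightarrow>
     (\<forall>\<Phi> :: ('z \<Rightarrow>\<^sub>L real) \<Rightarrow>\<^sub>L real. \<exists>z. \<forall>\<zeta>. blinfun_apply \<Phi> \<zeta> = blinfun_apply \<zeta> z)"

text \<open>
  The functional on \<open>L\<^sup>p(T, Z)\<close> with which a function \<open>\<xi>\<close> in \<open>L\<^sup>q(T, Z\<^sup>*)\<close> is identified.
\<close>

definition Lp_pairing ::
    "'t measure \<Rightarrow> ereal \<Rightarrow> ('t \<Rightarrow> 'z::real_normed_vector \<Rightarrow>\<^sub>L real) \<Rightarrow> ('t \<Rightarrow> 'z) \<Rightarrow> real" where
  "Lp_pairing M p \<xi> = restrict (\<lambda>v. LINT t|M. blinfun_apply (\<xi> t) (v t)) (Lp_space M p)"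

definition measurable_multifunction :: "'t measure \<Rightarrow> ('t \<Rightarrow> 'z::topological_space set) \<Rightarrow> bool" where
  "measurable_multifunction M S \<longleftrightarrow>
     (\<forall>U. open U \<longrightarrow> {t \<in> space M. S t \<inter> U \<noteq> {}} \<in> sets M)"

definition Sel :: "'t measure \<Rightarrow> ereal \<Rightarrow> ('t \<Rightarrow> 'z::real_normed_vector set) \<Rightarrow> ('t \<Rightarrow> 'z) set" where
  "Sel M p S = {z \<in> Lp_space M p. AE t in M. z t \<in> S t}"

end

theory Submission
  imports Defs
begin

text \<open>
  Tangent cones are pointwise: \<open>v\<close> lies in the Clarke tangent cone of \<open>Sel M p S\<close> at \<open>x\<close> iff \<open>v t\<close>
  lies in the Clarke tangent cone of \<open>S t\<close> at \<open>x t\<close> almost everywhere. A tangent \<open>v\<close> to \<open>C\<close> at \<open>x\<close> is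
  one with \<open>d(y + \<eta> v, C) = o(\<eta>)\<close> uniformly for \<open>y\<close> in \<open>C\<close> near \<open>x\<close>. For a tangent to the set of
  selections this holds in \<open>L\<^sup>p\<close> only. By Fatou's lemma it then holds pointwise along some step sizes
  \<open>\<eta> \<rightarrow> 0\<close>, and since a large step can be composed of many small ones, it holds for all small \<open>\<eta>\<close>.
  Conversely, pointwise tangents are corrected by measurable selections outside a set that is small
  for the measure with density \<open>\<bar>v\<bar>\<^sup>p\<close>.

  The duality between \<open>L\<^sup>p(T, Z)\<close> and \<open>L\<^sup>q(T, Z\<^sup>*)\<close> turns a normal functional into a function \<open>\<xi>\<close>
  that is nonpositive on all measurable selections of the tangent cones. These selections are dense
  in the tangent cones: the cone is the zero set of a sublinear function that depends measurably on
  \<open>t\<close>, and by weak compactness of balls in a reflexive space, whether this zero set meets a ball can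
  be read off from the values at countably many points.

  Statement (b) follows from (a), since subgradients of the distance function are normal and have
  norm at most 1.
\<close>

section \<open>The Hahn-Banach theorem and reflexive spaces\<close>

text \<open>The measure may be infinite, so a fixed positive function \<open>w\<close> of p-norm at
  most 1 serves as unit of length at each point: all \<open>y\<close> with
  \<open>norm (y t - x t) \<le> \<delta> * w t\<close> lie in the \<delta>-ball about
  \<open>x\<close> in L^p, which yields pointwise neighbourhoods of radius
  \<open>\<delta> * w t\<close>. Tangency with error \<epsilon> in L^p, tested against the pointwise
  rate \<open>c * w t\<close>, leaves an exceptional set on which \<open>w\<close> has norm at most
  \<open>\<epsilon> / c\<close>. This set disappears when \<epsilon> tends to 0 with
  \<open>c\<close> fixed; only then does \<open>c\<close> tend to 0. In the converse direction the
  radius on which a pointwise tangent behaves well depends on \<open>t\<close>, and a function close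
  to \<open>x\<close> in L^p may be far from it on a small set. No correction is attempted at such
  points: the given selection is kept, which amounts to the correction term
  \<open>- v / \<epsilon>\<close>, and this is small because \<open>v\<close> has small norm there.
  The second obstacle is measurability, since the tangent cone is defined by uncountable quantifiers
  over \<open>S t\<close> and over step sizes. They are reduced to a countable dense family of
  selections and to rational steps.\<close>

definition sublinear :: "('a::real_vector \<Rightarrow> real) \<Rightarrow> bool" where
  "sublinear p \<longleftrightarrow> (\<forall>u v. p (u + v) \<le> p u + p v) \<and> (\<forall>a>0. \<forall>v. p (a *\<^sub>R v) \<le> a * p v)"

lemma sublinear_add: "sublinear p \<Longrightarrow> p (u + v) \<le> p u + p v"
  by (simp add: sublinear_def)

text \<open>Only one inequality is part of \<open>sublinear\<close>; the reverse one is the same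
  inequality with factor \<open>1 / a\<close> at \<open>a *\<^sub>R v\<close>.\<close>

lemma sublinear_scaleR:
  assumes "sublinear p" "a > 0"
  shows "p (a *\<^sub>R v) = a * p v"
proof (rule antisym)
  show "p (a *\<^sub>R v) \<le> a * p v" using assms by (simp add: sublinear_def)
  have "p ((1 / a) *\<^sub>R (a *\<^sub>R v)) \<le> (1 / a) * p (a *\<^sub>R v)"
    using assms unfolding sublinear_def by (meson divide_pos_pos zero_less_one)
  then show "a * p v \<le> p (a *\<^sub>R v)"
    using assms by (simp add: field_simps)
qed

lemma sublinear_zero: "sublinear p \<Longrightarrow> p 0 = 0"
  using sublinear_scaleR[of p 2 0] by simp

lemma sublinear_minus: "sublinear p \<Longrightarrow> - p (- v) \<le> p v"
  using sublinear_add[of p v "-v"] sublinear_zero[of p] by simp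

text \<open>\<open>Q v c\<close> is read as: \<open>c\<close> is an admissible upper estimate at
  \<open>v\<close>. Closure of the estimates under sums and positive multiples passes to their
  infimum, which \<open>U\<close> and \<open>L\<close> keep finite. The sublinear functionals
  constructed below (tilts, infima of chains, distances to subspaces, upper limits, the tangent
  gauge) are all of this kind.\<close>

lemma sublinear_Inf:
  fixes Q :: "'a::real_vector \<Rightarrow> real \<Rightarrow> bool"
  assumes ub: "\<And>v. Q v (U v)" and lb: "\<And>v c. Q v c \<Longrightarrow> L v \<le> c"
    and add: "\<And>u v c d. Q u c \<Longrightarrow> Q v d \<Longrightarrow> Q (u + v) (c + d)"
    and scale: "\<And>a v c. a > 0 \<Longrightarrow> Q v c \<Longrightarrow> Q (a *\<^sub>R v) (a * c)"
  shows "sublinear (\<lambda>v. Inf {c. Q v c})" and "\<And>v c. Q v c \<Longrightarrow> Inf {c. Q v c} \<le> c"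
proof -
  let ?q = "\<lambda>v. Inf {c. Q v c}"
  have bdd: "bdd_below {c. Q v c}" for v
    using lb by (intro bdd_belowI[where m = "L v"]) auto
  show le: "?q v \<le> c" if Q: "Q v c" for v c
    using that by (intro cInf_lower bdd) auto
  have ge: "c \<le> ?q v" if "\<And>d. Q v d \<Longrightarrow> c \<le> d" for v c
    using that ub[of v] by (intro cInf_greatest) auto
  show "sublinear ?q"
    unfolding sublinear_def
  proof safe
    fix u v
    have "?q (u + v) - c \<le> ?q v" if "Q u c" for c
    proof (rule ge)
      fix d assume "Q v d"
      with that show "?q (u + v) - c \<le> d" using le[OF add, of u c v d] by simp
    qed
    then have "?q (u + v) - ?q v \<le> ?q u"
      by (intro ge) (simp add: algebra_simps)
    then show "?q (u + v) \<le> ?q u + ?q v" by simp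
  next
    fix a :: real and v assume a: "a > 0"
    have "?q (a *\<^sub>R v) / a \<le> ?q v"
      using le[OF scale[OF a]] a by (intro ge) (simp add: field_simps)
    then show "?q (a *\<^sub>R v) \<le> a * ?q v" using a by (simp add: field_simps)
  qed
qed

text \<open>The functional is the infimum of \<open>p (v + t *\<^sub>R v0) - t * p v0\<close> over
  \<open>t \<ge> 0\<close>; the term \<open>t = 1\<close> gives the bound at \<open>- v0\<close>. A
  tilt is odd at \<open>v0\<close> and keeps the value \<open>p v0\<close> there. It serves both to
  show that minimal sublinear functionals are linear and to prescribe a value in the Hahn-Banach
  theorem.\<close>

lemma sublinear_tilt:
  fixes p :: "'a::real_vector \<Rightarrow> real"
  assumes p: "sublinear p"
  obtains q where "sublinear q" "\<And>v. q v \<le> p v" "q (- v0) \<le> - p v0"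
proof -
  define Q where "Q v c \<longleftrightarrow> (\<exists>t\<ge>0. p (v + t *\<^sub>R v0) - t * p v0 \<le> c)" for v c
  have lb: "- p (- v) \<le> c" if Q: "Q v c" for v c
  proof -
    obtain t where t: "t \<ge> 0" "p (v + t *\<^sub>R v0) - t * p v0 \<le> c"
      using Q unfolding Q_def by blast
    have "p (t *\<^sub>R v0) = t * p v0"
      using t sublinear_scaleR[OF p] sublinear_zero[OF p] by (cases "t = 0") auto
    moreover have "p (t *\<^sub>R v0) \<le> p (v + t *\<^sub>R v0) + p (- v)"
      using sublinear_add[OF p, of "v + t *\<^sub>R v0" "- v"] by simp
    ultimately show ?thesis using t by simp
  qed
  have 1: "Q v (p v)" for v unfolding Q_def by (intro exI[of _ 0]) simp
  have 2: "Q (u + v) (c + d)" if Q: "Q u c" "Q v d" for u v c d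
  proof -
    obtain s t where st: "s \<ge> 0" "p (u + s *\<^sub>R v0) - s * p v0 \<le> c"
      "t \<ge> 0" "p (v + t *\<^sub>R v0) - t * p v0 \<le> d" using Q unfolding Q_def by blast
    then show ?thesis
      unfolding Q_def using sublinear_add[OF p, of "u + s *\<^sub>R v0" "v + t *\<^sub>R v0"]
      by (intro exI[of _ "s + t"]) (simp add: algebra_simps)
  qed
  have 3: "Q (a *\<^sub>R v) (a * c)" if a: "a > 0" and Q: "Q v c" for a v c
  proof -
    obtain t where t: "t \<ge> 0" "p (v + t *\<^sub>R v0) - t * p v0 \<le> c" using Q unfolding Q_def by blast
    have "p (a *\<^sub>R v + (a * t) *\<^sub>R v0) - a * t * p v0 = a * (p (v + t *\<^sub>R v0) - t * p v0)"
      using sublinear_scaleR[OF p a, of "v + t *\<^sub>R v0"] by (simp add: algebra_simps)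
    also have "\<dots> \<le> a * c" using a t by simp
    finally show ?thesis unfolding Q_def using a t by (intro exI[of _ "a * t"]) simp
  qed
  have q: "sublinear (\<lambda>v. Inf {c. Q v c})"
    by (rule sublinear_Inf[of Q "p" "\<lambda>v. - p (- v)"]) (blast intro: 1 lb 2 3)+
  have q_le: "\<And>v c. Q v c \<Longrightarrow> Inf {c. Q v c} \<le> c"
    by (rule sublinear_Inf[of Q "p" "\<lambda>v. - p (- v)"]) (blast intro: 1 lb 2 3)+
  have "Q (- v0) (- p v0)"
    unfolding Q_def by (intro exI[of _ 1]) (simp add: sublinear_zero[OF p])
  then show thesis using q q_le[OF 1] q_le by (intro that) auto
qed

text \<open>A tilt at \<open>v\<close> cannot go strictly below a minimal \<open>p\<close>, so
  \<open>p (- v) \<le> - p v\<close>. Oddness then turns subadditivity and positive homogeneity into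
  linearity.\<close>

lemma sublinear_minimal_linear:
  assumes p: "sublinear p" and min: "\<And>q. sublinear q \<Longrightarrow> (\<And>v. q v \<le> p v) \<Longrightarrow> q = p"
  shows "linear p"
proof -
  have odd: "p (- v) = - p v" for v
  proof (rule antisym)
    obtain q where "sublinear q" "\<And>v. q v \<le> p v" "q (- v) \<le> - p v"
      using sublinear_tilt[OF p] by blast
    with min[of q] show "p (- v) \<le> - p v" by simp
    show "- p v \<le> p (- v)" using sublinear_minus[OF p, of "-v"] by simp
  qed
  show ?thesis
  proof (rule linearI)
    fix u v
    show "p (u + v) = p u + p v"
      using sublinear_add[OF p, of u v] sublinear_add[OF p, of "-u" "-v"]
        odd[of u] odd[of v] odd[of "u + v"] by simp
  next
    fix a v
    show "p (a *\<^sub>R v) = a *\<^sub>R p v"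
    proof (cases a "0::real" rule: linorder_cases)
      case less
      then show ?thesis
        using sublinear_scaleR[OF p, of "- a" v] odd[of "a *\<^sub>R v"] by simp
    qed (auto simp: sublinear_zero[OF p] sublinear_scaleR[OF p])
  qed
qed

text \<open>The pointwise infimum along the chain is finite because \<open>- p (- v)\<close> bounds
  every member from below. Subadditivity needs the chain: estimates by two different members can
  both be replaced by those of the smaller one.\<close>

lemma sublinear_chain_lower_bound:
  assumes p: "sublinear p" and ne: "C \<noteq> {}"
    and C: "\<And>q. q \<in> C \<Longrightarrow> sublinear q" "\<And>q v. q \<in> C \<Longrightarrow> q v \<le> p v"
    and chain: "\<And>q r. q \<in> C \<Longrightarrow> r \<in> C \<Longrightarrow> (\<forall>v. q v \<le> r v) \<or> (\<forall>v. r v \<le> q v)"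
  obtains m where "sublinear m" "\<And>q v. q \<in> C \<Longrightarrow> m v \<le> q v"
proof -
  define Q where "Q v c \<longleftrightarrow> (\<exists>q\<in>C. q v \<le> c)" for v c
  obtain r where r: "r \<in> C" using ne by blast
  have 1: "Q v (r v)" for v using r by (auto simp: Q_def)
  have lb: "- p (- v) \<le> c" if Q: "Q v c" for v c
  proof -
    obtain q where "q \<in> C" "q v \<le> c" using Q by (auto simp: Q_def)
    then show ?thesis using C(2)[of q "- v"] sublinear_minus[OF C(1), of q v] by simp
  qed
  have 2: "Q (u + v) (c + d)" if Q: "Q u c" "Q v d" for u v c d
  proof -
    obtain q r where qr: "q \<in> C" "q u \<le> c" "r \<in> C" "r v \<le> d" using Q by (auto simp: Q_def)
    from chain[OF qr(1,3)] obtain s where s: "s \<in> C" "s u \<le> q u" "s v \<le> r v"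
      using qr by blast
    then show ?thesis
      unfolding Q_def using qr sublinear_add[OF C(1)[OF s(1)], of u v] by (intro bexI[of _ s]) auto
  qed
  have 3: "Q (a *\<^sub>R v) (a * c)" if "a > 0" and "Q v c" for a v c
    using that sublinear_scaleR[OF C(1)] unfolding Q_def by (metis mult_left_mono less_imp_le)
  have m: "sublinear (\<lambda>v. Inf {c. Q v c})"
    by (rule sublinear_Inf[of Q "r" "\<lambda>v. - p (- v)"]) (blast intro: 1 lb 2 3)+
  have m_le: "\<And>v c. Q v c \<Longrightarrow> Inf {c. Q v c} \<le> c"
    by (rule sublinear_Inf[of Q "r" "\<lambda>v. - p (- v)"]) (blast intro: 1 lb 2 3)+
  show thesis
  proof (rule that[OF m])
    show "Inf {c. Q v c} \<le> q v" if "q \<in> C" for q v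
      by (rule m_le) (use that in \<open>auto simp: Q_def\<close>)
  qed
qed

text \<open>Zorn's lemma gives a minimal sublinear functional below a tilt of \<open>p\<close> at
  \<open>v0\<close>, and minimality makes it linear. The tilt is what forces equality at
  \<open>v0\<close>.\<close>

theorem hahn_banach_sublinear:
  fixes p :: "'a::real_vector \<Rightarrow> real"
  assumes p: "sublinear p"
  obtains F where "linear F" "\<And>v. F v \<le> p v" "F v0 = p v0"
proof -
  obtain q where q: "sublinear q" "\<And>v. q v \<le> p v" "q (- v0) \<le> - p v0"
    using sublinear_tilt[OF p] by blast
  define A where "A = {r. sublinear r \<and> (\<forall>v. r v \<le> q v)}"
  \<comment> \<open>The order is reversed, so that a maximal element for \<open>P\<close> is a
    minimal functional.\<close>
  define P where "P r s \<longleftrightarrow> (\<forall>v. s v \<le> r v)" for r s :: "'a \<Rightarrow> real"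
  have "\<exists>m\<in>A. \<forall>r\<in>A. P m r \<longrightarrow> r = m"
  proof (rule predicate_Zorn)
    show "partial_order_on A (relation_of P A)"
      by (rule partial_order_on_relation_ofI) (auto simp: P_def fun_eq_iff intro: order_trans antisym)
    fix C assume "C \<in> Chains (relation_of P A)"
    then have C: "C \<subseteq> A" "\<And>r s. r \<in> C \<Longrightarrow> s \<in> C \<Longrightarrow> P r s \<or> P s r"
      by (auto simp: Chains_def relation_of_def)
    show "\<exists>u\<in>A. \<forall>a\<in>C. P a u"
    proof (cases "C = {}")
      case True
      then show ?thesis using q by (auto simp: A_def)
    next
      case False
      have sl: "sublinear r" if "r \<in> C" for r using C(1) that by (auto simp: A_def)
      have ub: "r v \<le> q v" if "r \<in> C" for r v using C(1) that by (auto simp: A_def)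
      have ch: "(\<forall>v. r v \<le> s v) \<or> (\<forall>v. s v \<le> r v)" if "r \<in> C" "s \<in> C" for r s
        using C(2)[OF that] by (auto simp: P_def)
      obtain m where m: "sublinear m" "\<And>r v. r \<in> C \<Longrightarrow> m v \<le> r v"
      proof (rule sublinear_chain_lower_bound[OF q(1) False])
        show "sublinear r" if "r \<in> C" for r using that by (rule sl)
        show "r v \<le> q v" if "r \<in> C" for r v using that by (rule ub)
        show "(\<forall>v. r v \<le> s v) \<or> (\<forall>v. s v \<le> r v)" if "r \<in> C" "s \<in> C" for r s
          using that by (rule ch)
      qed (rule that)
      obtain r where r: "r \<in> C" using False by auto
      have "m \<in> A"
        unfolding A_def using m(1) order_trans[OF m(2)[OF r] ub[OF r]] by blast
      moreover have "\<forall>a\<in>C. P a m"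
        unfolding P_def using m(2) by blast
      ultimately show ?thesis by blast
    qed
  qed
  then obtain F where F: "F \<in> A" and min: "\<And>r. r \<in> A \<Longrightarrow> P F r \<Longrightarrow> r = F" by blast
  have lin: "linear F"
  proof (rule sublinear_minimal_linear)
    show "sublinear F" using F by (simp add: A_def)
    fix r assume "sublinear r" "\<And>v. r v \<le> F v"
    then show "r = F" using F by (intro min) (auto simp: A_def P_def intro: order_trans)
  qed
  have le: "F v \<le> p v" for v
    using F q(2)[of v] by (auto simp: A_def intro: order_trans)
  have "- F v0 \<le> - p v0"
    using F q(3) linear_neg[OF lin, of v0] by (auto simp: A_def dest: spec[of _ "- v0"])
  with le[of v0] have "F v0 = p v0" by simp
  with lin le that show thesis by blast
qed

section \<open>Bounded functionals obtained from the Hahn-Banach theorem\<close>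

lemma linear_dominated_blinfun:
  fixes F :: "'a::real_normed_vector \<Rightarrow> real"
  assumes "linear F" and le: "\<And>v. F v \<le> K * norm v"
  obtains \<zeta> where "blinfun_apply \<zeta> = F"
proof -
  have "\<bar>F v\<bar> \<le> norm v * K" for v
    using le[of v] le[of "- v"] linear_neg[OF assms(1), of v] by (simp add: mult.commute abs_le_iff)
  then have "bounded_linear F"
    using assms(1) by (intro bounded_linear_intro[where K = K]) (auto simp: linear_add linear_scale)
  then show thesis using that bounded_linear_Blinfun_apply by blast
qed

lemma norm_blinfun_le_of_le:
  fixes \<zeta> :: "'a::real_normed_vector \<Rightarrow>\<^sub>L real"
  assumes "0 \<le> K" and "\<And>v. \<zeta> v \<le> K * norm v"
  shows "norm \<zeta> \<le> K"
proof (rule norm_blinfun_bound[OF assms(1)])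
  fix v show "norm (\<zeta> v) \<le> K * norm v"
    using assms(2)[of v] assms(2)[of "- v"] by (simp add: blinfun.minus_right abs_le_iff)
qed

lemma norming_functional:
  fixes v :: "'a::real_normed_vector"
  obtains \<zeta> :: "'a \<Rightarrow>\<^sub>L real" where "norm \<zeta> \<le> 1" "\<zeta> v = norm v"
proof -
  have "sublinear (norm :: 'a \<Rightarrow> real)" by (auto simp: sublinear_def norm_triangle_ineq)
  then obtain F :: "'a \<Rightarrow> real" where F: "linear F" "\<And>u. F u \<le> norm u" "F v = norm v"
    using hahn_banach_sublinear[of norm v] by blast
  obtain \<zeta> where \<zeta>: "blinfun_apply \<zeta> = F"
    using linear_dominated_blinfun[of F 1] F by auto
  show thesis using F \<zeta> norm_blinfun_le_of_le[of 1 \<zeta>] by (intro that[of \<zeta>]) auto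
qed

text \<open>\<open>P\<close> is the distance to \<open>W\<close>. A linear functional below it
  vanishes on the subspace \<open>W\<close>, where \<open>P\<close> does, and Hahn-Banach lets it
  attain the positive distance at \<open>v\<close>.\<close>

lemma annihilator_separates:
  fixes W :: "'a::real_normed_vector set"
  assumes W: "subspace W" and v: "v \<notin> closure W"
  obtains \<zeta> :: "'a \<Rightarrow>\<^sub>L real" where "\<And>w. w \<in> W \<Longrightarrow> \<zeta> w = 0" "\<zeta> v \<noteq> 0"
proof -
  define Q where "Q u c \<longleftrightarrow> (\<exists>w\<in>W. norm (u - w) \<le> c)" for u c
  define P where "P u = Inf {c. Q u c}" for u
  have 0: "0 \<in> W" using W by (rule subspace_0)
  have 1: "Q u (norm u)" for u unfolding Q_def using 0 by (intro bexI[of _ 0]) auto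
  have lb: "0 \<le> c" if Q: "Q u c" for u c using Q order_trans[OF norm_ge_zero] unfolding Q_def by blast
  have 2: "Q (u + v) (c + d)" if Q: "Q u c" "Q v d" for u v c d
  proof -
    obtain a b where ab: "a \<in> W" "norm (u - a) \<le> c" "b \<in> W" "norm (v - b) \<le> d"
      using Q unfolding Q_def by blast
    moreover have "norm (u + v - (a + b)) \<le> norm (u - a) + norm (v - b)"
      using norm_triangle_ineq[of "u - a" "v - b"] by (simp add: algebra_simps)
    ultimately show ?thesis
      unfolding Q_def using W by (intro bexI[of _ "a + b"]) (auto simp: subspace_add)
  qed
  have 3: "Q (a *\<^sub>R v) (a * c)" if a: "a > 0" and Q: "Q v c" for a v c
  proof -
    obtain b where b: "b \<in> W" "norm (v - b) \<le> c" using Q by (auto simp: Q_def)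
    have "norm (a *\<^sub>R v - a *\<^sub>R b) = a * norm (v - b)"
      using a by (metis abs_of_pos norm_scaleR scaleR_diff_right)
    then show ?thesis
      unfolding Q_def using W a b by (intro bexI[of _ "a *\<^sub>R b"]) (auto simp: subspace_scale)
  qed
  have sub: "sublinear P"
    by (rule sublinear_Inf[of Q "norm" "\<lambda>_. 0", folded P_def]) (blast intro: 1 lb 2 3)+
  have sub_le: "\<And>v c. Q v c \<Longrightarrow> P v \<le> c"
    by (rule sublinear_Inf[of Q "norm" "\<lambda>_. 0", folded P_def]) (blast intro: 1 lb 2 3)+
  obtain e where e: "e > 0" "\<And>w. w \<in> W \<Longrightarrow> e \<le> norm (v - w)"
    using v unfolding closure_approachable by (auto simp: dist_norm norm_minus_commute not_less)
  have Pv: "e \<le> P v"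
    unfolding P_def using 1[of v] e(2) by (intro cInf_greatest) (auto simp: Q_def intro: order_trans)
  obtain F where F: "linear F" "\<And>u. F u \<le> P u" "F v = P v"
    using hahn_banach_sublinear[OF sub, of v] by blast
  have bound: "F u \<le> 1 * norm u" for u
    using F(2)[of u] sub_le[OF 1[of u]] by simp
  obtain \<zeta> where \<zeta>: "blinfun_apply \<zeta> = F"
    using linear_dominated_blinfun[OF F(1) bound] by auto
  show thesis
  proof (rule that[of \<zeta>])
    show "\<zeta> v \<noteq> 0" using F(3) Pv e by (auto simp: \<zeta>)
    fix w assume w: "w \<in> W"
    have "F u \<le> 0" if "u \<in> W" for u
    proof -
      have "Q u 0" unfolding Q_def using that by (intro bexI[of _ u]) auto
      then show ?thesis using F(2)[of u] sub_le[of u 0] by simp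
    qed
    from this[OF w] this[of "- w"] show "\<zeta> w = 0"
      using w W linear_neg[OF F(1), of w] by (simp add: \<zeta> subspace_neg)
  qed
qed

text \<open>
  Hahn-Banach dominates a functional on the dual space by \<open>\<zeta> \<mapsto> limsup \<zeta> (v n)\<close>; reflexivity makes it
  evaluation at a point. This avoids extracting a weakly convergent subsequence.
\<close>

lemma reflexive_weak_cluster_point:
  fixes v :: "nat \<Rightarrow> 'z::real_normed_vector"
  assumes refl: "reflexive_space TYPE('z)" and R: "\<And>n. norm (v n) \<le> R"
  obtains z where
    "\<And>(\<zeta> :: 'z \<Rightarrow>\<^sub>L real) c. \<forall>\<^sub>F n in sequentially. \<zeta> (v n) \<le> c \<Longrightarrow> \<zeta> z \<le> c"
proof -
  define Q where "Q \<zeta> c \<longleftrightarrow> (\<forall>\<^sub>F n in sequentially. blinfun_apply \<zeta> (v n) \<le> c)"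
    for \<zeta> :: "'z \<Rightarrow>\<^sub>L real" and c
  define P where "P \<zeta> = Inf {c. Q \<zeta> c}" for \<zeta>
  have bound: "\<bar>blinfun_apply \<zeta> (v n)\<bar> \<le> R * norm \<zeta>" for \<zeta> :: "'z \<Rightarrow>\<^sub>L real" and n
    using norm_blinfun[of \<zeta> "v n"] mult_left_mono[OF R[of n] norm_ge_zero[of \<zeta>]]
    by (simp add: mult.commute)
  have 1: "Q \<zeta> (R * norm \<zeta>)" for \<zeta>
    unfolding Q_def using bound[of \<zeta>] by (simp add: abs_le_iff)
  have lb: "- (R * norm \<zeta>) \<le> c" if Q: "Q \<zeta> c" for \<zeta> c
  proof -
    obtain n where "blinfun_apply \<zeta> (v n) \<le> c"
      using Q eventually_happens[of _ sequentially] unfolding Q_def by auto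
    then show ?thesis using bound[of \<zeta> n] by (simp add: abs_le_iff)
  qed
  have 2: "Q (\<zeta> + \<xi>) (c + d)" if "Q \<zeta> c" "Q \<xi> d" for \<zeta> \<xi> c d
    using that unfolding Q_def by eventually_elim (simp add: blinfun.add_left)
  have 3: "Q (a *\<^sub>R \<zeta>) (a * c)" if "a > 0" "Q \<zeta> c" for a \<zeta> c
    using that(2) unfolding Q_def
    by eventually_elim (use that(1) in \<open>simp add: blinfun.scaleR_left\<close>)
  have sub: "sublinear P"
    by (rule sublinear_Inf[of Q "\<lambda>\<zeta>. R * norm \<zeta>" "\<lambda>\<zeta>. - (R * norm \<zeta>)", folded P_def]) (blast intro: 1 lb 2 3)+
  have sub_le: "\<And>v c. Q v c \<Longrightarrow> P v \<le> c"
    by (rule sublinear_Inf[of Q "\<lambda>\<zeta>. R * norm \<zeta>" "\<lambda>\<zeta>. - (R * norm \<zeta>)", folded P_def]) (blast intro: 1 lb 2 3)+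
  obtain F where F: "linear F" "\<And>\<zeta>. F \<zeta> \<le> P \<zeta>"
    using hahn_banach_sublinear[OF sub] by blast
  have "F \<zeta> \<le> R * norm \<zeta>" for \<zeta>
    using F(2)[of \<zeta>] sub_le[OF 1[of \<zeta>]] by simp
  then obtain \<Phi> where \<Phi>: "blinfun_apply \<Phi> = F"
    using linear_dominated_blinfun[OF F(1)] by blast
  obtain z where z: "\<And>\<zeta>. blinfun_apply \<Phi> \<zeta> = blinfun_apply \<zeta> z"
    using refl unfolding reflexive_space_def by blast
  show thesis
  proof (rule that)
    fix \<zeta> :: "'z \<Rightarrow>\<^sub>L real" and c assume "\<forall>\<^sub>F n in sequentially. \<zeta> (v n) \<le> c"
    then show "\<zeta> z \<le> c"
      using F(2)[of \<zeta>] sub_le[of \<zeta> c] z[of \<zeta>] by (simp add: \<Phi> Q_def)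
  qed
qed

section \<open>Countable dense sets in a separable reflexive space and in its dual\<close>

lemma countable_dense_real_normed:
  obtains D :: "nat \<Rightarrow> 'z::{real_normed_vector, second_countable_topology}"
  where "\<And>z e. e > 0 \<Longrightarrow> \<exists>n. norm (z - D n) < e"
proof -
  obtain B :: "'z set" where B: "countable B" "\<And>U. open U \<Longrightarrow> U \<noteq> {} \<Longrightarrow> \<exists>d\<in>B. d \<in> U"
    using countable_dense_setE by blast
  show thesis
  proof (rule that)
    fix z :: 'z and e :: real assume "e > 0"
    then obtain d where "d \<in> B" "d \<in> ball z e" using B(2)[of "ball z e"] by auto
    moreover from \<open>d \<in> B\<close> have "d \<in> range (from_nat_into B)"
      using B(1) by (metis UNIV_I from_nat_into_to_nat_on image_eqI)
    ultimately show "\<exists>n. norm (z - from_nat_into B n) < e" by (auto simp: dist_norm)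
  qed
qed

text \<open>Rational combinations are indexed by lists of pairs, a countable type, so that a dense
  sequence can be read off with \<open>from_nat\<close>.\<close>

lemma rat_span_dense:
  fixes d :: "nat \<Rightarrow> 'a::real_normed_vector" and q :: "(rat \<times> nat) list \<Rightarrow> 'a"
  defines "q \<equiv> \<lambda>l. \<Sum>(r, n)\<leftarrow>l. real_of_rat r *\<^sub>R d n"
  assumes "z \<in> closure (span (range d))"
  shows "z \<in> closure (range q)"
proof -
  have "y \<in> closure (range q)" if "y \<in> span (range d)" for y
    using that
  proof (induction rule: span_induct_alt)
    case base
    have "q [] = 0" by (simp add: q_def)
    then show ?case by (metis closure_subset rangeI subsetD)
  next
    case (step c x y)
    from step(1) obtain n where n: "x = d n" by blast
    show ?case
      unfolding closure_approachable
    proof (intro allI impI)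
      fix e :: real assume e: "e > 0"
      obtain l where l: "dist (q l) y < e / 2"
        using step(2)[unfolded closure_approachable, rule_format, OF half_gt_zero[OF e]] by (elim bexE rangeE) simp
      define \<delta> where "\<delta> = e / (2 * (norm x + 1))"
      have x: "norm x + 1 > 0" using norm_ge_zero[of x] by linarith
      have \<delta>: "\<delta> > 0" unfolding \<delta>_def using e x by simp
      obtain r where r: "c - \<delta> < real_of_rat r" "real_of_rat r < c + \<delta>"
        using of_rat_dense[of "c - \<delta>" "c + \<delta>"] \<delta> by auto
      then have "norm ((real_of_rat r - c) *\<^sub>R x) \<le> \<delta> * norm x"
        by (simp add: mult_right_mono abs_le_iff)
      also have "\<dots> < \<delta> * (norm x + 1)" using \<delta> by simp
      also have "\<dots> = e / 2"
        unfolding \<delta>_def using x by (simp add: divide_simps)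
      finally have 1: "norm ((real_of_rat r - c) *\<^sub>R x) < e / 2" .
      have 2: "q ((r, n) # l) - (c *\<^sub>R x + y) = (real_of_rat r - c) *\<^sub>R x + (q l - y)"
        by (simp add: q_def n algebra_simps)
      then have "dist (q ((r, n) # l)) (c *\<^sub>R x + y) < e"
        using l 1 norm_triangle_ineq[of "(real_of_rat r - c) *\<^sub>R x" "q l - y"]
        by (simp only: dist_norm 2)
      then show "\<exists>b\<in>range q. dist b (c *\<^sub>R x + y) < e" by blast
    qed
  qed
  then have "closure (span (range d)) \<subseteq> closure (range q)"
    by (intro closure_minimal) auto
  with assms(2) show ?thesis by blast
qed

text \<open>Functionals \<open>N n\<close> norming a dense sequence span a dense subspace of the
  dual. Otherwise a nonzero \<Phi> vanishes on all of them and is, by reflexivity, evaluation at a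
  point \<open>z\<close>; a \<open>D n\<close> near \<open>z\<close> then has norm
  \<open>N n (D n - z)\<close>, which is small, so \<open>z = 0\<close>. The sequence is needed for
  Borel measurability of functions with values in the dual.\<close>

lemma separable_dual_of_reflexive:
  assumes refl: "reflexive_space TYPE('z::{real_normed_vector, second_countable_topology})"
  obtains E :: "nat \<Rightarrow> 'z::{real_normed_vector, second_countable_topology} \<Rightarrow>\<^sub>L real" where "\<And>\<zeta> e. e > 0 \<Longrightarrow> \<exists>n. norm (\<zeta> - E n) < e"
proof -
  obtain D :: "nat \<Rightarrow> 'z" where D: "\<And>z e. e > 0 \<Longrightarrow> \<exists>n. norm (z - D n) < e"
    using countable_dense_real_normed by blast
  have "\<forall>n. \<exists>\<zeta> :: 'z \<Rightarrow>\<^sub>L real. norm \<zeta> \<le> 1 \<and> blinfun_apply \<zeta> (D n) = norm (D n)"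
    using norming_functional by metis
  then obtain N :: "nat \<Rightarrow> 'z \<Rightarrow>\<^sub>L real" where N: "\<And>n. norm (N n) \<le> 1" "\<And>n. blinfun_apply (N n) (D n) = norm (D n)"
    by metis
  have dense: "\<zeta> \<in> closure (span (range N))" for \<zeta>
  proof (rule ccontr)
    assume "\<zeta> \<notin> closure (span (range N))"
    then obtain \<Phi> :: "('z \<Rightarrow>\<^sub>L real) \<Rightarrow>\<^sub>L real" where
      \<Phi>: "\<And>w. w \<in> span (range N) \<Longrightarrow> \<Phi> w = 0" "\<Phi> \<zeta> \<noteq> 0"
      using annihilator_separates[OF subspace_span] by metis
    obtain z where z: "\<And>\<zeta>. blinfun_apply \<Phi> \<zeta> = blinfun_apply \<zeta> z"
      using refl unfolding reflexive_space_def by blast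
    have "norm z \<le> 0 + e" if e: "e > 0" for e
    proof -
      obtain n where n: "norm (z - D n) < e / 2" using D[of "e / 2" z] e by auto
      have "N n z = 0" using \<Phi>(1)[of "N n"] z by (simp add: span_base)
      then have "norm (D n) = N n (D n - z)" by (simp add: N blinfun.diff_right)
      also have "\<dots> \<le> norm (D n - z)"
        using norm_blinfun[of "N n" "D n - z"] N(1)[of n] mult_right_mono[OF N(1)[of n], of "norm (D n - z)"]
        by (simp add: abs_le_iff)
      finally show ?thesis using n norm_triangle_ineq[of "z - D n" "D n"] by (simp add: norm_minus_commute)
    qed
    then have "z = 0" using field_le_epsilon[of "norm z" 0] by simp
    then show False using \<Phi>(2) z by (simp add: blinfun.zero_right)
  qed
  define q where "q l = (\<Sum>(r, n)\<leftarrow>l. real_of_rat r *\<^sub>R N n)" for l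
  show thesis
  proof (rule that[of "\<lambda>k. q (from_nat k)"])
    fix \<zeta> :: "'z \<Rightarrow>\<^sub>L real" and e :: real assume "e > 0"
    moreover have "\<zeta> \<in> closure (range q)"
      using rat_span_dense[OF dense] unfolding q_def .
    ultimately obtain l where "dist (q l) \<zeta> < e" unfolding closure_approachable by blast
    then show "\<exists>k. norm (\<zeta> - q (from_nat k)) < e"
      by (intro exI[of _ "to_nat l"]) (simp add: dist_norm norm_minus_commute)
  qed
qed

section \<open>Lebesgue-Bochner spaces\<close>

lemma powr_convex_nonneg:
  fixes u v a b p :: real
  assumes p: "1 \<le> p" and uv: "0 < u" "0 < v" "u + v = 1" and ab: "0 \<le> a" "0 \<le> b"
  shows "(u * a + v * b) powr p \<le> u * a powr p + v * b powr p"
proof -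
  have small: "(w * c) powr p \<le> w * c powr p" if w: "0 < w" "w \<le> 1" and "0 \<le> c" for w c :: real
  proof -
    have "w powr p \<le> w powr 1" using p w by (intro powr_mono') auto
    then show ?thesis using that by (simp add: powr_mult mult_right_mono)
  qed
  consider "a = 0" | "b = 0" | "a > 0" "b > 0" using ab by linarith
  then show ?thesis
  proof cases
    case 1 then show ?thesis using small[of v b] uv ab by simp
  next
    case 2 then show ?thesis using small[of u a] uv ab by simp
  next
    case 3
    moreover have u: "u = 1 - v" using uv by simp
    ultimately show ?thesis
      unfolding u using convex_onD[OF powr_convex[OF p], of v a b] uv by simp
  qed
qed

lemma conjugate_exponent_finite:
  assumes "conjugate_exponent p q" "1 < p"
  obtains r where "q = ereal r" "1 < r" "1 / p + 1 / r = 1"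
proof -
  have eq: "1 / ereal p + 1 / q = 1" using assms by (simp add: conjugate_exponent_def)
  show thesis
  proof (cases q)
    case (real r)
    have "r \<noteq> 0"
    proof
      assume "r = 0"
      moreover have "1 / ereal 0 = \<infinity>" by (simp add: divide_ereal_def flip: zero_ereal_def)
      ultimately have "1 / ereal p + \<infinity> = 1" using eq by (simp only: real)
      then show False by simp
    qed
    then have r: "1 / p + 1 / r = 1" using eq real assms(2) by (simp add: one_ereal_def)
    then have "1 / r > 0" "1 / r < 1"
      using r assms(2) divide_less_eq_1_pos[of p 1] divide_pos_pos[of 1 p] by linarith+
    then have "1 < r" by (simp add: field_simps split: if_splits)
    then show thesis using r real that by blast
  qed (use eq assms(2) in \<open>auto simp: one_ereal_def\<close>)
qed

section \<open>The p-norm: domination, linearity, the inequalities of Minkowski and Hoelder\<close>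

context
  fixes M :: "'t measure" and p :: real
  assumes p: "1 \<le> p"
begin

lemma Lp_iff:
  "f \<in> Lp_space M (ereal p) \<longleftrightarrow> f \<in> borel_measurable M \<and> integrable M (\<lambda>t. norm (f t) powr p)"
  by (simp add: Lp_space_def)

lemma Lp_norm_eq: "Lp_norm M (ereal p) f = (LINT t|M. norm (f t) powr p) powr (1 / p)"
  by (simp add: Lp_norm_def)

lemma Lp_norm_nonneg: "0 \<le> Lp_norm M (ereal p) f"
  by (simp add: Lp_norm_eq)

lemma Lp_norm_powr: "Lp_norm M (ereal p) f powr p = (LINT t|M. norm (f t) powr p)"
  using p by (simp add: Lp_norm_eq powr_powr integral_nonneg_AE)

lemma Lp_norm_le_iff:
  assumes "0 \<le> c"
  shows "Lp_norm M (ereal p) f \<le> c \<longleftrightarrow> (LINT t|M. norm (f t) powr p) \<le> c powr p"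
  unfolding Lp_norm_powr[symmetric] using p assms Lp_norm_nonneg[of f]
    powr_mono2[of p "Lp_norm M (ereal p) f" c] powr_less_mono2[of p c "Lp_norm M (ereal p) f"]
  by linarith

lemma Lp_measurable: "f \<in> Lp_space M (ereal p) \<Longrightarrow> f \<in> borel_measurable M"
  by (simp add: Lp_iff)

text \<open>\<open>f\<close> and \<open>g\<close> may take values in different spaces; vector
  functions are often dominated by scalar multiples of a weight.\<close>

lemma Lp_dominated:
  assumes g: "g \<in> Lp_space M (ereal p)" and f: "f \<in> borel_measurable M"
    and le: "AE t in M. norm (f t) \<le> norm (g t)"
  shows "f \<in> Lp_space M (ereal p)" "Lp_norm M (ereal p) f \<le> Lp_norm M (ereal p) g"
proof -
  have le': "AE t in M. norm (f t) powr p \<le> norm (g t) powr p"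
    using le by eventually_elim (use p in \<open>simp add: powr_mono2\<close>)
  have "integrable M (\<lambda>t. norm (f t) powr p)"
  proof (rule Bochner_Integration.integrable_bound)
    show "integrable M (\<lambda>t. norm (g t) powr p)" using g by (simp add: Lp_iff)
    show "AE t in M. norm (norm (f t) powr p) \<le> norm (norm (g t) powr p)" using le' by simp
  qed (use f in simp)
  then show "f \<in> Lp_space M (ereal p)" using f by (simp add: Lp_iff)
  with g le' show "Lp_norm M (ereal p) f \<le> Lp_norm M (ereal p) g"
    unfolding Lp_norm_eq using p
    by (intro powr_mono2 integral_mono_AE) (auto simp: Lp_iff integral_nonneg_AE)
qed

lemma Lp_cong_norm:
  assumes g: "g \<in> Lp_space M (ereal p)" and f: "f \<in> borel_measurable M"
    and eq: "AE t in M. norm (f t) = norm (g t)"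
  shows "Lp_norm M (ereal p) f = Lp_norm M (ereal p) g"
proof -
  have "f \<in> Lp_space M (ereal p)" "Lp_norm M (ereal p) f \<le> Lp_norm M (ereal p) g"
    by (rule Lp_dominated[OF g f], use eq in eventually_elim, simp)+
  moreover have "Lp_norm M (ereal p) g \<le> Lp_norm M (ereal p) f"
    by (rule Lp_dominated(2)[OF calculation(1)]) (use eq g in \<open>auto simp: Lp_iff\<close>)
  ultimately show ?thesis by simp
qed

lemma Lp_norm_zero_iff:
  assumes "f \<in> Lp_space M (ereal p)"
  shows "Lp_norm M (ereal p) f = 0 \<longleftrightarrow> (AE t in M. f t = 0)"
proof -
  have "Lp_norm M (ereal p) f = 0 \<longleftrightarrow> (LINT t|M. norm (f t) powr p) = 0"
    using p by (simp add: Lp_norm_eq)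
  also have "\<dots> \<longleftrightarrow> (AE t in M. norm (f t) powr p = 0)"
    using assms by (intro integral_nonneg_eq_0_iff_AE) (auto simp: Lp_iff)
  finally show ?thesis by simp
qed

lemma Lp_zero: "(\<lambda>_. 0) \<in> Lp_space M (ereal p)"
  by (simp add: Lp_iff)

lemma Lp_norm_zero: "Lp_norm M (ereal p) (\<lambda>_. 0) = 0"
  by (simp add: Lp_norm_zero_iff Lp_zero)

lemma Lp_scale:
  fixes f :: "'t \<Rightarrow> 'b::{real_normed_vector, second_countable_topology}"
  assumes "f \<in> Lp_space M (ereal p)"
  shows "(\<lambda>t. r *\<^sub>R f t) \<in> Lp_space M (ereal p)"
    and "Lp_norm M (ereal p) (\<lambda>t. r *\<^sub>R f t) = \<bar>r\<bar> * Lp_norm M (ereal p) f"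
  using assms p by (auto simp: Lp_iff Lp_norm_eq powr_mult powr_powr integral_nonneg_AE)

lemma Lp_add:
  fixes f g :: "'t \<Rightarrow> 'b::{real_normed_vector, second_countable_topology}"
  assumes f: "f \<in> Lp_space M (ereal p)" and g: "g \<in> Lp_space M (ereal p)"
  shows "(\<lambda>t. f t + g t) \<in> Lp_space M (ereal p)"
proof -
  have [measurable]: "f \<in> borel_measurable M" "g \<in> borel_measurable M"
    using f g by (auto simp: Lp_iff)
  have "integrable M (\<lambda>t. norm (f t + g t) powr p)"
  proof (rule Bochner_Integration.integrable_bound)
    show "integrable M (\<lambda>t. 2 powr p * (norm (f t) powr p + norm (g t) powr p))"
      using f g by (simp add: Lp_iff)
    have "norm (f t + g t) powr p \<le> 2 powr p * (norm (f t) powr p + norm (g t) powr p)" for t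
    proof -
      have "norm (f t + g t) \<le> 2 * max (norm (f t)) (norm (g t))"
        using norm_triangle_ineq[of "f t" "g t"] by linarith
      then have "norm (f t + g t) powr p \<le> (2 * max (norm (f t)) (norm (g t))) powr p"
        using p by (intro powr_mono2) auto
      also have "\<dots> = 2 powr p * max (norm (f t)) (norm (g t)) powr p"
        by (simp add: powr_mult max_def)
      also have "\<dots> \<le> 2 powr p * (norm (f t) powr p + norm (g t) powr p)"
        by (intro mult_left_mono) (auto simp: max_def)
      finally show ?thesis .
    qed
    then show "AE t in M. norm (norm (f t + g t) powr p)
        \<le> norm (2 powr p * (norm (f t) powr p + norm (g t) powr p))"
      by simp
  qed simp
  then show ?thesis by (simp add: Lp_iff)
qed

lemma Lp_diff:
  fixes f g :: "'t \<Rightarrow> 'b::{real_normed_vector, second_countable_topology}"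
  assumes "f \<in> Lp_space M (ereal p)" "g \<in> Lp_space M (ereal p)"
  shows "(\<lambda>t. f t - g t) \<in> Lp_space M (ereal p)"
  using Lp_add[OF assms(1) Lp_scale(1)[OF assms(2), of "-1"]] by simp

text \<open>With \<open>a\<close> and \<open>b\<close> the two norms,
  \<open>(f + g) / (a + b)\<close> is a convex combination of \<open>f / a\<close> and
  \<open>g / b\<close>, and convexity of the power bounds it by \<open>k\<close>, which has integral
  1. Vanishing norms are treated apart because of the division.\<close>

lemma Lp_triangle:
  fixes f g :: "'t \<Rightarrow> 'b::{real_normed_vector, second_countable_topology}"
  assumes f: "f \<in> Lp_space M (ereal p)" and g: "g \<in> Lp_space M (ereal p)"
  shows "Lp_norm M (ereal p) (\<lambda>t. f t + g t) \<le> Lp_norm M (ereal p) f + Lp_norm M (ereal p) g"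
proof -
  define a where "a = Lp_norm M (ereal p) f"
  define b where "b = Lp_norm M (ereal p) g"
  have [measurable]: "f \<in> borel_measurable M" "g \<in> borel_measurable M"
    using f g by (auto simp: Lp_iff)
  have nn: "0 \<le> a" "0 \<le> b" by (auto simp: a_def b_def Lp_norm_nonneg)
  consider "a = 0" | "b = 0" | "a > 0" "b > 0" using nn by linarith
  then have "Lp_norm M (ereal p) (\<lambda>t. f t + g t) \<le> a + b"
  proof cases
    case 1
    then have "AE t in M. f t = 0" using Lp_norm_zero_iff[OF f] by (simp add: a_def)
    then have "AE t in M. norm (f t + g t) = norm (g t)" by eventually_elim simp
    from Lp_cong_norm[OF g _ this] show ?thesis using nn by (simp add: b_def)
  next
    case 2
    then have "AE t in M. g t = 0" using Lp_norm_zero_iff[OF g] by (simp add: b_def)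
    then have "AE t in M. norm (f t + g t) = norm (f t)" by eventually_elim simp
    from Lp_cong_norm[OF f _ this] show ?thesis using nn by (simp add: a_def)
  next
    case 3
    define u where "u = a / (a + b)"
    define v where "v = b / (a + b)"
    have uv: "0 < u" "0 < v" "u + v = 1" using 3 by (simp_all add: u_def v_def flip: add_divide_distrib)
    define k where "k t = u * (norm (f t) powr p / a powr p) + v * (norm (g t) powr p / b powr p)" for t
    have k: "integrable M k" unfolding k_def using f g by (simp add: Lp_iff)
    have "LINT t|M. norm (f t) powr p = a powr p" "LINT t|M. norm (g t) powr p = b powr p"
      by (auto simp: a_def b_def Lp_norm_powr)
    then have int_k: "integral\<^sup>L M k = 1"
      unfolding k_def using f g 3 uv by (simp add: Lp_iff)
    have pt: "norm (f t + g t) powr p \<le> (a + b) powr p * k t" for t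
    proof -
      have "norm (f t + g t) \<le> (a + b) * (u * (norm (f t) / a) + v * (norm (g t) / b))"
      proof -
        have "(a + b) * u = a" "(a + b) * v = b" using 3 by (auto simp: u_def v_def)
        moreover have "(a + b) * (u * (norm (f t) / a) + v * (norm (g t) / b))
            = ((a + b) * u) * norm (f t) / a + ((a + b) * v) * norm (g t) / b"
          by (simp add: distrib_left)
        ultimately show ?thesis using 3 norm_triangle_ineq[of "f t" "g t"] by simp
      qed
      then have "norm (f t + g t) powr p
          \<le> ((a + b) * (u * (norm (f t) / a) + v * (norm (g t) / b))) powr p"
        using p by (intro powr_mono2) auto
      also have "\<dots> = (a + b) powr p * (u * (norm (f t) / a) + v * (norm (g t) / b)) powr p"
        by (rule powr_mult)
      also have "\<dots> \<le> (a + b) powr p * k t"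
        unfolding k_def using 3
          powr_convex_nonneg[OF p uv, of "norm (f t) / a" "norm (g t) / b"]
        by (auto simp: powr_divide intro!: mult_left_mono)
      finally show ?thesis .
    qed
    have "(LINT t|M. norm (f t + g t) powr p) \<le> (LINT t|M. (a + b) powr p * k t)"
      using Lp_add[OF f g] k pt by (intro integral_mono) (auto simp: Lp_iff)
    also have "\<dots> = (a + b) powr p" by (simp add: int_k)
    finally show ?thesis using nn by (subst Lp_norm_le_iff) auto
  qed
  then show ?thesis by (simp add: a_def b_def)
qed

lemma Lp_indicator:
  fixes f :: "'t \<Rightarrow> 'b::{real_normed_vector, second_countable_topology}"
  assumes f: "f \<in> Lp_space M (ereal p)" and A: "A \<in> sets M"
  shows "(\<lambda>t. indicator A t *\<^sub>R f t) \<in> Lp_space M (ereal p)"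
    and "Lp_norm M (ereal p) (\<lambda>t. indicator A t *\<^sub>R f t) \<le> Lp_norm M (ereal p) f"
proof -
  have [measurable]: "f \<in> borel_measurable M" "A \<in> sets M" using f A by (auto simp: Lp_iff)
  show "(\<lambda>t. indicator A t *\<^sub>R f t) \<in> Lp_space M (ereal p)"
    and "Lp_norm M (ereal p) (\<lambda>t. indicator A t *\<^sub>R f t) \<le> Lp_norm M (ereal p) f"
    by (rule Lp_dominated[OF f]; auto simp: indicator_def)+
qed

text \<open>Dominated convergence. The sets need not decrease: it is enough that almost every point
  leaves them eventually.\<close>

lemma Lp_norm_tendsto_zero:
  fixes f :: "'t \<Rightarrow> 'b::{real_normed_vector, second_countable_topology}"
  assumes f: "f \<in> Lp_space M (ereal p)" and A: "\<And>n. A n \<in> sets M"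
    and lim: "AE t in M. \<forall>\<^sub>F n in sequentially. t \<notin> A n"
  shows "(\<lambda>n. Lp_norm M (ereal p) (\<lambda>t. indicator (A n) t *\<^sub>R f t)) \<longlonglongrightarrow> 0"
proof -
  have [measurable]: "f \<in> borel_measurable M" "A n \<in> sets M" for n using f A by (auto simp: Lp_iff)
  have "(\<lambda>n. LINT t|M. norm (indicator (A n) t *\<^sub>R f t) powr p) \<longlonglongrightarrow> (LINT t|M. 0)"
  proof (rule integral_dominated_convergence)
    show "integrable M (\<lambda>t. norm (f t) powr p)" using f by (simp add: Lp_iff)
    show "AE t in M. (\<lambda>n. norm (indicator (A n) t *\<^sub>R f t) powr p) \<longlonglongrightarrow> 0"
      using lim
    proof eventually_elim
      case (elim t)
      then have "\<forall>\<^sub>F n in sequentially. norm (indicator (A n) t *\<^sub>R f t) powr p = 0"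
        by eventually_elim simp
      then show ?case by (rule tendsto_eventually)
    qed
    show "AE t in M. norm (norm (indicator (A n) t *\<^sub>R f t) powr p) \<le> norm (f t) powr p" for n
      by (auto simp: indicator_def)
  qed simp_all
  then have "(\<lambda>n. (LINT t|M. norm (indicator (A n) t *\<^sub>R f t) powr p) powr (1 / p)) \<longlonglongrightarrow> 0 powr (1 / p)"
    using p by (intro tendsto_powr') (auto simp: integral_nonneg_AE)
  then show ?thesis by (simp add: Lp_norm_eq)
qed

text \<open>The weight takes the place of an exhaustion by sets of finite measure in all later arguments.\<close>

lemma Lp_weight:
  assumes "sigma_finite_measure M"
  obtains w :: "'t \<Rightarrow> real" where "w \<in> Lp_space M (ereal p)" "Lp_norm M (ereal p) w \<le> 1" "\<And>t. w t > 0"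
proof -
  interpret sigma_finite_measure M by fact
  obtain h :: "'t \<Rightarrow> real" where h: "h \<in> borel_measurable M" "\<And>t. 0 < h t" "integrable M h"
    by (rule obtain_positive_integrable_function) blast
  \<comment> \<open>Division by \<open>c\<close> makes the integral of \<open>w powr p\<close> at
    most 1; the maximum with 1 keeps the divisor positive and bounded away from 0.\<close>
  define c where "c = max 1 (integral\<^sup>L M h)"
  have c: "c \<ge> 1" "integral\<^sup>L M h \<le> c" by (auto simp: c_def)
  define w where "w t = (h t / c) powr (1 / p)" for t
  have pw: "norm (w t) powr p = h t / c" for t
    using h(2)[of t] c p by (simp add: w_def powr_powr)
  have [measurable]: "h \<in> borel_measurable M" by fact
  show thesis
  proof
    have "w \<in> borel_measurable M" by (simp add: w_def[abs_def])
    moreover have "integrable M (\<lambda>t. norm (w t) powr p)" using h(3) by (simp only: pw) simp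
    ultimately show "w \<in> Lp_space M (ereal p)" by (simp add: Lp_iff)
    show "Lp_norm M (ereal p) w \<le> 1" using c by (simp add: Lp_norm_le_iff pw del: real_norm_def)
    show "w t > 0" for t using h(2)[of t] c by (simp add: w_def)
  qed
qed

text \<open>For \<open>p = 1\<close> the factor \<open>f\<close> is essentially bounded by its norm.
  Otherwise Young's inequality is applied to the functions divided by their norms, which gives a
  majorant \<open>k\<close> of integral \<open>1 / r + 1 / p = 1\<close>; vanishing norms are
  treated apart.\<close>

lemma Lp_holder:
  assumes q: "conjugate_exponent p q" and f: "f \<in> Lp_space M q" and g: "g \<in> Lp_space M (ereal p)"
  shows "integrable M (\<lambda>t. norm (f t) * norm (g t))"
    and "(LINT t|M. norm (f t) * norm (g t)) \<le> Lp_norm M q f * Lp_norm M (ereal p) g"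
proof -
  have [measurable]: "f \<in> borel_measurable M" "g \<in> borel_measurable M"
    using f g by (auto simp: Lp_space_def)
  have "integrable M (\<lambda>t. norm (f t) * norm (g t)) \<and>
    (LINT t|M. norm (f t) * norm (g t)) \<le> Lp_norm M q f * Lp_norm M (ereal p) g"
  proof (cases "p = 1")
    case True
    then have [simp]: "q = \<infinity>" using q by (simp add: conjugate_exponent_def)
    define c where "c = Lp_norm M q f"
    have fin: "esssup M (\<lambda>t. ennreal (norm (f t))) < \<infinity>" using f by (simp add: Lp_space_def)
    have "AE t in M. norm (f t) \<le> c"
      using esssup_AE[where M = M and f = "\<lambda>t. ennreal (norm (f t))"]
    proof eventually_elim
      case (elim t)
      then have "ennreal (norm (f t)) \<le> ennreal c"
        using fin by (simp add: c_def Lp_norm_def)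
      then show ?case by (simp add: c_def Lp_norm_def)
    qed
    then have le: "AE t in M. norm (f t) * norm (g t) \<le> c * norm (g t)"
      by eventually_elim (simp add: mult_right_mono)
    have g': "integrable M (\<lambda>t. norm (g t))" using g[unfolded Lp_iff] True by simp
    then have int: "integrable M (\<lambda>t. c * norm (g t))" by simp
    have int': "integrable M (\<lambda>t. norm (f t) * norm (g t))"
    proof (rule Bochner_Integration.integrable_bound[OF int])
      show "AE t in M. norm (norm (f t) * norm (g t)) \<le> norm (c * norm (g t))"
        using le by eventually_elim (simp add: order_trans[OF _ abs_ge_self])
    qed simp
    moreover have "(LINT t|M. norm (f t) * norm (g t)) \<le> (LINT t|M. c * norm (g t))"
      by (rule integral_mono_AE[OF int' int le])
    ultimately show ?thesis
      using True Lp_norm_eq[of g] by (simp add: c_def integral_nonneg_AE)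
  next
    case False
    then have "1 < p" using p by simp
    with q obtain r where r: "q = ereal r" "1 < r" "1 / p + 1 / r = 1"
      using conjugate_exponent_finite by blast
    define a where "a = Lp_norm M q f"
    define b where "b = Lp_norm M (ereal p) g"
    have fr: "integrable M (\<lambda>t. norm (f t) powr r)" using f r by (simp add: Lp_space_def)
    have gp: "integrable M (\<lambda>t. norm (g t) powr p)" using g by (simp add: Lp_iff)
    have ar: "a = (LINT t|M. norm (f t) powr r) powr (1 / r)" by (simp add: a_def r Lp_norm_def)
    have apr: "a powr r = (LINT t|M. norm (f t) powr r)"
      using r by (simp add: ar powr_powr integral_nonneg_AE)
    have bpp: "b powr p = (LINT t|M. norm (g t) powr p)" by (simp add: b_def Lp_norm_powr)
    have nn: "0 \<le> a" "0 \<le> b" by (auto simp: ar b_def Lp_norm_nonneg)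
    consider "a = 0" | "b = 0" | "a > 0" "b > 0" using nn by linarith
    then show ?thesis
    proof cases
      case 1
      then have "AE t in M. norm (f t) powr r = 0"
        using apr fr r by (subst (asm) eq_commute) (simp add: integral_nonneg_eq_0_iff_AE)
      then have 0: "AE t in M. norm (f t) * norm (g t) = 0" by eventually_elim simp
      have "integrable M (\<lambda>t. norm (f t) * norm (g t)) = integrable M (\<lambda>t. 0 :: real)"
        "(LINT t|M. norm (f t) * norm (g t)) = (LINT t|M. 0)"
        by (rule integrable_cong_AE integral_cong_AE; use 0 in simp)+
      then show ?thesis using nn by (simp flip: a_def b_def)
    next
      case 2
      then have "AE t in M. g t = 0" using Lp_norm_zero_iff[OF g] by (simp add: b_def)
      then have 0: "AE t in M. norm (f t) * norm (g t) = 0" by eventually_elim simp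
      have "integrable M (\<lambda>t. norm (f t) * norm (g t)) = integrable M (\<lambda>t. 0 :: real)"
        "(LINT t|M. norm (f t) * norm (g t)) = (LINT t|M. 0)"
        by (rule integrable_cong_AE integral_cong_AE; use 0 in simp)+
      then show ?thesis using nn by (simp flip: a_def b_def)
    next
      case 3
      define k where "k t = (norm (f t) powr r / a powr r) / r + (norm (g t) powr p / b powr p) / p" for t
      have k: "integrable M k" unfolding k_def using fr gp by simp
      have int_k: "integral\<^sup>L M k = 1"
        unfolding k_def using fr gp 3 r by (simp add: apr[symmetric] bpp[symmetric])
      have pt: "norm (f t) * norm (g t) \<le> a * b * k t" for t
      proof -
        have "(norm (f t) / a) * (norm (g t) / b) \<le> k t"
          unfolding k_def using Youngs_inequality[of r p "norm (f t) / a" "norm (g t) / b"] r \<open>1 < p\<close> 3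
          by (simp add: powr_divide add.commute)
        then show ?thesis using 3 by (simp add: field_simps)
      qed
      have int: "integrable M (\<lambda>t. norm (f t) * norm (g t))"
      proof (rule Bochner_Integration.integrable_bound)
        show "integrable M (\<lambda>t. a * b * k t)" using k by simp
        show "AE t in M. norm (norm (f t) * norm (g t)) \<le> norm (a * b * k t)"
          using order_trans[OF pt abs_ge_self] by simp
      qed simp
      have "(LINT t|M. norm (f t) * norm (g t)) \<le> (LINT t|M. a * b * k t)"
        using k pt by (intro integral_mono int) auto
      then show ?thesis using int int_k by (simp add: a_def b_def)
    qed
  qed
  then show "integrable M (\<lambda>t. norm (f t) * norm (g t))"
    and "(LINT t|M. norm (f t) * norm (g t)) \<le> Lp_norm M q f * Lp_norm M (ereal p) g"
    by auto
qed

end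

section \<open>Measurable selections\<close>

text \<open>An open set is the union of countably many closed balls with centres \<open>D n\<close>
  and radii \<open>1 / (k + 1)\<close>. Closed balls matter because weak compactness decides whether
  a tangent cone meets one.\<close>

lemma sets_open_from_cballs:
  fixes \<Gamma> :: "'t \<Rightarrow> 'z::real_normed_vector set" and D :: "nat \<Rightarrow> 'z"
  assumes D: "\<And>z e. e > 0 \<Longrightarrow> \<exists>n. norm (z - D n) < e"
    and ball: "\<And>z r. r > 0 \<Longrightarrow> {t \<in> space M. \<Gamma> t \<inter> cball z r \<noteq> {}} \<in> sets M"
    and U: "open U"
  shows "{t \<in> space M. \<Gamma> t \<inter> U \<noteq> {}} \<in> sets M"
proof -
  define I where "I = {(n, k). cball (D n) (1 / real (Suc k)) \<subseteq> U}"
  have cover: "\<exists>i\<in>I. z \<in> cball (D (fst i)) (1 / real (Suc (snd i)))" if z: "z \<in> U" for z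
  proof -
    obtain e where e: "e > 0" "ball z e \<subseteq> U" using U z openE by blast
    obtain k where k: "1 / real (Suc k) < e / 2"
      using nat_approx_posE[of "e / 2"] e(1) by auto
    obtain n where n: "norm (z - D n) < 1 / real (Suc k)" using D[of "1 / real (Suc k)" z] by auto
    have "cball (D n) (1 / real (Suc k)) \<subseteq> ball z e"
    proof
      fix y assume "y \<in> cball (D n) (1 / real (Suc k))"
      then have "dist (D n) y \<le> 1 / real (Suc k)" by simp
      moreover have "dist z y \<le> dist z (D n) + dist (D n) y" by (rule dist_triangle)
      ultimately show "y \<in> ball z e" using n k by (simp add: dist_norm)
    qed
    then have "(n, k) \<in> I" using e by (auto simp: I_def)
    moreover have "z \<in> cball (D n) (1 / real (Suc k))" using n by (simp add: dist_norm norm_minus_commute)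
    ultimately show ?thesis by force
  qed
  have "{t \<in> space M. \<Gamma> t \<inter> U \<noteq> {}}
      = (\<Union>i\<in>I. {t \<in> space M. \<Gamma> t \<inter> cball (D (fst i)) (1 / real (Suc (snd i))) \<noteq> {}})"
    (is "?L = ?R")
  proof
    show "?L \<subseteq> ?R" using cover by fastforce
    show "?R \<subseteq> ?L" by (auto simp: I_def)
  qed
  also have "\<dots> \<in> sets M" by (intro sets.countable_UN'' ball) auto
  finally show ?thesis .
qed

text \<open>No index is required to exist. The function stays measurable where \<open>P\<close>
  fails for every \<open>n\<close>, so first choices that make sense only on part of the space can
  be used and cut off afterwards.\<close>

lemma measurable_first_index:
  fixes D :: "nat \<Rightarrow> 't \<Rightarrow> 'z::topological_space"
  assumes P: "\<And>n. {t \<in> space M. P n t} \<in> sets M" and D: "\<And>n. D n \<in> borel_measurable M"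
  shows "(\<lambda>t. D (LEAST n. P n t) t) \<in> borel_measurable M"
proof -
  have [measurable]: "Measurable.pred M (P n)" for n using P by (simp add: pred_def)
  have "(\<lambda>t. LEAST n. P n t) \<in> measurable M (count_space UNIV)" by measurable
  then show ?thesis by (rule measurable_compose_countable[OF D])
qed

text \<open>The construction of Kuratowski and Ryll-Nardzewski: the approximants \<open>s j\<close>
  take values in a dense sequence, come within \<open>r j\<close> of \<open>\<Gamma> t\<close>, and
  consecutive ones differ by less than \<open>2 * r j\<close>. They therefore converge, and the
  limit lies in the closed set.\<close>

lemma measurable_selection:
  fixes \<Gamma> :: "'t \<Rightarrow> 'z::{banach, second_countable_topology} set"
  assumes meas: "\<And>U. open U \<Longrightarrow> {t \<in> space M. \<Gamma> t \<inter> U \<noteq> {}} \<in> sets M"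
    and ne: "\<And>t. t \<in> space M \<Longrightarrow> \<Gamma> t \<noteq> {}" and closed: "\<And>t. t \<in> space M \<Longrightarrow> closed (\<Gamma> t)"
  obtains s where "s \<in> borel_measurable M" "\<And>t. t \<in> space M \<Longrightarrow> s t \<in> \<Gamma> t"
proof -
  obtain D :: "nat \<Rightarrow> 'z" where D: "\<And>z e. e > 0 \<Longrightarrow> \<exists>n. norm (z - D n) < e"
    using countable_dense_real_normed by blast
  define r :: "nat \<Rightarrow> real" where "r j = (1 / 2) ^ j" for j
  have r: "r j > 0" "r (Suc j) = r j / 2" for j by (auto simp: r_def)
  \<comment> \<open>The factor 2 guarantees an index: if \<open>z\<close> in
    \<open>\<Gamma> t\<close> is within \<open>r j\<close> of \<open>f t\<close> and
    \<open>D n\<close> is within \<open>r (Suc j)\<close> of \<open>z\<close>, then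
    \<open>D n\<close> is within \<open>3 / 2 * r j\<close> of \<open>f t\<close>.\<close>
  define P where "P j f n t \<longleftrightarrow> \<Gamma> t \<inter> ball (D n) (r (Suc j)) \<noteq> {} \<and> D n \<in> ball (f t) (2 * r j)"
    for j f n t
  define s where "s = rec_nat (\<lambda>t. D (LEAST n. \<Gamma> t \<inter> ball (D n) (r 0) \<noteq> {}))
    (\<lambda>j f t. D (LEAST n. P j f n t))"
  have s0: "s 0 = (\<lambda>t. D (LEAST n. \<Gamma> t \<inter> ball (D n) (r 0) \<noteq> {}))" by (simp add: s_def)
  have sSuc: "s (Suc j) = (\<lambda>t. D (LEAST n. P j (s j) n t))" for j by (simp add: s_def)
  have near: "\<exists>n. z \<in> ball (D n) e" if "e > 0" for z e
    using D[OF that, of z] by (auto simp: dist_norm norm_minus_commute)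
  have s_meas: "s j \<in> borel_measurable M" for j
  proof (induction j)
    case 0
    show ?case unfolding s0 by (rule measurable_first_index[where D = "\<lambda>n _. D n"]) (auto intro: meas)
  next
    case (Suc j)
    have [measurable]: "s j \<in> borel_measurable M" by fact
    have "{t \<in> space M. P j (s j) n t} \<in> sets M" for n
    proof -
      have "{t \<in> space M. P j (s j) n t} = {t \<in> space M. \<Gamma> t \<inter> ball (D n) (r (Suc j)) \<noteq> {}}
          \<inter> {t \<in> space M. dist (s j t) (D n) < 2 * r j}" by (auto simp: P_def)
      also have "\<dots> \<in> sets M" by (intro sets.Int meas) auto
      finally show ?thesis .
    qed
    then show ?case unfolding sSuc by (intro measurable_first_index[where D = "\<lambda>n _. D n"]) auto
  qed
  have hit: "\<Gamma> t \<inter> ball (s j t) (r j) \<noteq> {}" if t: "t \<in> space M" for j t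
  proof (induction j)
    case 0
    obtain z where "z \<in> \<Gamma> t" using ne[OF t] by blast
    then have "\<exists>n. \<Gamma> t \<inter> ball (D n) (r 0) \<noteq> {}" using near[OF r(1)[of 0], of z] by blast
    then show ?case unfolding s0 by (rule LeastI_ex)
  next
    case (Suc j)
    then obtain z where z: "z \<in> \<Gamma> t" "dist (s j t) z < r j" by auto
    obtain n where n: "z \<in> ball (D n) (r (Suc j))" using near[OF r(1)] by blast
    have "dist (s j t) (D n) \<le> dist (s j t) z + dist z (D n)" by (rule dist_triangle)
    then have "P j (s j) n t" using z n r(1)[of j] r(2)[of j] by (auto simp: P_def dist_commute)
    then have "P j (s j) (LEAST n. P j (s j) n t) t" by (rule LeastI)
    then show ?case unfolding sSuc P_def by blast
  qed
  have step: "dist (s j t) (s (Suc j) t) < 2 * r j" if t: "t \<in> space M" for j t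
  proof -
    obtain z where z: "z \<in> \<Gamma> t" "dist (s j t) z < r j" using hit[OF t, of j] by auto
    obtain n where n: "z \<in> ball (D n) (r (Suc j))" using near[OF r(1)] by blast
    have "dist (s j t) (D n) \<le> dist (s j t) z + dist z (D n)" by (rule dist_triangle)
    then have "P j (s j) n t" using z n r(1)[of j] r(2)[of j] by (auto simp: P_def dist_commute)
    then have "P j (s j) (LEAST n. P j (s j) n t) t" by (rule LeastI)
    then show ?thesis unfolding sSuc P_def by simp
  qed
  have lim: "(\<lambda>j. s j t) \<longlonglongrightarrow> lim (\<lambda>j. s j t)" if t: "t \<in> space M" for t
  proof -
    have "summable (\<lambda>j. s (Suc j) t - s j t)"
    proof (rule summable_comparison_test')
      show "summable (\<lambda>j. 2 * r j)" unfolding r_def by (intro summable_mult summable_geometric) simp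
      show "norm (s (Suc j) t - s j t) \<le> 2 * r j" if "j \<ge> 0" for j
        using step[OF t, of j] by (simp add: dist_norm norm_minus_commute)
    qed
    then have "convergent (\<lambda>n. \<Sum>j<n. s (Suc j) t - s j t)" by (rule summable_iff_convergent[THEN iffD1])
    then have "convergent (\<lambda>n. s n t - s 0 t)" by (simp only: sum_lessThan_telescope[of "\<lambda>j. s j t"])
    then have "convergent (\<lambda>n. s n t - s 0 t + s 0 t)" by (intro convergent_add convergent_const)
    then show ?thesis by (simp add: convergent_LIMSEQ_iff)
  qed
  show thesis
  proof
    show "(\<lambda>t. lim (\<lambda>j. s j t)) \<in> borel_measurable M"
      by (rule borel_measurable_LIMSEQ_metric[OF s_meas lim])
    fix t assume t: "t \<in> space M"
    have "\<forall>j. \<exists>z. z \<in> \<Gamma> t \<and> dist (s j t) z < r j" using hit[OF t] by (force simp: set_eq_iff)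
    then obtain z where z: "\<And>j. z j \<in> \<Gamma> t" "\<And>j. dist (s j t) (z j) < r j" by metis
    have r0: "r \<longlonglongrightarrow> 0" unfolding r_def[abs_def] by (intro LIMSEQ_power_zero) simp
    have "(\<lambda>j. dist (s j t) (z j)) \<longlonglongrightarrow> 0"
      by (rule tendsto_sandwich[OF _ _ tendsto_const r0]) (use z(2) in \<open>auto intro!: always_eventually less_imp_le\<close>)
    then have "(\<lambda>j. z j - s j t) \<longlonglongrightarrow> 0"
      unfolding dist_norm norm_minus_commute[of "s _ t"] by (rule tendsto_norm_zero_cancel)
    then have "z \<longlonglongrightarrow> lim (\<lambda>j. s j t)"
      by (rule Lim_transform[OF lim[OF t]])
    then show "lim (\<lambda>j. s j t) \<in> \<Gamma> t"
      using closed_sequentially[OF closed[OF t]] z(1) by blast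
  qed
qed

text \<open>For each basic ball \<open>B n k\<close> there is a selection lying in the closure of
  the ball whenever \<open>\<Gamma> t\<close> meets the ball. Small balls containing
  \<open>z\<close> then give values close to \<open>z\<close>.\<close>

lemma castaing_representation:
  fixes \<Gamma> :: "'t \<Rightarrow> 'z::{banach, second_countable_topology} set"
  assumes meas: "\<And>U. open U \<Longrightarrow> {t \<in> space M. \<Gamma> t \<inter> U \<noteq> {}} \<in> sets M"
    and ne: "\<And>t. t \<in> space M \<Longrightarrow> \<Gamma> t \<noteq> {}" and closed: "\<And>t. t \<in> space M \<Longrightarrow> closed (\<Gamma> t)"
  obtains s :: "nat \<Rightarrow> 't \<Rightarrow> 'z" where "\<And>n. s n \<in> borel_measurable M"
    "\<And>n t. t \<in> space M \<Longrightarrow> s n t \<in> \<Gamma> t"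
    "\<And>t z e. t \<in> space M \<Longrightarrow> z \<in> \<Gamma> t \<Longrightarrow> e > 0 \<Longrightarrow> \<exists>n. dist (s n t) z < e"
proof -
  obtain D :: "nat \<Rightarrow> 'z" where D: "\<And>z e. e > 0 \<Longrightarrow> \<exists>n. norm (z - D n) < e"
    using countable_dense_real_normed by blast
  define B where "B n k = ball (D n) (1 / real (Suc k))" for n k
  have "\<exists>s. s \<in> borel_measurable M \<and>
      (\<forall>t\<in>space M. s t \<in> \<Gamma> t \<and> (\<Gamma> t \<inter> B n k \<noteq> {} \<longrightarrow> s t \<in> closure (B n k)))" for n k
  proof -
    \<comment> \<open>The closure makes the values closed. An open set meets it exactly when it
      meets \<open>\<Gamma> t \<inter> B n k\<close>, so measurability reduces to open sets hit by
      \<Gamma>.\<close>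
    define \<Delta> where "\<Delta> t = (if \<Gamma> t \<inter> B n k \<noteq> {} then closure (\<Gamma> t \<inter> B n k) else \<Gamma> t)" for t
    have B: "open (B n k)" by (simp add: B_def)
    have "{t \<in> space M. \<Delta> t \<inter> U \<noteq> {}} \<in> sets M" if U: "open U" for U
    proof -
      have "\<Delta> t \<inter> U \<noteq> {} \<longleftrightarrow> \<Gamma> t \<inter> (B n k \<inter> U) \<noteq> {} \<or> \<Gamma> t \<inter> U \<noteq> {} \<and> \<not> \<Gamma> t \<inter> B n k \<noteq> {}" for t
        using open_Int_closure_eq_empty[OF U, of "\<Gamma> t \<inter> B n k"]
        by (cases "\<Gamma> t \<inter> B n k = {}") (simp_all add: \<Delta>_def Int_ac)
      then show ?thesis
        using U B by (simp only:) (intro sets.sets_Collect_disj sets.sets_Collect_conj sets.sets_Collect_neg meas open_Int)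
    qed
    moreover have "\<Delta> t \<noteq> {}" "closed (\<Delta> t)" if "t \<in> space M" for t
      using ne[OF that] closed[OF that] by (auto simp: \<Delta>_def)
    ultimately obtain s where s: "s \<in> borel_measurable M" "\<And>t. t \<in> space M \<Longrightarrow> s t \<in> \<Delta> t"
      using measurable_selection[of M \<Delta>] by blast
    have "s t \<in> \<Gamma> t \<and> (\<Gamma> t \<inter> B n k \<noteq> {} \<longrightarrow> s t \<in> closure (B n k))" if t: "t \<in> space M" for t
    proof -
      have "closure (\<Gamma> t \<inter> B n k) \<subseteq> \<Gamma> t" by (rule closure_minimal[OF Int_lower1 closed[OF t]])
      moreover have "closure (\<Gamma> t \<inter> B n k) \<subseteq> closure (B n k)" by (rule closure_mono[OF Int_lower2])
      ultimately show ?thesis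
        using s(2)[OF t] unfolding \<Delta>_def by (cases "\<Gamma> t \<inter> B n k = {}") (simp, simp, blast)
    qed
    with s(1) show ?thesis by blast
  qed
  then obtain s where s: "\<And>n k. s n k \<in> borel_measurable M"
    "\<And>n k t. t \<in> space M \<Longrightarrow> s n k t \<in> \<Gamma> t"
    "\<And>n k t. t \<in> space M \<Longrightarrow> \<Gamma> t \<inter> B n k \<noteq> {} \<Longrightarrow> s n k t \<in> closure (B n k)" by metis
  show thesis
  proof (rule that[of "\<lambda>i. s (fst (prod_decode i)) (snd (prod_decode i))"])
    fix t z and e :: real assume t: "t \<in> space M" and z: "z \<in> \<Gamma> t" and e: "e > 0"
    obtain k where k: "1 / real (Suc k) < e / 2"
      using nat_approx_posE[of "e / 2"] e by auto
    obtain n where n: "norm (z - D n) < 1 / real (Suc k)" using D[of "1 / real (Suc k)" z] by auto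
    have zB: "z \<in> B n k" using n by (simp add: B_def dist_norm norm_minus_commute)
    with z have "s n k t \<in> closure (B n k)" using s(3)[OF t] by blast
    also have "\<dots> \<subseteq> cball (D n) (1 / real (Suc k))" unfolding B_def by (intro closure_minimal) auto
    finally have "dist (D n) (s n k t) \<le> 1 / real (Suc k)" by simp
    moreover have "dist (s n k t) z \<le> dist (s n k t) (D n) + dist (D n) z" by (rule dist_triangle)
    ultimately have "dist (s n k t) z < e"
      using n k by (simp add: dist_commute dist_norm norm_minus_commute)
    then show "\<exists>i. dist (s (fst (prod_decode i)) (snd (prod_decode i)) t) z < e"
      by (intro exI[of _ "prod_encode (n, k)"]) simp
  qed (use s in auto)
qed

section \<open>Clarke tangent cones through distance estimates\<close>

text \<open>One radius bounds both the distance of \<open>y\<close> from \<open>x\<close> and the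
  step size, so that it can be taken of the form \<open>1 / (k + 1)\<close>. Both bounds are strict,
  hence stable under small perturbations, which permits testing on countable sets.\<close>

definition tangent_within :: "'z::real_normed_vector set \<Rightarrow> 'z \<Rightarrow> 'z \<Rightarrow> real \<Rightarrow> real \<Rightarrow> bool" where
  "tangent_within C x v c \<delta> \<longleftrightarrow>
     (\<forall>y\<in>C. \<forall>\<eta>. norm (y - x) < \<delta> \<longrightarrow> 0 < \<eta> \<longrightarrow> \<eta> < \<delta> \<longrightarrow> infdist (y + \<eta> *\<^sub>R v) C \<le> c * \<eta>)"

definition tangent_bound :: "'z::real_normed_vector set \<Rightarrow> 'z \<Rightarrow> 'z \<Rightarrow> real \<Rightarrow> bool" where
  "tangent_bound C x v c \<longleftrightarrow> (\<exists>\<delta>>0. tangent_within C x v c \<delta>)"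

text \<open>For \<open>x\<close> in \<open>C\<close> this is the upper limit of
  \<open>infdist (y + \<eta> *\<^sub>R v) C / \<eta>\<close> as \<open>y\<close> tends to
  \<open>x\<close> within \<open>C\<close> and \<eta> decreases to 0. Clarke's cone is the set where
  it is at most 0. Requiring the bound for all \<open>d > c\<close> avoids asking whether the best
  constant is attained.\<close>

definition tangent_gauge :: "'z::real_normed_vector set \<Rightarrow> 'z \<Rightarrow> 'z \<Rightarrow> real" where
  "tangent_gauge C x v = Inf {c. \<forall>d>c. tangent_bound C x v d}"

lemma infdist_lessD:
  assumes "infdist z C < a" "C \<noteq> {}"
  obtains c where "c \<in> C" "dist z c < a"
proof -
  have "\<exists>c\<in>C. dist z c < a"
  proof (rule ccontr)
    assume "\<not> ?thesis"
    then have "a \<le> infdist z C"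
      unfolding infdist_notempty[OF assms(2)] by (intro cINF_greatest assms(2)) (auto simp: not_less)
    with assms(1) show False by simp
  qed
  then show thesis using that by blast
qed

lemma infdist_le_norm: "c \<in> C \<Longrightarrow> infdist z C \<le> norm (z - c)"
  using infdist_le[of c C z] by (simp add: dist_norm)

lemma tangent_within_antimono: "tangent_within C x v c \<delta> \<Longrightarrow> \<delta>' \<le> \<delta> \<Longrightarrow> tangent_within C x v c \<delta>'"
  unfolding tangent_within_def by (meson less_le_trans)

text \<open>Makes the quantifier over radii countable, as measurability in \<open>t\<close>
  requires.\<close>

lemma tangent_bound_iff_nat: "tangent_bound C x v c \<longleftrightarrow> (\<exists>k::nat. tangent_within C x v c (1 / real (Suc k)))"
proof
  assume "tangent_bound C x v c"
  then obtain \<delta> where \<delta>: "\<delta> > 0" "tangent_within C x v c \<delta>" unfolding tangent_bound_def by blast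
  obtain k where "1 / real (Suc k) < \<delta>" using nat_approx_posE[OF \<delta>(1)] by blast
  then show "\<exists>k. tangent_within C x v c (1 / real (Suc k))"
    using tangent_within_antimono[OF \<delta>(2)] less_imp_le by blast
next
  assume "\<exists>k. tangent_within C x v c (1 / real (Suc k))"
  then obtain k where "tangent_within C x v c (1 / real (Suc k))" ..
  moreover have "1 / real (Suc k) > 0" by simp
  ultimately show "tangent_bound C x v c" unfolding tangent_bound_def by blast
qed

lemma tangent_bound_mono:
  assumes "tangent_bound C x v c" "c \<le> d"
  shows "tangent_bound C x v d"
proof -
  obtain \<delta> where \<delta>: "\<delta> > 0" "\<And>y \<eta>. y \<in> C \<Longrightarrow> norm (y - x) < \<delta> \<Longrightarrow> 0 < \<eta> \<Longrightarrow> \<eta> < \<delta> \<Longrightarrow>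
      infdist (y + \<eta> *\<^sub>R v) C \<le> c * \<eta>"
    using assms(1) unfolding tangent_bound_def tangent_within_def by blast
  have "infdist (y + \<eta> *\<^sub>R v) C \<le> d * \<eta>" if "y \<in> C" "norm (y - x) < \<delta>" "0 < \<eta>" "\<eta> < \<delta>" for y \<eta>
    using \<delta>(2)[OF that] mult_right_mono[OF assms(2), of \<eta>] that by linarith
  with \<delta>(1) show ?thesis unfolding tangent_bound_def tangent_within_def by blast
qed

lemma tangent_bound_norm: "tangent_bound C x v (norm v)"
  unfolding tangent_bound_def tangent_within_def
proof (intro exI[of _ 1] conjI ballI allI impI)
  fix y and \<eta> :: real assume "y \<in> C" "0 < \<eta>"
  then show "infdist (y + \<eta> *\<^sub>R v) C \<le> norm v * \<eta>"
    using infdist_le_norm[of y C "y + \<eta> *\<^sub>R v"] by (simp add: mult.commute)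
qed simp

lemma tangent_bound_nonneg:
  assumes "tangent_bound C x v c" "x \<in> C"
  shows "0 \<le> c"
proof -
  obtain \<delta> where \<delta>: "\<delta> > 0" "\<And>y \<eta>. y \<in> C \<Longrightarrow> norm (y - x) < \<delta> \<Longrightarrow> 0 < \<eta> \<Longrightarrow> \<eta> < \<delta> \<Longrightarrow>
      infdist (y + \<eta> *\<^sub>R v) C \<le> c * \<eta>"
    using assms(1) unfolding tangent_bound_def tangent_within_def by blast
  have "0 \<le> c * (\<delta> / 2)"
    using \<delta>(1) assms(2) by (intro order_trans[OF infdist_nonneg \<delta>(2)[of x]]) auto
  then show ?thesis using \<delta>(1) by (simp add: zero_le_mult_iff)
qed

text \<open>A step along \<open>v + w\<close> is a step along \<open>v\<close>, a move to a nearby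
  point \<open>z\<close> of \<open>C\<close>, and a step along \<open>w\<close> from
  \<open>z\<close>. The slack in \<open>c + d < e\<close> compensates that the distance to
  \<open>C\<close> need not be attained.\<close>

lemma tangent_bound_add:
  assumes v: "tangent_bound C x v c" and w: "tangent_bound C x w d" and e: "c + d < e" and x: "x \<in> C"
  shows "tangent_bound C x (v + w) e"
proof -
  obtain \<delta>1 where 1: "\<delta>1 > 0" "\<And>y \<eta>. y \<in> C \<Longrightarrow> norm (y - x) < \<delta>1 \<Longrightarrow> 0 < \<eta> \<Longrightarrow> \<eta> < \<delta>1 \<Longrightarrow>
      infdist (y + \<eta> *\<^sub>R v) C \<le> c * \<eta>"
    using v unfolding tangent_bound_def tangent_within_def by blast
  obtain \<delta>2 where 2: "\<delta>2 > 0" "\<And>y \<eta>. y \<in> C \<Longrightarrow> norm (y - x) < \<delta>2 \<Longrightarrow> 0 < \<eta> \<Longrightarrow> \<eta> < \<delta>2 \<Longrightarrow>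
      infdist (y + \<eta> *\<^sub>R w) C \<le> d * \<eta>"
    using w unfolding tangent_bound_def tangent_within_def by blast
  \<comment> \<open>\<open>z\<close> will be within \<open>\<eta> * (k - 1)\<close> of
    \<open>y\<close>, so the radius \<open>\<delta>2 / k\<close> for \<open>y\<close> and \<eta>
    keeps \<open>z\<close> within \<open>\<delta>2\<close> of \<open>x\<close>.\<close>
  define k where "k = 1 + norm v + (e - d)"
  have k: "k \<ge> 1" using tangent_bound_nonneg[OF v x] e by (simp add: k_def)
  define \<delta> where "\<delta> = min \<delta>1 (\<delta>2 / k)"
  have \<delta>k: "\<delta> * k \<le> \<delta>2" "\<delta> \<le> \<delta>1" "\<delta> > 0" using 1(1) 2(1) k by (auto simp: \<delta>_def min_def field_simps)
  have \<delta>2: "\<delta> \<le> \<delta>2" proof -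
    have "\<delta> * 1 \<le> \<delta> * k" using k \<delta>k(3) by (intro mult_left_mono) auto
    then show ?thesis using \<delta>k(1) by simp
  qed
  have "infdist (y + \<eta> *\<^sub>R (v + w)) C \<le> e * \<eta>"
    if y: "y \<in> C" "norm (y - x) < \<delta>" and \<eta>: "0 < \<eta>" "\<eta> < \<delta>" for y \<eta>
  proof -
    have "infdist (y + \<eta> *\<^sub>R v) C \<le> c * \<eta>" using y \<eta> \<delta>k by (intro 1) auto
    also have "\<dots> < (e - d) * \<eta>" using e \<eta> by simp
    finally obtain z where z: "z \<in> C" "dist (y + \<eta> *\<^sub>R v) z < (e - d) * \<eta>"
      using y(1) infdist_lessD by blast
    have "norm (z - x) \<le> norm (y - x) + norm (\<eta> *\<^sub>R v) + dist (y + \<eta> *\<^sub>R v) z"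
      using norm_triangle_ineq[of "y - x" "\<eta> *\<^sub>R v"]
        norm_triangle_ineq[of "y - x + \<eta> *\<^sub>R v" "z - (y + \<eta> *\<^sub>R v)"]
      by (simp add: dist_norm norm_minus_commute algebra_simps)
    also have "\<dots> < \<delta> + \<eta> * norm v + (e - d) * \<eta>" using y \<eta> z by simp
    also have "\<dots> = \<delta> + \<eta> * (k - 1)" by (simp add: k_def algebra_simps)
    also have "\<dots> \<le> \<delta> + \<delta> * (k - 1)" using \<eta> k by (intro add_left_mono mult_right_mono) auto
    also have "\<dots> \<le> \<delta>2" using \<delta>k by (simp add: algebra_simps)
    finally have "infdist (z + \<eta> *\<^sub>R w) C \<le> d * \<eta>" using z \<eta> \<delta>2 by (intro 2) auto
    moreover have "infdist (y + \<eta> *\<^sub>R (v + w)) C \<le> infdist (z + \<eta> *\<^sub>R w) C + dist (y + \<eta> *\<^sub>R v) z"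
      using infdist_triangle[of "y + \<eta> *\<^sub>R (v + w)" C "z + \<eta> *\<^sub>R w"]
      by (simp add: dist_norm algebra_simps)
    ultimately show ?thesis using z by (simp add: algebra_simps)
  qed
  with \<delta>k show ?thesis unfolding tangent_bound_def tangent_within_def by blast
qed

lemma tangent_bound_scaleR:
  assumes v: "tangent_bound C x v c" and a: "a > 0"
  shows "tangent_bound C x (a *\<^sub>R v) (a * c)"
proof -
  obtain \<delta> where \<delta>: "\<delta> > 0" "\<And>y \<eta>. y \<in> C \<Longrightarrow> norm (y - x) < \<delta> \<Longrightarrow> 0 < \<eta> \<Longrightarrow> \<eta> < \<delta> \<Longrightarrow>
      infdist (y + \<eta> *\<^sub>R v) C \<le> c * \<eta>"
    using v unfolding tangent_bound_def tangent_within_def by blast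
  have "infdist (y + \<eta> *\<^sub>R a *\<^sub>R v) C \<le> a * c * \<eta>"
    if y: "y \<in> C" "norm (y - x) < min \<delta> (\<delta> / a)" and \<eta>: "0 < \<eta>" "\<eta> < min \<delta> (\<delta> / a)" for y \<eta>
  proof -
    have "\<eta> * a < \<delta>" using \<eta> a by (simp add: pos_less_divide_eq)
    then show ?thesis using \<delta>(2)[of y "\<eta> * a"] y \<eta> a by (simp add: mult_ac)
  qed
  moreover have "min \<delta> (\<delta> / a) > 0" using \<delta> a by simp
  ultimately show ?thesis unfolding tangent_bound_def tangent_within_def by blast
qed

text \<open>For \<open>\<eta> > 0\<close>, a correction \<open>\<epsilon> *\<^sub>R b\<close> with
  \<open>norm b \<le> 1\<close> amounts to a point of \<open>C\<close> within
  \<open>\<epsilon> * \<eta>\<close> of \<open>y + \<eta> *\<^sub>R v\<close>. To obtain such a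
  point from a distance estimate, the estimate is used with \<open>\<epsilon> / 2\<close>, since the
  distance need not be attained.\<close>

lemma clarke_tangent_cone_iff:
  fixes C :: "'z::real_normed_vector set"
  assumes x: "x \<in> C"
  shows "v \<in> clarke_tangent_cone UNIV norm C x \<longleftrightarrow> (\<forall>c>0. tangent_bound C x v c)"
proof safe
  fix c :: real assume v: "v \<in> clarke_tangent_cone UNIV norm C x" and c: "c > 0"
  then have "\<exists>\<delta>>0. \<exists>\<kappa>>0. \<forall>y\<in>C. norm (y - x) \<le> \<delta> \<longrightarrow>
        (\<forall>\<eta>\<in>{0..\<kappa>}. \<exists>b\<in>UNIV. norm b \<le> 1 \<and> y + \<eta> *\<^sub>R (v + c *\<^sub>R b) \<in> C)"
    unfolding clarke_tangent_cone_def by blast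
  then obtain \<delta> \<kappa> where d: "\<delta> > 0" "\<kappa> > 0" "\<And>y \<eta>. y \<in> C \<Longrightarrow> norm (y - x) \<le> \<delta> \<Longrightarrow> 0 \<le> \<eta> \<Longrightarrow> \<eta> \<le> \<kappa> \<Longrightarrow>
     \<exists>b. norm b \<le> 1 \<and> y + \<eta> *\<^sub>R (v + c *\<^sub>R b) \<in> C" by fastforce
  have "infdist (y + \<eta> *\<^sub>R v) C \<le> c * \<eta>"
    if y: "y \<in> C" "norm (y - x) < min \<delta> \<kappa>" and \<eta>: "0 < \<eta>" "\<eta> < min \<delta> \<kappa>" for y \<eta>
  proof -
    obtain b where b: "norm b \<le> 1" "y + \<eta> *\<^sub>R (v + c *\<^sub>R b) \<in> C" using d(3)[of y \<eta>] y \<eta> by auto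
    have "infdist (y + \<eta> *\<^sub>R v) C \<le> norm ((\<eta> * c) *\<^sub>R b)"
      using infdist_le_norm[OF b(2), of "y + \<eta> *\<^sub>R v"] by (simp add: algebra_simps)
    also have "\<dots> \<le> c * \<eta>" using b c \<eta> mult_left_mono[OF b(1), of "c * \<eta>"] by (simp add: mult_ac abs_mult)
    finally show ?thesis .
  qed
  moreover have "min \<delta> \<kappa> > 0" using d by simp
  ultimately show "tangent_bound C x v c" unfolding tangent_bound_def tangent_within_def by blast
next
  assume v: "\<forall>c>0. tangent_bound C x v c"
  have "\<exists>\<delta>>0. \<exists>\<kappa>>0. \<forall>y\<in>C. norm (y - x) \<le> \<delta> \<longrightarrow>
        (\<forall>\<eta>\<in>{0..\<kappa>}. \<exists>b\<in>UNIV. norm b \<le> 1 \<and> y + \<eta> *\<^sub>R (v + \<epsilon> *\<^sub>R b) \<in> C)" if \<epsilon>: "\<epsilon> > 0" for \<epsilon>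
  proof -
    have "tangent_bound C x v (\<epsilon> / 2)" using v \<epsilon> by simp
    then obtain \<delta> where \<delta>: "\<delta> > 0" "\<And>y \<eta>. y \<in> C \<Longrightarrow> norm (y - x) < \<delta> \<Longrightarrow> 0 < \<eta> \<Longrightarrow> \<eta> < \<delta> \<Longrightarrow>
        infdist (y + \<eta> *\<^sub>R v) C \<le> \<epsilon> / 2 * \<eta>"
      unfolding tangent_bound_def tangent_within_def by blast
    have "\<exists>b. norm b \<le> 1 \<and> y + \<eta> *\<^sub>R (v + \<epsilon> *\<^sub>R b) \<in> C"
      if y: "y \<in> C" "norm (y - x) \<le> \<delta> / 2" and \<eta>: "0 \<le> \<eta>" "\<eta> \<le> \<delta> / 2" for y \<eta>
    proof (cases "\<eta> = 0")
      case True
      then show ?thesis using y by (intro exI[of _ 0]) simp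
    next
      case False
      then have \<eta>0: "\<eta> > 0" using \<eta> by simp
      have "infdist (y + \<eta> *\<^sub>R v) C \<le> \<epsilon> / 2 * \<eta>" using y \<eta> \<eta>0 \<delta>(1) by (intro \<delta>) auto
      also have "\<dots> < \<epsilon> * \<eta>" using \<epsilon> \<eta>0 by simp
      finally obtain z where z: "z \<in> C" "dist (y + \<eta> *\<^sub>R v) z < \<epsilon> * \<eta>"
        using y(1) infdist_lessD by blast
      define b where "b = (1 / (\<epsilon> * \<eta>)) *\<^sub>R (z - (y + \<eta> *\<^sub>R v))"
      have "norm b \<le> 1" using z(2) \<epsilon> \<eta>0 by (simp add: b_def dist_norm norm_minus_commute)
      moreover have "y + \<eta> *\<^sub>R (v + \<epsilon> *\<^sub>R b) = z" using \<epsilon> \<eta>0 by (simp add: b_def scaleR_add_right mult.commute)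
      ultimately show ?thesis using z(1) by blast
    qed
    then show ?thesis
      using \<delta>(1) by (intro exI[of _ "\<delta> / 2"] conjI ballI impI) (auto simp del: le_divide_eq_numeral1)
  qed
  then show "v \<in> clarke_tangent_cone UNIV norm C x" unfolding clarke_tangent_cone_def by blast
qed

section \<open>The tangent gauge as a sublinear function\<close>

context
  fixes C :: "'z::real_normed_vector set" and x :: 'z
  assumes x: "x \<in> C"
begin

lemma tangent_gauge_sublinear: "sublinear (tangent_gauge C x)"
  and tangent_gauge_le: "(\<And>d. c < d \<Longrightarrow> tangent_bound C x v d) \<Longrightarrow> tangent_gauge C x v \<le> c"
proof -
  define Q where "Q v c \<longleftrightarrow> (\<forall>d>c. tangent_bound C x v d)" for v c
  have G: "tangent_gauge C x = (\<lambda>v. Inf {c. Q v c})" by (simp add: tangent_gauge_def[abs_def] Q_def)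
  have 1: "Q v (norm v)" for v
    unfolding Q_def using tangent_bound_mono[OF tangent_bound_norm] by (blast intro: less_imp_le)
  have lb: "0 \<le> c" if Q: "Q v c" for v c
  proof (rule ccontr)
    assume "\<not> 0 \<le> c"
    then show False using Q tangent_bound_nonneg[OF _ x, of v "c / 2"] by (auto simp: Q_def)
  qed
  have 2: "Q (u + v) (c + d)" if Q: "Q u c" "Q v d" for u v c d
    unfolding Q_def
  proof safe
    fix e assume e: "c + d < e"
    \<comment> \<open>A third of the slack, so that \<open>(c + h) + (d + h)\<close> is still less
      than \<open>e\<close>.\<close>
    define h where "h = (e - (c + d)) / 3"
    have "tangent_bound C x u (c + h)" "tangent_bound C x v (d + h)" using Q e by (auto simp: Q_def h_def)
    then show "tangent_bound C x (u + v) e"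
      by (rule tangent_bound_add) (use e x in \<open>auto simp: h_def field_simps\<close>)
  qed
  have 3: "Q (a *\<^sub>R v) (a * c)" if a: "a > 0" and Q: "Q v c" for a v c
    unfolding Q_def
  proof safe
    fix d assume "a * c < d"
    then have "tangent_bound C x v (d / a)" using Q a by (simp add: Q_def pos_less_divide_eq mult.commute)
    from tangent_bound_scaleR[OF this a] show "tangent_bound C x (a *\<^sub>R v) d" using a by simp
  qed
  show "sublinear (tangent_gauge C x)"
    unfolding G by (rule sublinear_Inf[of Q norm "\<lambda>_. 0"]) (blast intro: 1 lb 2 3)+
  show "tangent_gauge C x v \<le> c" if c: "\<And>d. c < d \<Longrightarrow> tangent_bound C x v d"
  proof -
    have "Q v c" using c by (simp add: Q_def)
    then show ?thesis unfolding G by (rule sublinear_Inf(2)[of Q norm "\<lambda>_. 0", rotated -1]) (blast intro: 1 lb 2 3)+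
  qed
qed

lemma tangent_bound_of_gauge:
  assumes "tangent_gauge C x v < d"
  shows "tangent_bound C x v d"
proof -
  have "norm v \<in> {c. \<forall>d>c. tangent_bound C x v d}"
    using tangent_bound_mono[OF tangent_bound_norm, of v] by (simp add: less_imp_le)
  then have ne: "{c. \<forall>d>c. tangent_bound C x v d} \<noteq> {}" by blast
  obtain c where "c < d" "\<forall>d>c. tangent_bound C x v d"
    using cInf_lessD[OF ne] assms unfolding tangent_gauge_def by blast
  then show ?thesis by blast
qed

lemma tangent_gauge_le_norm: "tangent_gauge C x v \<le> norm v"
  by (rule tangent_gauge_le) (rule tangent_bound_mono[OF tangent_bound_norm], simp)

lemma clarke_tangent_cone_gauge:
  "v \<in> clarke_tangent_cone UNIV norm C x \<longleftrightarrow> tangent_gauge C x v \<le> 0"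
  unfolding clarke_tangent_cone_iff[OF x]
  using tangent_gauge_le[of 0 v] tangent_bound_of_gauge[of v] by force

lemma tangent_gauge_lipschitz: "tangent_gauge C x u \<le> tangent_gauge C x v + norm (u - v)"
  using sublinear_add[OF tangent_gauge_sublinear, of v "u - v"] tangent_gauge_le_norm[of "u - v"] by simp

lemma closed_clarke_tangent_cone: "closed (clarke_tangent_cone UNIV norm C x)"
proof -
  have "v \<in> clarke_tangent_cone UNIV norm C x"
    if v: "v \<in> closure (clarke_tangent_cone UNIV norm C x)" for v
  proof -
    have "tangent_gauge C x v \<le> 0 + e" if e: "e > 0" for e
    proof -
      obtain u where u: "u \<in> clarke_tangent_cone UNIV norm C x" "dist u v < e"
        using v[unfolded closure_approachable] e by blast
      then show ?thesis
        using tangent_gauge_lipschitz[of v u] by (simp add: clarke_tangent_cone_gauge dist_norm norm_minus_commute)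
    qed
    then show ?thesis unfolding clarke_tangent_cone_gauge by (rule field_le_epsilon)
  qed
  then show ?thesis using closure_subset_eq by blast
qed

lemma zero_in_clarke_tangent_cone: "0 \<in> clarke_tangent_cone UNIV norm C x"
  unfolding clarke_tangent_cone_gauge using tangent_gauge_le_norm[of 0] by simp

text \<open>A step of size \<open>h\<close> is replaced by about \<open>h / \<eta>\<close> steps of size \<open>\<eta>\<close>, whose errors add up linearly.\<close>

lemma tangent_bound_iterate:
  assumes \<delta>: "\<delta> > 0"
    and small: "\<And>e. e > 0 \<Longrightarrow> \<exists>\<eta>. 0 < \<eta> \<and> \<eta> < e \<and>
      (\<forall>y\<in>C. norm (y - x) < \<delta> \<longrightarrow> infdist (y + \<eta> *\<^sub>R v) C \<le> c * \<eta>)"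
    and d: "c < d"
  shows "tangent_bound C x v d"
proof -
  obtain \<eta>0 where "0 < \<eta>0" "\<And>y. y \<in> C \<Longrightarrow> norm (y - x) < \<delta> \<Longrightarrow> infdist (y + \<eta>0 *\<^sub>R v) C \<le> c * \<eta>0"
    using small[OF zero_less_one] by blast
  then have "0 \<le> c * \<eta>0" using x \<delta> infdist_nonneg by (metis cancel_comm_monoid_add_class.diff_cancel norm_zero order_trans)
  then have c: "0 \<le> c" using \<open>0 < \<eta>0\<close> by (simp add: zero_le_mult_iff)
  \<comment> \<open>After small steps of total length at most \<open>h\<close> the current point is
    within \<open>h * (norm v + d)\<close> of \<open>y\<close>. The bound
    \<open>\<delta> / k\<close> on the initial distance and on \<open>h\<close> keeps it within
    \<delta> of \<open>x\<close>, where \<open>small\<close> applies.\<close>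
  define k where "k = 1 + norm v + d"
  have k: "k \<ge> 1" using c d by (simp add: k_def)
  have "infdist (y + h *\<^sub>R v) C \<le> d * h"
    if y: "y \<in> C" "norm (y - x) < \<delta> / k" and h: "0 < h" "h < \<delta> / k" for y h
  proof (rule field_le_epsilon)
    fix e :: real assume e: "e > 0"
    have nv: "norm v + 1 > 0" using norm_ge_zero[of v] by linarith
    \<comment> \<open>What is left of \<open>h\<close> after the \<open>m\<close> full steps is
      shorter than \<eta> and costs at most \<open>\<eta> * norm v\<close>, which is less than
      \<open>e\<close>.\<close>
    obtain \<eta> where \<eta>: "0 < \<eta>" "\<eta> < e / (norm v + 1)"
      "\<And>y. y \<in> C \<Longrightarrow> norm (y - x) < \<delta> \<Longrightarrow> infdist (y + \<eta> *\<^sub>R v) C \<le> c * \<eta>"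
      using small[of "e / (norm v + 1)"] e nv by auto
    define m where "m = nat \<lfloor>h / \<eta>\<rfloor>"
    have m: "real m * \<eta> \<le> h" "h < (real m + 1) * \<eta>"
    proof -
      have "real m \<le> h / \<eta>" "h / \<eta> < real m + 1" using h \<eta> by (auto simp: m_def)
      then show "real m * \<eta> \<le> h" "h < (real m + 1) * \<eta>"
        using \<eta>(1) by (simp_all add: field_simps)
    qed
    have "\<exists>z\<in>C. norm (z - (y + (real j * \<eta>) *\<^sub>R v)) \<le> real j * \<eta> * d" if "j \<le> m" for j
      using that
    proof (induction j)
      case 0
      then show ?case using y by (intro bexI[of _ y]) auto
    next
      case (Suc j)
      then obtain z where z: "z \<in> C" "norm (z - (y + (real j * \<eta>) *\<^sub>R v)) \<le> real j * \<eta> * d" by auto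
      have j: "real j * \<eta> \<le> h" proof -
        have "real j * \<eta> \<le> real m * \<eta>" using Suc.prems \<eta>(1) by (intro mult_right_mono) auto
        with m(1) show ?thesis by linarith
      qed
      have "norm (z - x) \<le> norm (y - x) + norm ((real j * \<eta>) *\<^sub>R v) + norm (z - (y + (real j * \<eta>) *\<^sub>R v))"
        using norm_triangle_ineq[of "y - x" "(real j * \<eta>) *\<^sub>R v"]
          norm_triangle_ineq[of "y - x + (real j * \<eta>) *\<^sub>R v" "z - (y + (real j * \<eta>) *\<^sub>R v)"]
        by (simp add: algebra_simps)
      also have "\<dots> \<le> norm (y - x) + (real j * \<eta>) * (k - 1)"
        using z \<eta>(1) by (simp add: k_def algebra_simps)
      also have "\<dots> \<le> norm (y - x) + h * (k - 1)" using j k by (intro add_left_mono mult_right_mono) auto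
      also have "\<dots> < \<delta> / k + (\<delta> / k) * (k - 1)"
        using y h k by (intro add_less_le_mono mult_right_mono) auto
      also have "\<dots> = \<delta>" using k by (simp add: field_simps)
      finally have "infdist (z + \<eta> *\<^sub>R v) C \<le> c * \<eta>" using z by (intro \<eta>)
      also have "\<dots> < d * \<eta>" using d \<eta> by simp
      finally obtain z' where z': "z' \<in> C" "dist (z + \<eta> *\<^sub>R v) z' < d * \<eta>"
        using y(1) infdist_lessD by blast
      have "norm (z' - (y + (real (Suc j) * \<eta>) *\<^sub>R v))
          \<le> norm (z' - (z + \<eta> *\<^sub>R v)) + norm (z - (y + (real j * \<eta>) *\<^sub>R v))"
        using norm_triangle_ineq[of "z' - (z + \<eta> *\<^sub>R v)" "z - (y + (real j * \<eta>) *\<^sub>R v)"]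
        by (simp add: algebra_simps)
      also have "\<dots> \<le> d * \<eta> + real j * \<eta> * d" using z z' by (simp add: dist_norm norm_minus_commute)
      also have "\<dots> = real (Suc j) * \<eta> * d" by (simp add: algebra_simps)
      finally show ?case using z' by blast
    qed
    then obtain z where z: "z \<in> C" "norm (z - (y + (real m * \<eta>) *\<^sub>R v)) \<le> real m * \<eta> * d" by blast
    have "infdist (y + h *\<^sub>R v) C \<le> norm (y + h *\<^sub>R v - z)" by (rule infdist_le_norm[OF z(1)])
    also have "\<dots> \<le> norm (z - (y + (real m * \<eta>) *\<^sub>R v)) + norm ((h - real m * \<eta>) *\<^sub>R v)"
      using norm_triangle_ineq[of "y + (real m * \<eta>) *\<^sub>R v - z" "(h - real m * \<eta>) *\<^sub>R v"]
      by (simp add: algebra_simps norm_minus_commute)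
    also have "\<dots> \<le> h * d + \<eta> * norm v"
    proof (rule add_mono)
      show "norm (z - (y + (real m * \<eta>) *\<^sub>R v)) \<le> h * d"
        using z(2) mult_right_mono[OF m(1), of d] c d by linarith
      have "\<bar>h - real m * \<eta>\<bar> \<le> \<eta>" using m by (simp add: algebra_simps)
      then show "norm ((h - real m * \<eta>) *\<^sub>R v) \<le> \<eta> * norm v" by (simp add: mult_right_mono)
    qed
    also have "\<dots> \<le> h * d + e"
    proof -
      have "\<eta> * (norm v + 1) < e" using \<eta>(2) nv by (simp add: pos_less_divide_eq)
      then show ?thesis using \<eta>(1) by (simp add: algebra_simps)
    qed
    finally show "infdist (y + h *\<^sub>R v) C \<le> d * h + e" by (simp add: mult.commute)
  qed
  moreover have "\<delta> / k > 0" using \<delta> k by simp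
  ultimately show ?thesis unfolding tangent_bound_def tangent_within_def by blast
qed

end

text \<open>The constraints on \<open>y\<close> and \<eta> are strict, so a dense element near
  \<open>y\<close> and a rational slightly above \<eta> satisfy them too; the estimate passes to the
  limit because the distance to \<open>C\<close> is Lipschitz.\<close>

lemma tangent_within_countable:
  fixes C :: "'z::real_normed_vector set"
  assumes s: "\<And>n. s n \<in> C" and dense: "\<And>z e. z \<in> C \<Longrightarrow> e > 0 \<Longrightarrow> \<exists>n. dist (s n) z < e"
  shows "tangent_within C x v c \<delta> \<longleftrightarrow>
    (\<forall>n::nat. \<forall>r::rat. norm (s n - x) < \<delta> \<longrightarrow> 0 < real_of_rat r \<longrightarrow> real_of_rat r < \<delta> \<longrightarrow>
      infdist (s n + real_of_rat r *\<^sub>R v) C \<le> c * real_of_rat r)" (is "_ \<longleftrightarrow> ?P")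
proof
  assume "tangent_within C x v c \<delta>"
  then show ?P using s unfolding tangent_within_def by blast
next
  assume k: ?P
  have "infdist (y + \<eta> *\<^sub>R v) C \<le> c * \<eta>"
    if y: "y \<in> C" "norm (y - x) < \<delta>" and \<eta>: "0 < \<eta>" "\<eta> < \<delta>" for y \<eta>
  proof (rule field_le_epsilon)
    fix e :: real assume e: "e > 0"
    define m where "m = 1 + norm v + \<bar>c\<bar>"
    have m: "m > 0" using norm_ge_zero[of v] abs_ge_zero[of c] unfolding m_def by linarith
    \<comment> \<open>The first entry keeps the error caused by the rational step, at most
      \<open>h * (norm v + \<bar>c\<bar>)\<close>, below \<open>e / 2\<close>. The other two keep
      the perturbed point and step inside the strict ranges.\<close>
    define h where "h = min (e / (2 * m)) (min (\<delta> - norm (y - x)) (\<delta> - \<eta>))"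
    have h: "h > 0" using y \<eta> e m by (auto simp: h_def)
    obtain n where n: "dist (s n) y < min (e / 2) h" using dense[OF y(1), of "min (e / 2) h"] h e by auto
    obtain r where r: "\<eta> < real_of_rat r" "real_of_rat r < \<eta> + h" using of_rat_dense[of \<eta> "\<eta> + h"] h by auto
    have "norm (s n - x) < \<delta>"
      using norm_triangle_ineq[of "s n - y" "y - x"] n by (simp add: h_def dist_norm)
    moreover have "real_of_rat r < \<delta>" using r by (simp add: h_def)
    ultimately have 1: "infdist (s n + real_of_rat r *\<^sub>R v) C \<le> c * real_of_rat r"
      using k less_trans[OF \<eta>(1) r(1)] by blast
    have "norm (y + \<eta> *\<^sub>R v - (s n + real_of_rat r *\<^sub>R v)) \<le> norm (y - s n) + \<bar>\<eta> - real_of_rat r\<bar> * norm v"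
    proof -
      have "y + \<eta> *\<^sub>R v - (s n + real_of_rat r *\<^sub>R v) = (y - s n) + (\<eta> - real_of_rat r) *\<^sub>R v"
        by (simp add: algebra_simps)
      then show ?thesis by (metis norm_scaleR norm_triangle_ineq)
    qed
    also have "\<dots> \<le> e / 2 + h * norm v"
      using n r by (intro add_mono mult_right_mono) (auto simp: dist_norm norm_minus_commute)
    finally have 2: "infdist (y + \<eta> *\<^sub>R v) C \<le> c * real_of_rat r + e / 2 + h * norm v"
      using infdist_triangle[of "y + \<eta> *\<^sub>R v" C "s n + real_of_rat r *\<^sub>R v"] 1 by (simp add: dist_norm)
    have "c * (real_of_rat r - \<eta>) \<le> \<bar>c\<bar> * h"
    proof -
      have "c * (real_of_rat r - \<eta>) \<le> \<bar>c\<bar> * (real_of_rat r - \<eta>)" using r by (intro mult_right_mono) auto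
      also have "\<dots> \<le> \<bar>c\<bar> * h" using r by (intro mult_left_mono) auto
      finally show ?thesis .
    qed
    then have 3: "c * real_of_rat r \<le> c * \<eta> + \<bar>c\<bar> * h" by (simp add: algebra_simps)
    have "h \<le> e / (2 * m)" by (simp add: h_def)
    then have "h * m \<le> e / 2" using m by (simp add: field_simps)
    then have "h * norm v + \<bar>c\<bar> * h \<le> e / 2" using h by (simp add: m_def algebra_simps)
    with 2 3 show "infdist (y + \<eta> *\<^sub>R v) C \<le> c * \<eta> + e" by simp
  qed
  then show "tangent_within C x v c \<delta>" unfolding tangent_within_def by blast
qed

text \<open>A weak cluster point of approximate solutions is an exact one, because the norm and
  \<open>g\<close> are weakly lower semicontinuous: the value at the cluster point is the value of a
  norming functional, respectively of a linear functional below \<open>g\<close>. The bound of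
  \<open>g\<close> by the norm makes the latter continuous.\<close>

lemma sublinear_attains_zero:
  fixes g :: "'z::real_normed_vector \<Rightarrow> real"
  assumes refl: "reflexive_space TYPE('z)" and g: "sublinear g" "\<And>v. g v \<le> norm v"
    and approx: "\<And>k::nat. \<exists>v. norm (v - z) < r + 1 / real (Suc k) \<and> g v \<le> 1 / real (Suc k)"
  shows "\<exists>v\<in>cball z r. g v \<le> 0"
proof -
  obtain v where v: "\<And>k::nat. norm (v k - z) < r + 1 / real (Suc k)" "\<And>k. g (v k) \<le> 1 / real (Suc k)"
    using approx by metis
  have "norm (v k) \<le> norm z + r + 1" for k
  proof -
    have "1 / real (Suc k) \<le> 1" by simp
    moreover have "norm (v k) \<le> norm (v k - z) + norm z" using norm_triangle_ineq[of "v k - z" z] by simp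
    ultimately show ?thesis using v(1)[of k] by linarith
  qed
  then obtain u where u: "\<And>(\<zeta> :: 'z \<Rightarrow>\<^sub>L real) c. \<forall>\<^sub>F n in sequentially. \<zeta> (v n) \<le> c \<Longrightarrow> \<zeta> u \<le> c"
    using reflexive_weak_cluster_point[OF refl, of v] by metis
  have ev: "\<forall>\<^sub>F n in sequentially. 1 / real (Suc n) < e" if "e > 0" for e
    using order_tendstoD(2)[OF LIMSEQ_Suc[OF lim_1_over_n] that] by simp
  have "norm (u - z) \<le> r + e" if e: "e > 0" for e
  proof -
    obtain \<zeta> :: "'z \<Rightarrow>\<^sub>L real" where \<zeta>: "norm \<zeta> \<le> 1" "\<zeta> (u - z) = norm (u - z)"
      using norming_functional by blast
    have "\<zeta> y \<le> norm y" for y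
      using norm_blinfun[of \<zeta> y] mult_right_mono[OF \<zeta>(1), of "norm y"] by simp
    then have le: "\<zeta> (v n) \<le> \<zeta> z + norm (v n - z)" for n
      by (metis add.commute blinfun.diff_right diff_le_eq)
    have "\<forall>\<^sub>F n in sequentially. \<zeta> (v n) \<le> \<zeta> z + (r + e)"
      using ev[OF e]
    proof eventually_elim
      case (elim n)
      then show ?case using le[of n] v(1)[of n] by simp
    qed
    then have "\<zeta> u \<le> \<zeta> z + (r + e)" by (rule u)
    then show ?thesis using \<zeta>(2) by (simp add: blinfun.diff_right)
  qed
  then have "norm (u - z) \<le> r" by (rule field_le_epsilon)
  moreover have "g u \<le> 0 + e" if e: "e > 0" for e
  proof -
    obtain F where F: "linear F" "\<And>y. F y \<le> g y" "F u = g u"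
      using hahn_banach_sublinear[OF g(1)] by blast
    have "F y \<le> 1 * norm y" for y using F(2)[of y] g(2)[of y] by simp
    then obtain \<zeta> where \<zeta>: "blinfun_apply \<zeta> = F"
      using linear_dominated_blinfun[OF F(1)] by blast
    have "\<forall>\<^sub>F n in sequentially. \<zeta> (v n) \<le> e"
      using ev[OF e]
    proof eventually_elim
      case (elim n)
      then show ?case using F(2)[of "v n"] v(2)[of n] by (simp add: \<zeta>)
    qed
    from u[OF this] show ?thesis using F(3) by (simp add: \<zeta>)
  qed
  then have "g u \<le> 0" by (rule field_le_epsilon)
  ultimately show ?thesis by (intro bexI[of _ u]) (auto simp: dist_norm norm_minus_commute)
qed

section \<open>Tangent cones of sets of selections\<close>

text \<open>A Castaing representation of \<open>S\<close>, through which quantifiers over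
  \<open>S t\<close> become countable.\<close>

locale dense_selections =
  fixes M :: "'t measure" and S :: "'t \<Rightarrow> 'z::{banach, second_countable_topology} set"
    and s :: "nat \<Rightarrow> 't \<Rightarrow> 'z"
  assumes s_meas: "\<And>n. s n \<in> borel_measurable M"
    and s_in: "\<And>n t. t \<in> space M \<Longrightarrow> s n t \<in> S t"
    and s_dense: "\<And>t z e. t \<in> space M \<Longrightarrow> z \<in> S t \<Longrightarrow> e > 0 \<Longrightarrow> \<exists>n. dist (s n t) z < e"
    and S_closed: "\<And>t. t \<in> space M \<Longrightarrow> closed (S t)"
begin

lemma S_nonempty: "t \<in> space M \<Longrightarrow> S t \<noteq> {}"
  using s_in by blast

lemma infdist_less_iff:
  assumes t: "t \<in> space M"
  shows "infdist z (S t) < a \<longleftrightarrow> (\<exists>n. dist z (s n t) < a)"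
proof
  assume "infdist z (S t) < a"
  then obtain c where c: "c \<in> S t" "dist z c < a" using infdist_lessD S_nonempty[OF t] by blast
  obtain n where "dist (s n t) c < a - dist z c" using s_dense[OF t c(1)] c(2) by (meson diff_gt_0_iff_gt)
  then have "dist z (s n t) < a" using dist_triangle[of z "s n t" c] by (simp add: dist_commute)
  then show "\<exists>n. dist z (s n t) < a" ..
next
  assume "\<exists>n. dist z (s n t) < a"
  then show "infdist z (S t) < a" using infdist_le[OF s_in[OF t]] le_less_trans by blast
qed

lemma measurable_infdist:
  assumes "z \<in> borel_measurable M"
  shows "(\<lambda>t. infdist (z t) (S t)) \<in> borel_measurable M"
proof (rule borel_measurable_iff_less[THEN iffD2], rule allI)
  fix a :: real
  have [measurable]: "z \<in> borel_measurable M" "s n \<in> borel_measurable M" for n using assms s_meas by auto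
  have "{t \<in> space M. infdist (z t) (S t) < a} = {t \<in> space M. \<exists>n. dist (z t) (s n t) < a}"
    using infdist_less_iff by blast
  also have "\<dots> \<in> sets M" by measurable
  finally show "{t \<in> space M. infdist (z t) (S t) < a} \<in> sets M" .
qed

lemma measurable_member:
  assumes "x \<in> borel_measurable M"
  shows "{t \<in> space M. x t \<in> S t} \<in> sets M"
proof -
  have [measurable]: "(\<lambda>t. infdist (x t) (S t)) \<in> borel_measurable M" using assms by (rule measurable_infdist)
  have "{t \<in> space M. x t \<in> S t} = {t \<in> space M. infdist (x t) (S t) = 0}"
    using in_closed_iff_infdist_zero[OF S_closed S_nonempty] by blast
  also have "\<dots> \<in> sets M" by measurable
  finally show ?thesis .
qed

lemma measurable_tangent_within:
  assumes "x \<in> borel_measurable M" "v \<in> borel_measurable M" "c \<in> borel_measurable M"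
  shows "{t \<in> space M. tangent_within (S t) (x t) (v t) (c t) \<delta>} \<in> sets M"
proof -
  have [measurable]: "x \<in> borel_measurable M" "v \<in> borel_measurable M" "c \<in> borel_measurable M"
    "s n \<in> borel_measurable M" for n using assms s_meas by auto
  have [measurable]: "(\<lambda>t. infdist (s n t + real_of_rat r *\<^sub>R v t) (S t)) \<in> borel_measurable M" for n r
    by (intro measurable_infdist) measurable
  have "{t \<in> space M. tangent_within (S t) (x t) (v t) (c t) \<delta>} =
    {t \<in> space M. \<forall>n::nat. \<forall>r::rat. norm (s n t - x t) < \<delta> \<longrightarrow> 0 < real_of_rat r \<longrightarrow> real_of_rat r < \<delta> \<longrightarrow>
      infdist (s n t + real_of_rat r *\<^sub>R v t) (S t) \<le> c t * real_of_rat r}"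
    using tangent_within_countable[where s = "\<lambda>n. s n t" for t, OF s_in s_dense]
    by (intro Collect_cong conj_cong refl) blast
  also have "\<dots> \<in> sets M" by measurable
  finally show ?thesis .
qed

lemma measurable_tangent_bound:
  assumes "x \<in> borel_measurable M" "v \<in> borel_measurable M" "c \<in> borel_measurable M"
  shows "{t \<in> space M. tangent_bound (S t) (x t) (v t) (c t)} \<in> sets M"
  unfolding tangent_bound_iff_nat
  by (intro sets.sets_Collect_countable_Ex measurable_tangent_within assms)

text \<open>The right-hand side consists of countably many conditions, each measurable when
  \<open>C\<close> and \<open>x\<close> depend on \<open>t\<close>. A point of the cone may be moved
  to a nearby \<open>D n\<close> because the gauge is Lipschitz; conversely weak compactness turns
  the approximate tangents into an exact one.\<close>

lemma clarke_tangent_cone_hits_cball: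
  assumes refl: "reflexive_space TYPE('z)" and x: "x \<in> C"
    and D: "\<And>z e. e > 0 \<Longrightarrow> \<exists>n. norm (z - D n) < e"
  shows "clarke_tangent_cone UNIV norm C x \<inter> cball (z :: 'z) r \<noteq> {} \<longleftrightarrow>
    (\<forall>k::nat. \<exists>n::nat. norm (D n - z) < r + 1 / real (Suc k) \<and> tangent_bound C x (D n) (1 / real (Suc k)))"
proof
  assume "clarke_tangent_cone UNIV norm C x \<inter> cball z r \<noteq> {}"
  then obtain v where v: "tangent_gauge C x v \<le> 0" "norm (v - z) \<le> r"
    by (auto simp: clarke_tangent_cone_gauge[OF x] dist_norm norm_minus_commute)
  show "\<forall>k. \<exists>n. norm (D n - z) < r + 1 / real (Suc k) \<and> tangent_bound C x (D n) (1 / real (Suc k))"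
  proof
    fix k :: nat
    obtain n where n: "norm (v - D n) < 1 / real (Suc k)" using D[of "1 / real (Suc k)" v] by auto
    have "norm (D n - z) < r + 1 / real (Suc k)"
      using norm_triangle_ineq[of "D n - v" "v - z"] n v(2) by (simp add: norm_minus_commute)
    moreover have "tangent_gauge C x (D n) < 1 / real (Suc k)"
      using tangent_gauge_lipschitz[OF x, of "D n" v] v(1) n by (simp add: norm_minus_commute)
    ultimately show "\<exists>n. norm (D n - z) < r + 1 / real (Suc k) \<and> tangent_bound C x (D n) (1 / real (Suc k))"
      using tangent_bound_of_gauge[OF x] by blast
  qed
next
  assume *: "\<forall>k. \<exists>n. norm (D n - z) < r + 1 / real (Suc k) \<and> tangent_bound C x (D n) (1 / real (Suc k))"
  have "\<exists>v. norm (v - z) < r + 1 / real (Suc k) \<and> tangent_gauge C x v \<le> 1 / real (Suc k)" for k :: nat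
  proof -
    obtain n where n: "norm (D n - z) < r + 1 / real (Suc k)" "tangent_bound C x (D n) (1 / real (Suc k))"
      using * by blast
    then show ?thesis
      using tangent_gauge_le[OF x] tangent_bound_mono[OF n(2)] less_imp_le by blast
  qed
  then obtain v where "v \<in> cball z r" "tangent_gauge C x v \<le> 0"
    using sublinear_attains_zero[OF refl tangent_gauge_sublinear[OF x] tangent_gauge_le_norm[OF x]] by blast
  then show "clarke_tangent_cone UNIV norm C x \<inter> cball z r \<noteq> {}"
    using clarke_tangent_cone_gauge[OF x] by blast
qed

lemma castaing_clarke_tangent_cone:
  assumes refl: "reflexive_space TYPE('z)" and x: "x \<in> borel_measurable M"
  obtains u :: "nat \<Rightarrow> 't \<Rightarrow> 'z" where "\<And>n. u n \<in> borel_measurable M"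
    "\<And>n t. t \<in> space M \<Longrightarrow> x t \<in> S t \<Longrightarrow> u n t \<in> clarke_tangent_cone UNIV norm (S t) (x t)"
    "\<And>t v e. t \<in> space M \<Longrightarrow> x t \<in> S t \<Longrightarrow> v \<in> clarke_tangent_cone UNIV norm (S t) (x t) \<Longrightarrow>
      e > 0 \<Longrightarrow> \<exists>n. dist (u n t) v < e"
proof -
  \<comment> \<open>The value \<open>{0}\<close> where \<open>x t\<close> is not in
    \<open>S t\<close> keeps the multifunction closed and nonempty on the whole space.\<close>
  define \<Gamma> where "\<Gamma> t = (if x t \<in> S t then clarke_tangent_cone UNIV norm (S t) (x t) else {0})" for t
  obtain D :: "nat \<Rightarrow> 'z" where D: "\<And>z e. e > 0 \<Longrightarrow> \<exists>n. norm (z - D n) < e"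
    using countable_dense_real_normed by blast
  have ball: "{t \<in> space M. \<Gamma> t \<inter> cball z r \<noteq> {}} \<in> sets M" for z r
  proof -
    have "\<Gamma> t \<inter> cball z r \<noteq> {} \<longleftrightarrow>
        x t \<in> S t \<and> (\<forall>k::nat. \<exists>n::nat. norm (D n - z) < r + 1 / real (Suc k) \<and>
          tangent_bound (S t) (x t) (D n) (1 / real (Suc k))) \<or>
        x t \<notin> S t \<and> 0 \<in> cball z r" for t
      using clarke_tangent_cone_hits_cball[OF refl _ D, of "x t" "S t" z r] by (auto simp: \<Gamma>_def)
    then show ?thesis
      by (simp only:)
        (intro sets.sets_Collect_disj sets.sets_Collect_conj sets.sets_Collect_countable_All
          sets.sets_Collect_countable_Ex sets.sets_Collect_neg sets.sets_Collect_const
          measurable_member measurable_tangent_bound x measurable_const; simp)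
  qed
  have \<Gamma>: "closed (\<Gamma> t)" "\<Gamma> t \<noteq> {}" for t
    using closed_clarke_tangent_cone[of "x t" "S t"] zero_in_clarke_tangent_cone[of "x t" "S t"]
    unfolding \<Gamma>_def by auto
  obtain u :: "nat \<Rightarrow> 't \<Rightarrow> 'z" where u: "\<And>n. u n \<in> borel_measurable M" "\<And>n t. t \<in> space M \<Longrightarrow> u n t \<in> \<Gamma> t"
    "\<And>t z e. t \<in> space M \<Longrightarrow> z \<in> \<Gamma> t \<Longrightarrow> e > 0 \<Longrightarrow> \<exists>n. dist (u n t) z < e"
  proof (rule castaing_representation[of M \<Gamma>])
    show "{t \<in> space M. \<Gamma> t \<inter> U \<noteq> {}} \<in> sets M" if "open U" for U
      by (rule sets_open_from_cballs[OF D ball that])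
    show "\<Gamma> t \<noteq> {}" "closed (\<Gamma> t)" for t by (rule \<Gamma>)+
    fix s :: "nat \<Rightarrow> 't \<Rightarrow> 'z"
    assume s: "\<And>n. s n \<in> borel_measurable M" "\<And>n t. t \<in> space M \<Longrightarrow> s n t \<in> \<Gamma> t"
      "\<And>t z e. t \<in> space M \<Longrightarrow> z \<in> \<Gamma> t \<Longrightarrow> e > 0 \<Longrightarrow> \<exists>n. dist (s n t) z < e"
    show thesis
    proof (rule that[of s])
      show "\<exists>n. dist (s n t) z < e" if "t \<in> space M" "z \<in> \<Gamma> t" "e > 0" for t z e using that by (rule s(3))
    qed (use s in auto)
  qed
  show thesis
  proof
    show "u n \<in> borel_measurable M" for n by (rule u)
    show "u n t \<in> clarke_tangent_cone UNIV norm (S t) (x t)" if "t \<in> space M" "x t \<in> S t" for n t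
      using u(2)[OF that(1), of n] that(2) by (simp add: \<Gamma>_def)
    show "\<exists>n. dist (u n t) v < e"
      if "t \<in> space M" "x t \<in> S t" "v \<in> clarke_tangent_cone UNIV norm (S t) (x t)" "e > 0" for t v e
      using u(3)[OF that(1) _ that(4), of v] that(2,3) by (simp add: \<Gamma>_def)
  qed
qed

end

section \<open>The p-norm on small sets\<close>

lemma Lp_norm_indicator_mono:
  fixes f :: "'t \<Rightarrow> 'b::{real_normed_vector, second_countable_topology}"
  assumes p: "1 \<le> p" and f: "f \<in> Lp_space M (ereal p)" and A: "A \<in> sets M" and B: "B \<in> sets M"
    and "A \<subseteq> B"
  shows "Lp_norm M (ereal p) (\<lambda>t. indicator A t *\<^sub>R f t) \<le> Lp_norm M (ereal p) (\<lambda>t. indicator B t *\<^sub>R f t)"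
proof -
  have [measurable]: "f \<in> borel_measurable M" "A \<in> sets M" using Lp_measurable[OF p f] A by auto
  show ?thesis
    by (rule Lp_dominated(2)[OF p Lp_indicator(1)[OF p f B]]) (use \<open>A \<subseteq> B\<close> in \<open>auto simp: indicator_def\<close>)
qed

text \<open>\<open>v\<close> is split at a level \<open>m\<close>. The part above it has norm below
  \<open>e / 2\<close>; below it, \<open>d \<le> norm (g t)\<close> gives
  \<open>norm (v t) \<le> real m / d * norm (g t)\<close>, which is small with \<open>g\<close>. The
  lemma handles the points where a function close to \<open>x\<close> in L^p is pointwise far from
  \<open>x\<close>.\<close>

lemma Lp_norm_abs_cont:
  fixes v :: "'t \<Rightarrow> 'b::{real_normed_vector, second_countable_topology}"
  assumes p: "1 \<le> p" and v: "v \<in> Lp_space M (ereal p)" and d: "d > 0" and e: "e > 0"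
  obtains \<delta> where "\<delta> > 0"
    "\<And>g :: 't \<Rightarrow> 'b. g \<in> Lp_space M (ereal p) \<Longrightarrow> Lp_norm M (ereal p) g \<le> \<delta> \<Longrightarrow>
      Lp_norm M (ereal p) (\<lambda>t. indicator {t \<in> space M. d \<le> norm (g t)} t *\<^sub>R v t) \<le> e"
proof -
  have [measurable]: "v \<in> borel_measurable M" using v by (rule Lp_measurable[OF p])
  define A where "A m = {t \<in> space M. real m < norm (v t)}" for m :: nat
  have A: "A m \<in> sets M" for m unfolding A_def by measurable
  have "\<forall>\<^sub>F m in sequentially. t \<notin> A m" for t
    using eventually_gt_at_top[of "nat \<lceil>norm (v t)\<rceil>"]
    by eventually_elim (simp add: A_def not_less, linarith)
  then have "(\<lambda>m. Lp_norm M (ereal p) (\<lambda>t. indicator (A m) t *\<^sub>R v t)) \<longlonglongrightarrow> 0"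
    by (intro Lp_norm_tendsto_zero[OF p v A]) auto
  then have "\<forall>\<^sub>F m in sequentially. Lp_norm M (ereal p) (\<lambda>t. indicator (A m) t *\<^sub>R v t) < e / 2"
    using e by (intro order_tendstoD) auto
  then obtain m where m: "Lp_norm M (ereal p) (\<lambda>t. indicator (A m) t *\<^sub>R v t) < e / 2"
    using eventually_happens'[OF sequentially_bot] by blast
  \<comment> \<open>Chosen so that \<open>real m / d * \<delta> \<le> e / 2\<close>; the summand 1
    covers \<open>m = 0\<close>.\<close>
  define \<delta> where "\<delta> = e * d / (2 * (real m + 1))"
  show thesis
  proof
    show "\<delta> > 0" using e d by (simp add: \<delta>_def)
    fix g :: "'t \<Rightarrow> 'b"
    assume g: "g \<in> Lp_space M (ereal p)" "Lp_norm M (ereal p) g \<le> \<delta>"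
    have [measurable]: "g \<in> borel_measurable M" using g(1) by (rule Lp_measurable[OF p])
    define a where "a t = norm (indicator (A m) t *\<^sub>R v t)" for t
    define b where "b t = (real m / d) *\<^sub>R norm (g t)" for t
    have mA [measurable]: "A m \<in> sets M" by (rule A)
    have a: "a \<in> Lp_space M (ereal p)" "Lp_norm M (ereal p) a \<le> e / 2"
      using Lp_dominated[OF p Lp_indicator(1)[OF p v A, of m], of a] m by (auto simp: a_def[abs_def])
    have g': "(\<lambda>t. norm (g t)) \<in> Lp_space M (ereal p)" "Lp_norm M (ereal p) (\<lambda>t. norm (g t)) \<le> \<delta>"
      using Lp_dominated[OF p g(1), of "\<lambda>t. norm (g t)"] g(2) by auto
    have b: "b \<in> Lp_space M (ereal p)" unfolding b_def[abs_def] by (rule Lp_scale[OF p g'(1)])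
    have "Lp_norm M (ereal p) b = (real m / d) * Lp_norm M (ereal p) (\<lambda>t. norm (g t))"
      unfolding b_def[abs_def] using Lp_scale(2)[OF p g'(1), of "real m / d"] d by simp
    also have "\<dots> \<le> (real m / d) * \<delta>" using g'(2) d by (intro mult_left_mono) auto
    also have "\<dots> \<le> e / 2"
    proof -
      have "real m * e \<le> e * (real m + 1)" using e by (simp add: algebra_simps)
      then show ?thesis unfolding \<delta>_def using d by (simp add: field_simps)
    qed
    finally have b': "Lp_norm M (ereal p) b \<le> e / 2" .
    have "norm (indicator {t \<in> space M. d \<le> norm (g t)} t *\<^sub>R v t) \<le> norm (a t + b t)" if t: "t \<in> space M" for t
    proof -
      have "norm (v t) \<le> real m / d * norm (g t)" if "norm (v t) \<le> real m" "d \<le> norm (g t)"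
      proof -
        have "norm (v t) * d \<le> real m * norm (g t)" using that d by (intro mult_mono) auto
        then show ?thesis using d by (simp add: field_simps)
      qed
      then show ?thesis using t d by (auto simp: a_def b_def A_def indicator_def not_less)
    qed
    then have "Lp_norm M (ereal p) (\<lambda>t. indicator {t \<in> space M. d \<le> norm (g t)} t *\<^sub>R v t)
        \<le> Lp_norm M (ereal p) (\<lambda>t. a t + b t)"
      by (intro Lp_dominated(2)[OF p Lp_add[OF p a(1) b]] AE_I2) measurable
    also have "\<dots> \<le> Lp_norm M (ereal p) a + Lp_norm M (ereal p) b" by (rule Lp_triangle[OF p a(1) b])
    finally show "Lp_norm M (ereal p) (\<lambda>t. indicator {t \<in> space M. d \<le> norm (g t)} t *\<^sub>R v t) \<le> e"
      using a(2) b' by simp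
  qed
qed

section \<open>Tangents to the set of selections are pointwise tangents\<close>

context dense_selections
begin

text \<open>Tangency is tested on a selection that is as bad as possible: where some
  \<open>s n t\<close> near \<open>x t\<close> violates the estimate with rate
  \<open>c * w t\<close> it takes such a value, and elsewhere it equals \<open>x\<close>. At the bad
  points its correction \<open>b\<close> satisfies \<open>c * w t < \<epsilon> * norm (b t)\<close>.
  As \<open>b\<close> has p-norm at most 1, the norm of \<open>w\<close> on the bad set is at most
  \<open>\<epsilon> / c\<close>.\<close>

lemma clarke_tangent_cone_Sel_pointwise:
  fixes p :: real
  assumes p: "1 \<le> p" and sf: "sigma_finite_measure M" and x: "x \<in> Sel M p S"
    and v: "v \<in> clarke_tangent_cone (Lp_space M p) (Lp_norm M p) (Sel M p S) x"
  shows "AE t in M. v t \<in> clarke_tangent_cone UNIV norm (S t) (x t)"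
proof -
  obtain w :: "'t \<Rightarrow> real" where w: "w \<in> Lp_space M (ereal p)" "Lp_norm M (ereal p) w \<le> 1" "\<And>t. w t > 0"
    using Lp_weight[OF p sf] by blast
  have xL: "x \<in> Lp_space M p" and xS: "AE t in M. x t \<in> S t" using x by (auto simp: Sel_def)
  have vL: "v \<in> Lp_space M p" using v by (simp add: clarke_tangent_cone_def)
  have [measurable]: "x \<in> borel_measurable M" "v \<in> borel_measurable M" "w \<in> borel_measurable M"
    "s n \<in> borel_measurable M" for n using Lp_measurable[OF p] xL vL w s_meas by auto
  \<comment> \<open>\<open>L\<close> is the exceptional set for the rate \<open>c * w t\<close>. The
    two parameters are independent, so \<epsilon> can tend to 0 while \<open>c\<close> stays
    fixed.\<close>
  have key: "\<exists>L\<in>sets M. Lp_norm M (ereal p) (\<lambda>t. indicator L t *\<^sub>R w t) \<le> \<epsilon> / c \<and>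
      (\<forall>t\<in>space M - L. x t \<in> S t \<longrightarrow> (\<forall>d>c * w t. tangent_bound (S t) (x t) (v t) d))"
    if \<epsilon>: "\<epsilon> > 0" and c: "c > 0" for \<epsilon> c :: real
  proof -
    have "\<exists>\<delta>>0. \<exists>\<kappa>>0. \<forall>y\<in>Sel M p S. Lp_norm M p (y - x) \<le> \<delta> \<longrightarrow>
        (\<forall>\<eta>\<in>{0..\<kappa>}. \<exists>b\<in>Lp_space M p. Lp_norm M p b \<le> 1 \<and> y + \<eta> *\<^sub>R (v + \<epsilon> *\<^sub>R b) \<in> Sel M p S)"
      using v \<epsilon> unfolding clarke_tangent_cone_def by blast
    then obtain \<delta> \<kappa> where d: "\<delta> > 0" "\<kappa> > 0"
      and near: "\<And>y \<eta>. y \<in> Sel M p S \<Longrightarrow> Lp_norm M p (y - x) \<le> \<delta> \<Longrightarrow> 0 \<le> \<eta> \<Longrightarrow> \<eta> \<le> \<kappa> \<Longrightarrow>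
        \<exists>b\<in>Lp_space M p. Lp_norm M p b \<le> 1 \<and> y + \<eta> *\<^sub>R (v + \<epsilon> *\<^sub>R b) \<in> Sel M p S"
      by (metis atLeastAtMost_iff)
    define P where "P \<eta> n t \<longleftrightarrow> norm (s n t - x t) < \<delta> * w t \<and>
        c * w t * \<eta> < infdist (s n t + \<eta> *\<^sub>R v t) (S t)" for \<eta> n t
    define B where "B \<eta> = {t \<in> space M. \<exists>n. P \<eta> n t}" for \<eta>
    have P: "{t \<in> space M. P \<eta> n t} \<in> sets M" for \<eta> n
    proof -
      have [measurable]: "(\<lambda>t. infdist (s n t + \<eta> *\<^sub>R v t) (S t)) \<in> borel_measurable M"
        by (intro measurable_infdist) measurable
      show ?thesis unfolding P_def by measurable
    qed
    have B: "B \<eta> \<in> sets M" for \<eta>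
      unfolding B_def by (intro sets.sets_Collect_countable_Ex P)
    have small: "Lp_norm M (ereal p) (\<lambda>t. indicator (B \<eta>) t *\<^sub>R w t) \<le> \<epsilon> / c" if \<eta>: "0 < \<eta>" "\<eta> \<le> \<kappa>" for \<eta>
    proof -
      have [measurable]: "B \<eta> \<in> sets M" by (rule B)
      define y where "y t = (if t \<in> B \<eta> then s (LEAST n. P \<eta> n t) t else x t)" for t
      have [measurable]: "(\<lambda>t. s (LEAST n. P \<eta> n t) t) \<in> borel_measurable M"
        by (rule measurable_first_index[OF P s_meas])
      have [measurable]: "y \<in> borel_measurable M" unfolding y_def[abs_def] by measurable
      have yP: "P \<eta> (LEAST n. P \<eta> n t) t" if "t \<in> B \<eta>" for t
        using that LeastI_ex[of "\<lambda>n. P \<eta> n t"] by (simp add: B_def)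
      have diff: "norm (y t - x t) \<le> norm (\<delta> *\<^sub>R w t)" for t
        using yP[of t] d w(3)[of t] by (cases "t \<in> B \<eta>") (auto simp: y_def P_def)
      note dom = Lp_dominated[OF p Lp_scale(1)[OF p w(1), of \<delta>], of "\<lambda>t. y t - x t"]
      have yx: "(\<lambda>t. y t - x t) \<in> Lp_space M p" by (rule dom) (use diff in auto)
      have "Lp_norm M p (\<lambda>t. y t - x t) \<le> Lp_norm M p (\<lambda>t. \<delta> *\<^sub>R w t)" by (rule dom) (use diff in auto)
      also have "\<dots> \<le> \<delta>" using Lp_scale(2)[OF p w(1), of \<delta>] d w(2) mult_left_mono[OF w(2), of \<delta>] by simp
      finally have yx': "Lp_norm M p (y - x) \<le> \<delta>" by (simp add: fun_diff_def)
      have "y \<in> Lp_space M p" using Lp_add[OF p yx xL] by simp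
      moreover have "AE t in M. y t \<in> S t"
        using xS AE_space by eventually_elim (auto simp: y_def s_in)
      ultimately have "y \<in> Sel M p S" by (simp add: Sel_def)
      from near[OF this yx' less_imp_le[OF \<eta>(1)] \<eta>(2)] obtain b where b: "b \<in> Lp_space M p" "Lp_norm M p b \<le> 1"
        "AE t in M. y t + \<eta> *\<^sub>R (v t + \<epsilon> *\<^sub>R b t) \<in> S t"
        by (auto simp: Sel_def)
      have "AE t in M. norm (indicator (B \<eta>) t *\<^sub>R w t) \<le> norm ((\<epsilon> / c) *\<^sub>R b t)"
        using b(3)
      proof eventually_elim
        case (elim t)
        show ?case
        proof (cases "t \<in> B \<eta>")
          case True
          have "c * w t * \<eta> < infdist (y t + \<eta> *\<^sub>R v t) (S t)"
            using yP[OF True] True by (simp add: P_def y_def)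
          also have "\<dots> \<le> norm ((\<eta> * \<epsilon>) *\<^sub>R b t)"
            using infdist_le_norm[OF elim, of "y t + \<eta> *\<^sub>R v t"] by (simp add: algebra_simps)
          also have "\<dots> = \<epsilon> * norm (b t) * \<eta>" using \<eta> \<epsilon> by simp
          finally have "c * w t < \<epsilon> * norm (b t)" using \<eta> by simp
          then show ?thesis using c \<epsilon> w(3)[of t] True by (simp add: field_simps)
        qed simp
      qed
      then have "Lp_norm M p (\<lambda>t. indicator (B \<eta>) t *\<^sub>R w t) \<le> Lp_norm M p (\<lambda>t. (\<epsilon> / c) *\<^sub>R b t)"
        by (intro Lp_dominated(2)[OF p Lp_scale(1)[OF p b(1)]]) auto
      also have "\<dots> \<le> \<epsilon> / c"
        using Lp_scale(2)[OF p b(1), of "\<epsilon> / c"] b(2) \<epsilon> c mult_left_mono[OF b(2), of "\<epsilon> / c"] by simp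
      finally show ?thesis .
    qed
    \<comment> \<open>\<open>L j\<close> contains the points that are bad for all steps
      \<open>1 / (i + 1)\<close> with \<open>i \<ge> j\<close>. These sets increase, so their union
      inherits the bound \<open>\<epsilon> / c\<close>; outside the union there are arbitrarily
      small good steps, which is all that \<open>tangent_bound_iterate\<close> needs.\<close>
    define L where "L j = (\<Inter>i\<in>{j..}. B (1 / real (Suc i)))" for j :: nat
    have L: "L j \<in> sets M" for j unfolding L_def by (rule sets.countable_INT') (use B in auto)
    define LL where "LL = (\<Union>j. L j)"
    have LL: "LL \<in> sets M" unfolding LL_def using L by blast
    have [measurable]: "LL \<in> sets M" "L j \<in> sets M" for j using LL L by auto
    have mono: "L i \<subseteq> L j" if "i \<le> j" for i j unfolding L_def using that by (intro INT_anti_mono) auto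
    have "Lp_norm M p (\<lambda>t. indicator LL t *\<^sub>R w t) \<le> \<epsilon> / c + e" if e: "e > 0" for e
    proof -
      have "\<forall>\<^sub>F j in sequentially. t \<notin> LL - L j" for t
      proof (cases "t \<in> LL")
        case True
        then obtain i where "t \<in> L i" by (auto simp: LL_def)
        then have "t \<in> L j" if "i \<le> j" for j using mono[OF that] by blast
        then show ?thesis unfolding eventually_sequentially by blast
      qed simp
      then have "(\<lambda>j. Lp_norm M p (\<lambda>t. indicator (LL - L j) t *\<^sub>R w t)) \<longlonglongrightarrow> 0"
        by (intro Lp_norm_tendsto_zero[OF p w(1)]) auto
      then have "\<forall>\<^sub>F j in sequentially. Lp_norm M p (\<lambda>t. indicator (LL - L j) t *\<^sub>R w t) < e"
        using e by (intro order_tendstoD) auto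
      moreover have "\<forall>\<^sub>F j in sequentially. 1 / real (Suc j) < \<kappa>"
        using order_tendstoD(2)[OF LIMSEQ_Suc[OF lim_1_over_n] d(2)] by simp
      ultimately have "\<forall>\<^sub>F j in sequentially. Lp_norm M p (\<lambda>t. indicator LL t *\<^sub>R w t) \<le> \<epsilon> / c + e"
      proof eventually_elim
        case (elim j)
        have "Lp_norm M p (\<lambda>t. indicator LL t *\<^sub>R w t)
            = Lp_norm M p (\<lambda>t. indicator (L j) t *\<^sub>R w t + indicator (LL - L j) t *\<^sub>R w t)"
          by (rule arg_cong[where f = "Lp_norm M p"]) (auto simp: indicator_def LL_def fun_eq_iff)
        also have "\<dots> \<le> Lp_norm M p (\<lambda>t. indicator (L j) t *\<^sub>R w t)
            + Lp_norm M p (\<lambda>t. indicator (LL - L j) t *\<^sub>R w t)"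
          by (intro Lp_triangle[OF p] Lp_indicator(1)[OF p w(1)]) auto
        also have "Lp_norm M p (\<lambda>t. indicator (L j) t *\<^sub>R w t)
            \<le> Lp_norm M p (\<lambda>t. indicator (B (1 / real (Suc j))) t *\<^sub>R w t)"
          by (rule Lp_norm_indicator_mono[OF p w(1) L B]) (auto simp: L_def)
        also have "\<dots> \<le> \<epsilon> / c" using elim by (intro small) auto
        finally show ?case using elim by simp
      qed
      then show ?thesis using eventually_happens'[OF sequentially_bot] by blast
    qed
    then have "Lp_norm M p (\<lambda>t. indicator LL t *\<^sub>R w t) \<le> \<epsilon> / c" by (rule field_le_epsilon)
    moreover have "tangent_bound (S t) (x t) (v t) d'"
      if t: "t \<in> space M - LL" and xt: "x t \<in> S t" and d': "d' > c * w t" for t d'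
    proof (rule tangent_bound_iterate[OF xt _ _ d'])
      show "\<delta> * w t > 0" using d w(3) by simp
      fix e :: real assume e: "e > 0"
      obtain j where j: "1 / real (Suc j) < e" using nat_approx_posE[OF e] by blast
      have "t \<notin> L j" using t by (auto simp: LL_def)
      then obtain i where i: "i \<ge> j" "t \<notin> B (1 / real (Suc i))" by (auto simp: L_def)
      define \<eta> where "\<eta> = 1 / real (Suc i)"
      have "\<eta> \<le> 1 / real (Suc j)" unfolding \<eta>_def using i by (intro divide_left_mono) auto
      then have \<eta>: "0 < \<eta>" "\<eta> < e" using j by (auto simp: \<eta>_def)
      have notP: "infdist (s n t + \<eta> *\<^sub>R v t) (S t) \<le> c * w t * \<eta>" if "norm (s n t - x t) < \<delta> * w t" for n
      proof -
        have "\<not> P \<eta> n t" using i(2) t unfolding B_def \<eta>_def by blast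
        then show ?thesis using that unfolding P_def by linarith
      qed
      have "infdist (y + \<eta> *\<^sub>R v t) (S t) \<le> c * w t * \<eta>" if y: "y \<in> S t" "norm (y - x t) < \<delta> * w t" for y
      proof (rule field_le_epsilon)
        fix e' :: real assume e': "e' > 0"
        obtain n where n: "dist (s n t) y < min e' (\<delta> * w t - norm (y - x t))"
          using s_dense[OF _ y(1), of "min e' (\<delta> * w t - norm (y - x t))"] t y(2) e' by auto
        have "norm (s n t - x t) < \<delta> * w t"
          using norm_triangle_ineq[of "s n t - y" "y - x t"] n by (simp add: dist_norm)
        then show "infdist (y + \<eta> *\<^sub>R v t) (S t) \<le> c * w t * \<eta> + e'"
          using notP[of n] infdist_triangle[of "y + \<eta> *\<^sub>R v t" "S t" "s n t + \<eta> *\<^sub>R v t"] n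
          by (simp add: dist_norm norm_minus_commute)
      qed
      then show "\<exists>\<eta>. 0 < \<eta> \<and> \<eta> < e \<and>
          (\<forall>y\<in>S t. norm (y - x t) < \<delta> * w t \<longrightarrow> infdist (y + \<eta> *\<^sub>R v t) (S t) \<le> c * w t * \<eta>)"
        using \<eta> by blast
    qed
    ultimately show ?thesis using LL by blast
  qed
  have bound: "AE t in M. \<forall>d>c * w t. tangent_bound (S t) (x t) (v t) d" if c: "c > 0" for c
  proof -
    \<comment> \<open>\<open>key\<close> is used with error \<open>c / (m + 1)\<close>. On the
      intersection of the exceptional sets \<open>w\<close> has norm 0, so the intersection is null
      by positivity of \<open>w\<close>.\<close>
    have "\<forall>m::nat. \<exists>L\<in>sets M. Lp_norm M (ereal p) (\<lambda>t. indicator L t *\<^sub>R w t) \<le> (c / real (Suc m)) / c \<and>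
      (\<forall>t\<in>space M - L. x t \<in> S t \<longrightarrow> (\<forall>d>c * w t. tangent_bound (S t) (x t) (v t) d))"
      using c by (intro allI key) auto
    then obtain L where L: "\<And>m::nat. L m \<in> sets M"
      "\<And>m. Lp_norm M (ereal p) (\<lambda>t. indicator (L m) t *\<^sub>R w t) \<le> (c / real (Suc m)) / c"
      "\<And>m t d. t \<in> space M - L m \<Longrightarrow> x t \<in> S t \<Longrightarrow> d > c * w t \<Longrightarrow> tangent_bound (S t) (x t) (v t) d"
      by metis
    define K where "K = (\<Inter>m. L m)"
    have K [measurable]: "K \<in> sets M" unfolding K_def by (rule sets.countable_INT') (use L(1) in auto)
    have Kw: "(\<lambda>t. indicator K t *\<^sub>R w t) \<in> Lp_space M p" by (rule Lp_indicator(1)[OF p w(1) K])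
    have "Lp_norm M p (\<lambda>t. indicator K t *\<^sub>R w t) \<le> 0 + e" if e: "e > 0" for e
    proof -
      obtain m where m: "1 / real (Suc m) < e" using nat_approx_posE[OF e] by blast
      have "Lp_norm M p (\<lambda>t. indicator K t *\<^sub>R w t) \<le> Lp_norm M p (\<lambda>t. indicator (L m) t *\<^sub>R w t)"
        by (rule Lp_norm_indicator_mono[OF p w(1) K L(1)]) (auto simp: K_def)
      also have "\<dots> \<le> 1 / real (Suc m)" using L(2)[of m] c by simp
      finally show ?thesis using m by simp
    qed
    then have "Lp_norm M p (\<lambda>t. indicator K t *\<^sub>R w t) \<le> 0" by (rule field_le_epsilon)
    then have "Lp_norm M p (\<lambda>t. indicator K t *\<^sub>R w t) = 0" using Lp_norm_nonneg[OF p] by (rule antisym)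
    then have "AE t in M. indicator K t *\<^sub>R w t = 0" using Lp_norm_zero_iff[OF p Kw] by simp
    then show ?thesis
      using xS AE_space
    proof eventually_elim
      case (elim t)
      then have "t \<notin> K" using w(3)[of t] by (auto simp: indicator_def split: if_splits)
      then obtain m where "t \<notin> L m" by (auto simp: K_def)
      then show ?case using L(3)[of t m] elim by blast
    qed
  qed
  have "AE t in M. \<forall>j::nat. \<forall>d>(1 / real (Suc j)) * w t. tangent_bound (S t) (x t) (v t) d"
    unfolding AE_all_countable by (intro allI bound) simp
  then show ?thesis
    using xS
  proof eventually_elim
    case (elim t)
    have "tangent_bound (S t) (x t) (v t) d" if d: "d > 0" for d
    proof -
      obtain j where "1 / real (Suc j) < d / w t" using nat_approx_posE[of "d / w t"] d w(3)[of t] by auto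
      then have "(1 / real (Suc j)) * w t < d" using w(3)[of t] by (simp only: pos_less_divide_eq)
      then show ?thesis using elim(1) by blast
    qed
    then show ?case using clarke_tangent_cone_iff[OF elim(2)] by blast
  qed
qed

end

section \<open>The dual of a Lebesgue-Bochner space\<close>

text \<open>The hypothesis concerns rational combinations because only countably many inequalities
  can be arranged to hold together almost everywhere; it extends to real combinations by
  approximation. Hahn-Banach is applied to the infimal convolution of
  \<open>\<gamma> * norm v\<close> with the prescribed values. Working with lists of coefficients
  avoids any question of linear dependence among the \<open>D n\<close>.\<close>

lemma rational_functional_extension:
  fixes D :: "nat \<Rightarrow> 'z::real_normed_vector" and a :: "nat \<Rightarrow> real"
  assumes \<gamma>: "0 \<le> \<gamma>"
    and bound: "\<And>l. \<bar>\<Sum>(r, n)\<leftarrow>l. real_of_rat r * a n\<bar> \<le> \<gamma> * norm (\<Sum>(r, n)\<leftarrow>l. real_of_rat r *\<^sub>R D n)"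
  obtains \<zeta> :: "'z \<Rightarrow>\<^sub>L real" where "\<And>n. \<zeta> (D n) = a n" "norm \<zeta> \<le> \<gamma>"
proof -
  define H where "H l = (\<Sum>(r, n)\<leftarrow>l. r * a n)" for l :: "(real \<times> nat) list"
  define E where "E l = (\<Sum>(r, n)\<leftarrow>l. r *\<^sub>R D n)" for l :: "(real \<times> nat) list"
  have approx: "\<exists>k. \<bar>H l - (\<Sum>(r, n)\<leftarrow>k. real_of_rat r * a n)\<bar> < e \<and>
      norm (E l - (\<Sum>(r, n)\<leftarrow>k. real_of_rat r *\<^sub>R D n)) < e" if "e > 0" for l e
    using that
  proof (induction l arbitrary: e)
    case Nil
    then show ?case by (intro exI[of _ "[]"]) (simp add: H_def E_def)
  next
    case (Cons rn l)
    obtain r n where rn: "rn = (r, n)" by fastforce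
    obtain k where k: "\<bar>H l - (\<Sum>(r, n)\<leftarrow>k. real_of_rat r * a n)\<bar> < e / 2"
      "norm (E l - (\<Sum>(r, n)\<leftarrow>k. real_of_rat r *\<^sub>R D n)) < e / 2"
      using Cons.IH[of "e / 2"] Cons.prems by auto
    define m where "m = 1 + \<bar>a n\<bar> + norm (D n)"
    have m: "m > 0" "\<bar>a n\<bar> \<le> m" "norm (D n) \<le> m"
      using abs_ge_zero[of "a n"] norm_ge_zero[of "D n"] unfolding m_def by linarith+
    obtain q where q: "r < real_of_rat q" "real_of_rat q < r + e / (2 * m)"
      using of_rat_dense[of r "r + e / (2 * m)"] Cons.prems m(1) by auto
    have small: "\<bar>r - real_of_rat q\<bar> * m < e / 2"
    proof -
      have "\<bar>r - real_of_rat q\<bar> < e / (2 * m)" using q by linarith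
      then show ?thesis using m(1) by (simp add: pos_less_divide_eq)
    qed
    have 1: "\<bar>(r - real_of_rat q) * a n\<bar> < e / 2"
      using mult_left_mono[OF m(2), of "\<bar>r - real_of_rat q\<bar>"] small by (simp add: abs_mult)
    have 2: "norm ((r - real_of_rat q) *\<^sub>R D n) < e / 2"
      using mult_left_mono[OF m(3), of "\<bar>r - real_of_rat q\<bar>"] small by simp
    have "H (rn # l) - (\<Sum>(r, n)\<leftarrow>(q, n) # k. real_of_rat r * a n)
        = (r - real_of_rat q) * a n + (H l - (\<Sum>(r, n)\<leftarrow>k. real_of_rat r * a n))"
      by (simp add: H_def rn algebra_simps)
    then have A: "\<bar>H (rn # l) - (\<Sum>(r, n)\<leftarrow>(q, n) # k. real_of_rat r * a n)\<bar> < e"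
      using 1 k(1) by linarith
    have eq: "E (rn # l) - (\<Sum>(r, n)\<leftarrow>(q, n) # k. real_of_rat r *\<^sub>R D n)
        = (r - real_of_rat q) *\<^sub>R D n + (E l - (\<Sum>(r, n)\<leftarrow>k. real_of_rat r *\<^sub>R D n))"
      by (simp add: E_def rn algebra_simps)
    have "norm (E (rn # l) - (\<Sum>(r, n)\<leftarrow>(q, n) # k. real_of_rat r *\<^sub>R D n)) < e"
      unfolding eq using norm_triangle_ineq[of "(r - real_of_rat q) *\<^sub>R D n" "E l - (\<Sum>(r, n)\<leftarrow>k. real_of_rat r *\<^sub>R D n)"] 2 k(2)
      by linarith
    with A show ?case by blast
  qed
  have HE: "\<bar>H l\<bar> \<le> \<gamma> * norm (E l)" for l
  proof (rule field_le_epsilon)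
    fix e :: real assume e: "e > 0"
    define d where "d = e / (1 + \<gamma>)"
    have "d * (1 + \<gamma>) = e" using \<gamma> by (simp add: d_def)
    then have d: "d > 0" "d + \<gamma> * d = e" using e \<gamma> by (simp add: d_def, simp add: algebra_simps)
    obtain k where k: "\<bar>H l - (\<Sum>(r, n)\<leftarrow>k. real_of_rat r * a n)\<bar> < d"
      "norm (E l - (\<Sum>(r, n)\<leftarrow>k. real_of_rat r *\<^sub>R D n)) < d" using approx[OF d(1)] by blast
    have "norm (\<Sum>(r, n)\<leftarrow>k. real_of_rat r *\<^sub>R D n) \<le> norm (E l) + d"
      using k(2) norm_triangle_ineq2[of "\<Sum>(r, n)\<leftarrow>k. real_of_rat r *\<^sub>R D n" "E l"] by (simp add: norm_minus_commute)
    then have "\<gamma> * norm (\<Sum>(r, n)\<leftarrow>k. real_of_rat r *\<^sub>R D n) \<le> \<gamma> * (norm (E l) + d)"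
      using \<gamma> by (rule mult_left_mono)
    then show "\<bar>H l\<bar> \<le> \<gamma> * norm (E l) + e" using bound[of k] k(1) d(2) by (simp add: distrib_left)
  qed
  define Q where "Q v c \<longleftrightarrow> (\<exists>l. \<gamma> * norm (v - E l) + H l \<le> c)" for v c
  have 1: "Q v (\<gamma> * norm v)" for v unfolding Q_def by (intro exI[of _ "[]"]) (simp add: E_def H_def)
  have lb: "- (\<gamma> * norm v) \<le> c" if Q: "Q v c" for v c
  proof -
    obtain l where l: "\<gamma> * norm (v - E l) + H l \<le> c" using Q unfolding Q_def by blast
    have "norm (E l) \<le> norm (v - E l) + norm v"
      using norm_triangle_ineq2[of "E l" v] by (simp add: norm_minus_commute)
    then have "\<gamma> * norm (E l) \<le> \<gamma> * norm (v - E l) + \<gamma> * norm v"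
      using mult_left_mono[OF _ \<gamma>] by (metis distrib_left)
    then show ?thesis using l HE[of l] by linarith
  qed
  have 2: "Q (u + v) (c + d)" if Q: "Q u c" "Q v d" for u v c d
  proof -
    obtain k l where kl: "\<gamma> * norm (u - E k) + H k \<le> c" "\<gamma> * norm (v - E l) + H l \<le> d"
      using Q unfolding Q_def by blast
    have "norm (u + v - E (k @ l)) \<le> norm (u - E k) + norm (v - E l)"
      using norm_triangle_ineq[of "u - E k" "v - E l"] by (simp add: E_def algebra_simps)
    then have "\<gamma> * norm (u + v - E (k @ l)) \<le> \<gamma> * norm (u - E k) + \<gamma> * norm (v - E l)"
      using mult_left_mono[OF _ \<gamma>] by (metis distrib_left)
    moreover have "H (k @ l) = H k + H l" by (simp add: H_def)
    ultimately show ?thesis unfolding Q_def using kl by (intro exI[of _ "k @ l"]) linarith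
  qed
  have 3: "Q (b *\<^sub>R v) (b * c)" if b: "b > 0" and Q: "Q v c" for b v c
  proof -
    obtain l where l: "\<gamma> * norm (v - E l) + H l \<le> c" using Q unfolding Q_def by blast
    define k where "k = map (\<lambda>(r, n). (b * r, n)) l"
    have "E k = b *\<^sub>R E l" "H k = b * H l" unfolding k_def E_def H_def
      by (induction l) (auto simp: algebra_simps)
    then have "\<gamma> * norm (b *\<^sub>R v - E k) + H k = b * (\<gamma> * norm (v - E l) + H l)"
      using b by (simp add: algebra_simps flip: scaleR_diff_right)
    also have "\<dots> \<le> b * c" using b l by (intro mult_left_mono) auto
    finally show ?thesis unfolding Q_def by blast
  qed
  define P where "P v = Inf {c. Q v c}" for v
  have P: "sublinear P"
    by (rule sublinear_Inf[of Q "\<lambda>v. \<gamma> * norm v" "\<lambda>v. - (\<gamma> * norm v)", folded P_def]) (blast intro: 1 lb 2 3)+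
  have P_le: "\<And>v c. Q v c \<Longrightarrow> P v \<le> c"
    by (rule sublinear_Inf[of Q "\<lambda>v. \<gamma> * norm v" "\<lambda>v. - (\<gamma> * norm v)", folded P_def]) (blast intro: 1 lb 2 3)+
  obtain F where F: "linear F" "\<And>v. F v \<le> P v" using hahn_banach_sublinear[OF P] by blast
  have F_le: "F v \<le> \<gamma> * norm v" for v using F(2)[of v] P_le[OF 1[of v]] by linarith
  obtain \<zeta> where \<zeta>: "blinfun_apply \<zeta> = F" using linear_dominated_blinfun[OF F(1) F_le] by blast
  show thesis
  proof (rule that)
    show "norm \<zeta> \<le> \<gamma>" by (rule norm_blinfun_le_of_le[OF \<gamma>]) (simp add: \<zeta> F_le)
    fix n
    have "Q (D n) (a n)" unfolding Q_def by (intro exI[of _ "[(1, n)]"]) (simp add: E_def H_def)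
    moreover have "Q (- D n) (- a n)" unfolding Q_def by (intro exI[of _ "[(-1, n)]"]) (simp add: E_def H_def)
    ultimately have "F (D n) \<le> a n" "F (- D n) \<le> - a n"
      using F(2) P_le order_trans by blast+
    then show "\<zeta> (D n) = a n" using linear_neg[OF F(1), of "D n"] by (simp add: \<zeta>)
  qed
qed

text \<open>The bound by the norm of \<open>w\<close> on \<open>A\<close> acts twice: it tends to 0
  along sets decreasing to the empty set, which gives countable additivity, and it vanishes on null
  sets, which gives absolute continuity for the Radon-Nikodym theorem.\<close>

lemma additive_set_function_density:
  fixes \<nu> :: "'t set \<Rightarrow> real" and w :: "'t \<Rightarrow> real"
  assumes p: "1 \<le> p" and sf: "sigma_finite_measure M" and w: "w \<in> Lp_space M (ereal p)"
    and nonneg: "\<And>A. A \<in> sets M \<Longrightarrow> 0 \<le> \<nu> A"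
    and add: "\<And>A B. A \<in> sets M \<Longrightarrow> B \<in> sets M \<Longrightarrow> A \<inter> B = {} \<Longrightarrow> \<nu> (A \<union> B) = \<nu> A + \<nu> B"
    and bound: "\<And>A. A \<in> sets M \<Longrightarrow> \<nu> A \<le> c * Lp_norm M (ereal p) (\<lambda>t. indicator A t *\<^sub>R w t)"
  obtains g where "g \<in> borel_measurable M" "integrable M g"
    "\<And>A. A \<in> sets M \<Longrightarrow> (LINT t|M. indicator A t * g t) = \<nu> A"
proof -
  interpret sigma_finite_measure M by fact
  define f where "f A = ennreal (\<nu> A)" for A
  have zero: "\<nu> {} = 0" using add[of "{}" "{}"] by simp
  have pos: "positive (sets M) f" by (simp add: positive_def f_def zero)
  have "countably_additive (sets M) f"
  proof (rule sets.empty_continuous_imp_countably_additive[OF pos])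
    show "additive (sets M) f"
      unfolding additive_def f_def using add nonneg by (auto simp: ennreal_plus[symmetric] simp del: ennreal_plus)
    show "\<forall>A\<in>sets M. f A \<noteq> \<infinity>" by (simp add: f_def)
    fix A :: "nat \<Rightarrow> 't set" assume A: "range A \<subseteq> sets M" "decseq A" "(\<Inter>i. A i) = {}"
    then have Am: "A n \<in> sets M" for n by auto
    have "\<forall>\<^sub>F n in sequentially. t \<notin> A n" for t
    proof -
      obtain m where "t \<notin> A m" using A(3) by blast
      then have "t \<notin> A n" if "m \<le> n" for n using decseqD[OF A(2) that] by blast
      then show ?thesis unfolding eventually_sequentially by blast
    qed
    then have "(\<lambda>n. Lp_norm M (ereal p) (\<lambda>t. indicator (A n) t *\<^sub>R w t)) \<longlonglongrightarrow> 0"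
      by (intro Lp_norm_tendsto_zero[OF p w Am]) auto
    from tendsto_mult_left[OF this, of c]
    have lim: "(\<lambda>n. c * Lp_norm M (ereal p) (\<lambda>t. indicator (A n) t *\<^sub>R w t)) \<longlonglongrightarrow> 0" by simp
    have "(\<lambda>n. \<nu> (A n)) \<longlonglongrightarrow> 0"
    proof (rule tendsto_sandwich[OF _ _ tendsto_const lim])
      show "\<forall>\<^sub>F n in sequentially. 0 \<le> \<nu> (A n)" using nonneg[OF Am] by simp
      show "\<forall>\<^sub>F n in sequentially. \<nu> (A n) \<le> c * Lp_norm M (ereal p) (\<lambda>t. indicator (A n) t *\<^sub>R w t)"
        using bound[OF Am] by (intro always_eventually allI)
    qed
    then show "(\<lambda>n. f (A n)) \<longlonglongrightarrow> 0" unfolding f_def by (metis ennreal_0 tendsto_ennrealI)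
  qed
  define N where "N = measure_of (space M) (sets M) f"
  have N_sets: "sets N = sets M" "space N = space M" by (simp_all add: N_def)
  have N: "emeasure N A = f A" if "A \<in> sets M" for A
    unfolding N_def by (rule emeasure_measure_of_sigma[OF sets.sigma_algebra_axioms pos \<open>countably_additive (sets M) f\<close> that])
  have "absolutely_continuous M N"
    unfolding absolutely_continuous_def
  proof
    fix A assume A: "A \<in> null_sets M"
    then have As: "A \<in> sets M" by auto
    have "AE t in M. t \<notin> A" using A by (rule AE_not_in)
    then have "AE t in M. indicator A t *\<^sub>R w t = 0" by eventually_elim simp
    then have "Lp_norm M (ereal p) (\<lambda>t. indicator A t *\<^sub>R w t) = 0"
      using Lp_norm_zero_iff[OF p Lp_indicator(1)[OF p w As]] by simp
    then have "\<nu> A = 0" using bound[OF As] nonneg[OF As] by simp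
    then show "A \<in> null_sets N" using N[OF As] As by (simp add: null_sets_def N_sets f_def)
  qed
  then obtain h where h: "h \<in> borel_measurable M" "density M h = N"
    using Radon_Nikodym[OF _ N_sets(1)] by blast
  have hA: "(\<integral>\<^sup>+t. h t * indicator A t \<partial>M) = ennreal (\<nu> A)" if "A \<in> sets M" for A
    using emeasure_density[OF h(1) that] N[OF that] by (simp add: h(2) f_def)
  have "(\<integral>\<^sup>+t. h t \<partial>M) = (\<integral>\<^sup>+t. h t * indicator (space M) t \<partial>M)"
    by (intro nn_integral_cong) simp
  also have "\<dots> \<noteq> \<infinity>" using hA[OF sets.top] by simp
  finally have fin: "AE t in M. h t \<noteq> \<infinity>" by (rule nn_integral_noteq_infinite[OF h(1)])
  define g where "g t = enn2real (h t)" for t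
  have [measurable]: "h \<in> borel_measurable M" by (rule h(1))
  have gm [measurable]: "g \<in> borel_measurable M" unfolding g_def[abs_def] by measurable
  have gh: "AE t in M. ennreal (g t) = h t" using fin by eventually_elim (simp add: g_def top.not_eq_extremum)
  have gA: "(\<integral>\<^sup>+t. ennreal (indicator A t * g t) \<partial>M) = ennreal (\<nu> A)" if A: "A \<in> sets M" for A
  proof -
    have "(\<integral>\<^sup>+t. ennreal (indicator A t * g t) \<partial>M) = (\<integral>\<^sup>+t. h t * indicator A t \<partial>M)"
      using gh by (intro nn_integral_cong_AE) (auto simp: indicator_def)
    then show ?thesis using hA[OF A] by simp
  qed
  have "(\<integral>\<^sup>+t. ennreal (norm (g t)) \<partial>M) = (\<integral>\<^sup>+t. ennreal (indicator (space M) t * g t) \<partial>M)"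
    by (intro nn_integral_cong) (simp add: g_def)
  also have "\<dots> < \<infinity>" using gA[OF sets.top] by simp
  finally have int: "integrable M g" using gm by (intro integrableI_bounded) auto
  show thesis
  proof (rule that[OF gm int])
    fix A assume A: "A \<in> sets M"
    then have [measurable]: "A \<in> sets M" .
    have "(LINT t|M. indicator A t * g t) = enn2real (\<integral>\<^sup>+t. ennreal (indicator A t * g t) \<partial>M)"
      by (rule integral_eq_nn_integral) (auto simp: g_def)
    then show "(LINT t|M. indicator A t * g t) = \<nu> A" using gA[OF A] nonneg[OF A] by simp
  qed
qed

lemma borel_measurable_of_cballs:
  fixes f :: "'t \<Rightarrow> 'b::real_normed_vector" and E :: "nat \<Rightarrow> 'b"
  assumes E: "\<And>z e. e > 0 \<Longrightarrow> \<exists>n. norm (z - E n) < e"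
    and ball: "\<And>z r. r > 0 \<Longrightarrow> {t \<in> space M. norm (f t - z) \<le> r} \<in> sets M"
  shows "f \<in> borel_measurable M"
proof (rule borel_measurableI)
  fix U :: "'b set" assume U: "open U"
  have "{t \<in> space M. {f t} \<inter> U \<noteq> {}} \<in> sets M"
    by (rule sets_open_from_cballs[OF E _ U]) (use ball in \<open>auto simp: dist_norm norm_minus_commute\<close>)
  moreover have "{t \<in> space M. {f t} \<inter> U \<noteq> {}} = f -` U \<inter> space M" by auto
  ultimately show "f -` U \<inter> space M \<in> sets M" by simp
qed

text \<open>Approximating \<open>f\<close> by functions with values in a countable dense set reduces
  the claim to the functions \<open>\<xi> t z\<close> with \<open>z\<close> fixed.\<close>

lemma measurable_pairing:
  fixes \<xi> :: "'t \<Rightarrow> 'z::{real_normed_vector, second_countable_topology} \<Rightarrow>\<^sub>L real"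
  assumes \<xi>: "\<xi> \<in> borel_measurable M" and f: "f \<in> borel_measurable M"
  shows "(\<lambda>t. \<xi> t (f t)) \<in> borel_measurable M"
proof -
  obtain D :: "nat \<Rightarrow> 'z" where D: "\<And>z e. e > 0 \<Longrightarrow> \<exists>n. norm (z - D n) < e"
    using countable_dense_real_normed by blast
  have [measurable]: "f \<in> borel_measurable M" by fact
  have \<xi>z [measurable]: "(\<lambda>t. \<xi> t z) \<in> borel_measurable M" for z
    by (rule borel_measurable_continuous_on[where f = "\<lambda>\<zeta>. blinfun_apply \<zeta> z", OF _ \<xi>])
      (intro continuous_intros)
  define P where "P j n t \<longleftrightarrow> norm (f t - D n) < 1 / real (Suc j)" for j n :: nat and t
  have P: "{t \<in> space M. P j n t} \<in> sets M" for j n unfolding P_def by measurable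
  show ?thesis
  proof (rule borel_measurable_LIMSEQ_real)
    show "(\<lambda>t. \<xi> t (D (LEAST n. P j n t))) \<in> borel_measurable M" for j
      by (rule measurable_first_index[OF P, where D = "\<lambda>n t. \<xi> t (D n)"]) measurable
    fix t assume "t \<in> space M"
    have "\<exists>n. P j n t" for j unfolding P_def by (rule D) simp
    then have "P j (LEAST n. P j n t) t" for j by (rule LeastI_ex)
    then have "norm (D (LEAST n. P j n t) - f t) \<le> 1 / real (Suc j)" for j
      unfolding P_def by (metis less_imp_le norm_minus_commute)
    then have "(\<lambda>j. D (LEAST n. P j n t) - f t) \<longlonglongrightarrow> 0"
      by (intro Lim_null_comparison[OF always_eventually LIMSEQ_Suc[OF lim_1_over_n]] allI)
    then have "(\<lambda>j. D (LEAST n. P j n t)) \<longlonglongrightarrow> f t" by (rule LIM_zero_cancel)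
    then show "(\<lambda>j. \<xi> t (D (LEAST n. P j n t))) \<longlonglongrightarrow> \<xi> t (f t)"
      by (intro tendsto_intros)
  qed
qed

section \<open>The vector measure of a functional on L^p and its density\<close>

locale Lp_functional =
  fixes M :: "'t measure" and p :: real
    and \<phi> :: "('t \<Rightarrow> 'z::{real_normed_vector, second_countable_topology}) \<Rightarrow> real"
    and K :: real and w :: "'t \<Rightarrow> real"
  assumes p: "1 \<le> p" and sf: "sigma_finite_measure M"
    and \<phi>_add: "\<And>f g. f \<in> Lp_space M p \<Longrightarrow> g \<in> Lp_space M p \<Longrightarrow> \<phi> (\<lambda>t. f t + g t) = \<phi> f + \<phi> g"
    and \<phi>_scale: "\<And>r f. f \<in> Lp_space M p \<Longrightarrow> \<phi> (\<lambda>t. r *\<^sub>R f t) = r * \<phi> f"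
    and \<phi>_bound: "\<And>f. f \<in> Lp_space M p \<Longrightarrow> \<bar>\<phi> f\<bar> \<le> K * Lp_norm M p f" and K: "0 \<le> K"
    and w: "w \<in> Lp_space M p" and w_pos: "\<And>t. 0 < w t"
begin

lemma w_meas [measurable]: "w \<in> borel_measurable M"
  by (rule Lp_measurable[OF p w])

definition dominated :: "'t set \<Rightarrow> ('t \<Rightarrow> 'z) set" where
  "dominated A = {f \<in> Lp_space M p. \<forall>t. norm (f t) \<le> indicator A t * w t}"

text \<open>
  The total variation of the vector measure that sends \<open>A\<close> to the functional \<open>z \<mapsto> \<phi> (weighted A z)\<close>.
  It makes \<open>\<phi> (weighted A z) + norm z * variation A\<close> nonnegative, so that the Radon-Nikodym theorem
  applies without a Jordan decomposition.
\<close>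

definition variation :: "'t set \<Rightarrow> real" where
  "variation A = (SUP f\<in>dominated A. \<phi> f)"

text \<open>The factor \<open>w\<close> makes this function p-integrable for every measurable
  \<open>A\<close>, also when \<open>A\<close> has infinite measure.\<close>

definition weighted :: "'t set \<Rightarrow> 'z \<Rightarrow> 't \<Rightarrow> 'z" where
  "weighted A z = (\<lambda>t. (indicator A t * w t) *\<^sub>R z)"

lemma dominated_bound:
  assumes A: "A \<in> sets M" and f: "f \<in> dominated A"
  shows "\<phi> f \<le> K * Lp_norm M p (\<lambda>t. indicator A t *\<^sub>R w t)"
proof -
  have f': "f \<in> Lp_space M p" "\<And>t. norm (f t) \<le> indicator A t * w t" using f by (auto simp: dominated_def)
  have "\<phi> f \<le> K * Lp_norm M p f" using \<phi>_bound[OF f'(1)] by simp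
  also have "\<dots> \<le> K * Lp_norm M p (\<lambda>t. indicator A t *\<^sub>R w t)"
    by (intro mult_left_mono K Lp_dominated(2)[OF p Lp_indicator(1)[OF p w A]] Lp_measurable[OF p f'(1)] AE_I2)
      (use f'(2) in \<open>simp add: order_trans[OF _ abs_ge_self]\<close>)
  finally show ?thesis .
qed

lemma zero_dominated: "(\<lambda>_. 0) \<in> dominated A"
  using w_pos by (auto simp: dominated_def Lp_zero[OF p] less_imp_le)

lemma \<phi>_le_variation: "A \<in> sets M \<Longrightarrow> f \<in> dominated A \<Longrightarrow> \<phi> f \<le> variation A"
  unfolding variation_def by (intro cSUP_upper bdd_aboveI2[OF dominated_bound]) auto

lemma variation_le: "(\<And>f. f \<in> dominated A \<Longrightarrow> \<phi> f \<le> c) \<Longrightarrow> variation A \<le> c"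
  unfolding variation_def using zero_dominated by (intro cSUP_least) auto

lemma \<phi>_zero: "\<phi> (\<lambda>_. 0) = 0"
  using \<phi>_scale[OF Lp_zero[OF p], of 0] by simp

lemma variation_nonneg: "A \<in> sets M \<Longrightarrow> 0 \<le> variation A"
  using \<phi>_le_variation[OF _ zero_dominated] by (simp add: \<phi>_zero)

text \<open>A function dominated on the union splits into its restrictions; conversely functions
  dominated on the two disjoint sets can be chosen independently and added.\<close>

lemma variation_add:
  assumes A: "A \<in> sets M" and B: "B \<in> sets M" and AB: "A \<inter> B = {}"
  shows "variation (A \<union> B) = variation A + variation B"
proof (rule antisym)
  have C: "A \<union> B \<in> sets M" using A B by auto
  show "variation (A \<union> B) \<le> variation A + variation B"
  proof (rule variation_le)
    fix f assume f: "f \<in> dominated (A \<union> B)"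
    then have fL: "f \<in> Lp_space M p" by (simp add: dominated_def)
    note fA = Lp_indicator(1)[OF p fL A] and fB = Lp_indicator(1)[OF p fL B]
    have "f t = indicator A t *\<^sub>R f t + indicator B t *\<^sub>R f t" for t
    proof -
      have "norm (f t) \<le> indicator (A \<union> B) t * w t" using f by (simp add: dominated_def)
      then show ?thesis using AB by (cases "t \<in> A"; cases "t \<in> B") auto
    qed
    then have "\<phi> f = \<phi> (\<lambda>t. indicator A t *\<^sub>R f t) + \<phi> (\<lambda>t. indicator B t *\<^sub>R f t)"
      using \<phi>_add[OF fA fB] by presburger
    also have "\<dots> \<le> variation A + variation B"
    proof (intro add_mono \<phi>_le_variation A B)
      have nf: "norm (f t) \<le> indicator (A \<union> B) t * w t" for t using f by (simp add: dominated_def)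
      have "norm (indicator A t *\<^sub>R f t) \<le> indicator A t * w t" for t
        using nf[of t] by (cases "t \<in> A") auto
      then show "(\<lambda>t. indicator A t *\<^sub>R f t) \<in> dominated A" using fA by (simp add: dominated_def)
      have "norm (indicator B t *\<^sub>R f t) \<le> indicator B t * w t" for t
        using nf[of t] by (cases "t \<in> B") auto
      then show "(\<lambda>t. indicator B t *\<^sub>R f t) \<in> dominated B" using fB by (simp add: dominated_def)
    qed
    finally show "\<phi> f \<le> variation A + variation B" .
  qed
  have "\<phi> f + \<phi> g \<le> variation (A \<union> B)" if f: "f \<in> dominated A" and g: "g \<in> dominated B" for f g
  proof -
    have fg: "f \<in> Lp_space M p" "g \<in> Lp_space M p" using f g by (auto simp: dominated_def)
    have "norm (f t + g t) \<le> indicator (A \<union> B) t * w t" for t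
    proof -
      have "indicator (A \<union> B) t * w t = indicator A t * w t + indicator B t * w t"
        using AB by (auto simp: indicator_def)
      moreover have "norm (f t) \<le> indicator A t * w t" "norm (g t) \<le> indicator B t * w t"
        using f g by (auto simp: dominated_def)
      ultimately show ?thesis using norm_triangle_ineq[of "f t" "g t"] by linarith
    qed
    then have "(\<lambda>t. f t + g t) \<in> dominated (A \<union> B)" using Lp_add[OF p fg] by (simp add: dominated_def)
    from \<phi>_le_variation[OF C this] show ?thesis by (simp add: \<phi>_add[OF fg])
  qed
  then have "\<phi> f \<le> variation (A \<union> B) - \<phi> g" if "f \<in> dominated A" "g \<in> dominated B" for f g
    using that by (simp add: le_diff_eq)
  then have "variation A \<le> variation (A \<union> B) - \<phi> g" if "g \<in> dominated B" for g
    using that by (intro variation_le) auto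
  then have "variation B \<le> variation (A \<union> B) - variation A"
    by (intro variation_le) (simp add: le_diff_eq add.commute)
  then show "variation A + variation B \<le> variation (A \<union> B)" by simp
qed

lemma weighted_Lp: "A \<in> sets M \<Longrightarrow> weighted A z \<in> Lp_space M p"
proof -
  assume [measurable]: "A \<in> sets M"
  show ?thesis unfolding weighted_def
    by (rule Lp_dominated(1)[OF p Lp_scale(1)[OF p w, of "norm z"]])
      (use w_pos in \<open>auto simp: indicator_def mult.commute\<close>)
qed

text \<open>Divided by \<open>norm z\<close>, and with either sign, \<open>weighted A z\<close> is
  itself dominated on \<open>A\<close>.\<close>

lemma \<phi>_weighted_bound:
  assumes A: "A \<in> sets M"
  shows "\<bar>\<phi> (weighted A z)\<bar> \<le> norm z * variation A"
proof (cases "z = 0")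
  case True
  then show ?thesis by (simp add: weighted_def \<phi>_zero)
next
  case False
  have "\<sigma> * \<phi> (weighted A z) \<le> norm z * variation A" if \<sigma>: "\<bar>\<sigma>\<bar> = 1" for \<sigma> :: real
  proof -
    have "(\<lambda>t. (\<sigma> / norm z) *\<^sub>R weighted A z t) \<in> dominated A"
      using Lp_scale(1)[OF p weighted_Lp[OF A, of z], of "\<sigma> / norm z"] False \<sigma> w_pos
      by (auto simp: dominated_def weighted_def indicator_def less_imp_le abs_mult)
    from \<phi>_le_variation[OF A this] have "\<sigma> / norm z * \<phi> (weighted A z) \<le> variation A"
      by (simp add: \<phi>_scale[OF weighted_Lp[OF A]])
    then show ?thesis using False by (simp add: field_simps)
  qed
  from this[of 1] this[of "-1"] show ?thesis by (simp add: abs_le_iff)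
qed

lemma \<phi>_weighted_add_sets:
  assumes "A \<in> sets M" "B \<in> sets M" "A \<inter> B = {}"
  shows "\<phi> (weighted (A \<union> B) z) = \<phi> (weighted A z) + \<phi> (weighted B z)"
proof -
  have "weighted (A \<union> B) z = (\<lambda>t. weighted A z t + weighted B z t)"
    using assms(3) by (auto simp: weighted_def indicator_def fun_eq_iff)
  then show ?thesis by (simp add: \<phi>_add[OF weighted_Lp[OF assms(1)] weighted_Lp[OF assms(2)]])
qed

lemma \<phi>_weighted_sum_list:
  fixes D :: "nat \<Rightarrow> 'z"
  assumes A: "A \<in> sets M"
  shows "\<phi> (weighted A (\<Sum>(r, n)\<leftarrow>l. real_of_rat r *\<^sub>R D n)) = (\<Sum>(r, n)\<leftarrow>l. real_of_rat r * \<phi> (weighted A (D n)))"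
proof (induction l)
  case Nil
  then show ?case by (simp add: weighted_def \<phi>_zero)
next
  case (Cons rn l)
  obtain r n where rn: "rn = (r, n)" by fastforce
  have "weighted A (\<Sum>(r, n)\<leftarrow>rn # l. real_of_rat r *\<^sub>R D n) =
      (\<lambda>t. real_of_rat r *\<^sub>R weighted A (D n) t + weighted A (\<Sum>(r, n)\<leftarrow>l. real_of_rat r *\<^sub>R D n) t)"
    by (simp add: weighted_def rn scaleR_add_right mult_ac)
  then show ?case
    using Cons \<phi>_add[OF Lp_scale(1)[OF p weighted_Lp[OF A]] weighted_Lp[OF A]] \<phi>_scale[OF weighted_Lp[OF A]]
    by (simp add: rn)
qed

lemma variation_density:
  obtains \<gamma> where "\<gamma> \<in> borel_measurable M" "integrable M \<gamma>"
    "\<And>A. A \<in> sets M \<Longrightarrow> (LINT t|M. indicator A t * \<gamma> t) = variation A"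
proof (rule additive_set_function_density[OF p sf w variation_nonneg variation_add variation_le[OF dominated_bound]])
  fix g assume g: "g \<in> borel_measurable M" "integrable M g"
    "\<And>A. A \<in> sets M \<Longrightarrow> (LINT t|M. indicator A t * g t) = variation A"
  show thesis by (rule that[of g]) (use g in blast)+
qed

lemma weighted_density:
  obtains h where "h \<in> borel_measurable M" "integrable M h"
    "\<And>A. A \<in> sets M \<Longrightarrow> (LINT t|M. indicator A t * h t) = \<phi> (weighted A z)"
proof -
  obtain \<gamma> where \<gamma>: "\<gamma> \<in> borel_measurable M" "integrable M \<gamma>"
    "\<And>A. A \<in> sets M \<Longrightarrow> (LINT t|M. indicator A t * \<gamma> t) = variation A" using variation_density by blast
  define \<nu> where "\<nu> A = \<phi> (weighted A z) + norm z * variation A" for A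
  obtain g where g: "g \<in> borel_measurable M" "integrable M g"
    "\<And>A. A \<in> sets M \<Longrightarrow> (LINT t|M. indicator A t * g t) = \<nu> A"
  proof (rule additive_set_function_density[OF p sf w, of \<nu> "2 * norm z * K"])
    fix A assume A: "A \<in> sets M"
    show "0 \<le> \<nu> A" using \<phi>_weighted_bound[OF A, of z] by (simp add: \<nu>_def abs_le_iff)
    \<comment> \<open>Both summands of \<open>\<nu> A\<close> are at most
      \<open>norm z * variation A\<close>, whence the factor 2.\<close>
    have "\<nu> A \<le> 2 * norm z * variation A" using \<phi>_weighted_bound[OF A, of z] by (simp add: \<nu>_def abs_le_iff)
    also have "\<dots> \<le> 2 * norm z * (K * Lp_norm M p (\<lambda>t. indicator A t *\<^sub>R w t))"
      by (intro mult_left_mono variation_le dominated_bound A) auto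
    finally show "\<nu> A \<le> 2 * norm z * K * Lp_norm M p (\<lambda>t. indicator A t *\<^sub>R w t)" by (simp add: mult_ac)
  next
    fix A B assume "A \<in> sets M" "B \<in> sets M" "A \<inter> B = {}"
    then show "\<nu> (A \<union> B) = \<nu> A + \<nu> B"
      by (simp add: \<nu>_def variation_add \<phi>_weighted_add_sets distrib_left)
  next
    fix g assume g: "g \<in> borel_measurable M" "integrable M g"
      "\<And>A. A \<in> sets M \<Longrightarrow> (LINT t|M. indicator A t * g t) = \<nu> A"
    show thesis by (rule that[of g]) (use g in blast)+
  qed
  show thesis
  proof (rule that[of "\<lambda>t. g t - norm z * \<gamma> t"])
    show "(\<lambda>t. g t - norm z * \<gamma> t) \<in> borel_measurable M" using g \<gamma> by simp
    show "integrable M (\<lambda>t. g t - norm z * \<gamma> t)" using g \<gamma> by simp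
    fix A assume A: "A \<in> sets M"
    have "integrable M (\<lambda>t. indicator A t * g t)" "integrable M (\<lambda>t. indicator A t * \<gamma> t)"
      using integrable_mult_indicator[OF A g(2)] integrable_mult_indicator[OF A \<gamma>(2)] by simp_all
    then have "(LINT t|M. indicator A t * g t - norm z * (indicator A t * \<gamma> t)) = \<nu> A - norm z * variation A"
      using g(3)[OF A] \<gamma>(3)[OF A] by simp
    then show "(LINT t|M. indicator A t * (g t - norm z * \<gamma> t)) = \<phi> (weighted A z)"
      by (simp add: \<nu>_def algebra_simps)
  qed
qed

text \<open>Almost everywhere the densities \<open>h n\<close> attached to the vectors
  \<open>D n\<close> satisfy all rational linear inequalities that the density \<gamma> of the
  variation provides. At such a point there is a functional with values \<open>h n t / w t\<close>
  at \<open>D n\<close> and norm at most \<open>\<gamma> t / w t\<close>. It is chosen point by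
  point, but its values on a dense sequence determine it, so measurability survives the
  choice.\<close>

lemma density_functional:
  fixes D :: "nat \<Rightarrow> 'z"
  assumes refl: "reflexive_space TYPE('z)" and D: "\<And>z e. e > 0 \<Longrightarrow> \<exists>n. norm (z - D n) < e"
  obtains \<xi> :: "'t \<Rightarrow> 'z \<Rightarrow>\<^sub>L real" and \<gamma> where "\<xi> \<in> borel_measurable M" "integrable M \<gamma>"
    "AE t in M. norm (\<xi> t) * w t \<le> \<gamma> t"
    "\<And>n A. A \<in> sets M \<Longrightarrow> (LINT t|M. \<xi> t (weighted A (D n) t)) = \<phi> (weighted A (D n))"
proof -
  obtain \<gamma> where \<gamma>: "\<gamma> \<in> borel_measurable M" "integrable M \<gamma>"
    "\<And>A. A \<in> sets M \<Longrightarrow> (LINT t|M. indicator A t * \<gamma> t) = variation A" using variation_density by blast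
  have "\<forall>n. \<exists>h. h \<in> borel_measurable M \<and> integrable M h \<and>
      (\<forall>A\<in>sets M. (LINT t|M. indicator A t * h t) = \<phi> (weighted A (D n)))"
    using weighted_density by metis
  then obtain h where h: "\<And>n. h n \<in> borel_measurable M" "\<And>n. integrable M (h n)"
    "\<And>n A. A \<in> sets M \<Longrightarrow> (LINT t|M. indicator A t * h n t) = \<phi> (weighted A (D n))" by metis
  have [measurable]: "\<gamma> \<in> borel_measurable M" "h n \<in> borel_measurable M" for n using \<gamma> h by auto
  define E where "E l = (\<Sum>(r, n)\<leftarrow>l. real_of_rat r *\<^sub>R D n)" for l
  define H where "H l t = (\<Sum>(r, n)\<leftarrow>l. real_of_rat r * h n t)" for l t
  have H: "H l \<in> borel_measurable M \<and> integrable M (H l) \<and>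
      (\<forall>A\<in>sets M. (LINT t|M. indicator A t * H l t) = \<phi> (weighted A (E l)))" for l
  proof -
    have "H l \<in> borel_measurable M \<and> integrable M (H l) \<and>
      (\<forall>A\<in>sets M. (LINT t|M. indicator A t * H l t) = (\<Sum>(r, n)\<leftarrow>l. real_of_rat r * \<phi> (weighted A (D n))))"
    proof (induction l)
      case Nil
      then show ?case by (simp add: H_def[abs_def])
    next
      case (Cons rn l)
      obtain r n where rn: "rn = (r, n)" by fastforce
      have Hc: "H (rn # l) = (\<lambda>t. real_of_rat r * h n t + H l t)" by (simp add: H_def[abs_def] rn)
      have "(LINT t|M. indicator A t * H (rn # l) t)
          = (\<Sum>(r, n)\<leftarrow>rn # l. real_of_rat r * \<phi> (weighted A (D n)))" if A: "A \<in> sets M" for A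
      proof -
        have "integrable M (\<lambda>t. indicator A t * h n t)" "integrable M (\<lambda>t. indicator A t * H l t)"
          using integrable_mult_indicator[OF A h(2)[of n]] integrable_mult_indicator[OF A, of "H l"] Cons by simp_all
        then have "(LINT t|M. real_of_rat r * (indicator A t * h n t) + indicator A t * H l t)
            = (\<Sum>(r, n)\<leftarrow>rn # l. real_of_rat r * \<phi> (weighted A (D n)))"
          using Cons A h(3)[OF A, of n] by (simp add: rn)
        then show ?thesis by (simp add: Hc algebra_simps)
      qed
      then show ?case using Cons h(2)[of n] unfolding Hc by auto
    qed
    then show ?thesis using \<phi>_weighted_sum_list by (simp add: E_def)
  qed
  have AE_H: "AE t in M. \<sigma> * H l t \<le> norm (E l) * \<gamma> t" if \<sigma>: "\<bar>\<sigma>\<bar> = 1" for l and \<sigma> :: real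
  proof -
    have "AE t in M. 0 \<le> norm (E l) * \<gamma> t - \<sigma> * H l t"
    proof (rule sigma_finite_measure.density_nonneg[OF sf])
      show "integrable M (\<lambda>t. norm (E l) * \<gamma> t - \<sigma> * H l t)" using H[of l] \<gamma> by simp
      fix A assume A: "A \<in> sets M"
      have "integrable M (\<lambda>t. indicator A t * \<gamma> t)" "integrable M (\<lambda>t. indicator A t * H l t)"
        using integrable_mult_indicator[OF A \<gamma>(2)] integrable_mult_indicator[OF A, of "H l"] H[of l] by simp_all
      then have "(LINT t|M. norm (E l) * (indicator A t * \<gamma> t) - \<sigma> * (indicator A t * H l t))
          = norm (E l) * variation A - \<sigma> * \<phi> (weighted A (E l))"
        using H[of l] \<gamma>(3)[OF A] A by simp
      moreover have "\<sigma> * \<phi> (weighted A (E l)) \<le> \<bar>\<phi> (weighted A (E l))\<bar>"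
        using \<sigma> by (metis abs_ge_self abs_mult mult_1)
      ultimately have "0 \<le> (LINT t|M. norm (E l) * (indicator A t * \<gamma> t) - \<sigma> * (indicator A t * H l t))"
        using \<phi>_weighted_bound[OF A, of "E l"] by linarith
      then show "0 \<le> set_lebesgue_integral M A (\<lambda>t. norm (E l) * \<gamma> t - \<sigma> * H l t)"
        by (simp add: set_lebesgue_integral_def algebra_simps)
    qed
    then show ?thesis by eventually_elim simp
  qed
  have AE_\<gamma>: "AE t in M. 0 \<le> \<gamma> t"
    by (rule sigma_finite_measure.density_nonneg[OF sf, OF \<gamma>(2)]) (simp add: set_lebesgue_integral_def \<gamma>(3) variation_nonneg)
  \<comment> \<open>A measurable condition that holds almost everywhere and permits the extension;
    where it fails, \<xi> is set to 0.\<close>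
  define good where "good t \<longleftrightarrow> 0 \<le> \<gamma> t \<and> (\<forall>l. \<bar>H l t\<bar> \<le> norm (E l) * \<gamma> t)" for t
  have "AE t in M. \<forall>l. \<bar>H l t\<bar> \<le> norm (E l) * \<gamma> t"
    unfolding AE_all_countable
  proof
    fix l
    have "AE t in M. H l t \<le> norm (E l) * \<gamma> t" "AE t in M. - H l t \<le> norm (E l) * \<gamma> t"
      using AE_H[of 1 l] AE_H[of "-1" l] by simp_all
    then show "AE t in M. \<bar>H l t\<bar> \<le> norm (E l) * \<gamma> t"
      by eventually_elim (simp add: abs_le_iff)
  qed
  with AE_\<gamma> have AE_good: "AE t in M. good t" by eventually_elim (simp add: good_def)
  have [measurable]: "H l \<in> borel_measurable M" for l using H by simp
  have good_meas [measurable]: "Measurable.pred M good" unfolding good_def[abs_def] by measurable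
  have ex: "\<exists>\<zeta> :: 'z \<Rightarrow>\<^sub>L real. (\<forall>n. blinfun_apply \<zeta> (D n) = h n t / w t) \<and> norm \<zeta> \<le> \<gamma> t / w t" if good: "good t" for t
  proof -
    have bnd: "\<bar>\<Sum>(r, n)\<leftarrow>l. real_of_rat r * (h n t / w t)\<bar> \<le> \<gamma> t / w t * norm (\<Sum>(r, n)\<leftarrow>l. real_of_rat r *\<^sub>R D n)" for l
    proof -
      have "(\<Sum>(r, n)\<leftarrow>l. real_of_rat r * (h n t / w t)) = H l t / w t"
        unfolding H_def by (induction l) (auto simp: add_divide_distrib)
      then have "\<bar>\<Sum>(r, n)\<leftarrow>l. real_of_rat r * (h n t / w t)\<bar> = \<bar>H l t\<bar> / w t"
        using w_pos[of t] by (simp add: abs_divide)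
      also have "\<dots> \<le> norm (E l) * \<gamma> t / w t"
        using good w_pos[of t] by (intro divide_right_mono) (auto simp: good_def less_imp_le)
      finally show ?thesis by (simp add: E_def mult.commute)
    qed
    have nn: "0 \<le> \<gamma> t / w t" using good w_pos[of t] by (simp add: good_def)
    show ?thesis
      by (rule rational_functional_extension[of "\<gamma> t / w t" "\<lambda>n. h n t / w t" D, OF nn bnd]) blast
  qed
  then have "\<forall>t. \<exists>\<zeta> :: 'z \<Rightarrow>\<^sub>L real. good t \<longrightarrow>
      (\<forall>n. blinfun_apply \<zeta> (D n) = h n t / w t) \<and> norm \<zeta> \<le> \<gamma> t / w t" by blast
  from choice[OF this] obtain \<zeta> :: "'t \<Rightarrow> 'z \<Rightarrow>\<^sub>L real" where \<zeta>': "\<forall>t. good t \<longrightarrow>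
      (\<forall>n. blinfun_apply (\<zeta> t) (D n) = h n t / w t) \<and> norm (\<zeta> t) \<le> \<gamma> t / w t" by blast
  then have \<zeta>: "\<And>t n. good t \<Longrightarrow> blinfun_apply (\<zeta> t) (D n) = h n t / w t"
    "\<And>t. good t \<Longrightarrow> norm (\<zeta> t) \<le> \<gamma> t / w t" by blast+
  define \<xi> where "\<xi> t = (if good t then \<zeta> t else 0)" for t
  obtain E' :: "nat \<Rightarrow> 'z \<Rightarrow>\<^sub>L real" where E': "\<And>\<zeta> e. e > 0 \<Longrightarrow> \<exists>n. norm (\<zeta> - E' n) < e"
    using separable_dual_of_reflexive[OF refl] by blast
  \<comment> \<open>Norms in the dual can be tested on the dense sequence, where \<xi> is known
    explicitly. Preimages of closed balls under \<xi> thus become measurable.\<close>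
  have norm_le_iff: "norm \<eta> \<le> r \<longleftrightarrow> (\<forall>n. \<bar>\<eta> (D n)\<bar> \<le> r * norm (D n))" if r: "0 \<le> r" for \<eta> :: "'z \<Rightarrow>\<^sub>L real" and r
  proof
    assume "norm \<eta> \<le> r"
    then show "\<forall>n. \<bar>\<eta> (D n)\<bar> \<le> r * norm (D n)"
      using norm_blinfun[of \<eta>] mult_right_mono[OF _ norm_ge_zero] by (metis order_trans real_norm_def)
  next
    assume *: "\<forall>n. \<bar>\<eta> (D n)\<bar> \<le> r * norm (D n)"
    show "norm \<eta> \<le> r"
    proof (rule norm_blinfun_bound[OF r])
      fix z
      show "norm (\<eta> z) \<le> r * norm z"
      proof (rule field_le_epsilon)
        fix e :: real assume e: "e > 0"
        define m where "m = norm \<eta> + r + 1"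
        have m: "m > 0" using r norm_ge_zero[of \<eta>] unfolding m_def by linarith
        obtain n where n: "norm (z - D n) < e / m" using D[of "e / m" z] e m by auto
        have "norm (\<eta> z) \<le> norm (\<eta> (z - D n)) + norm (\<eta> (D n))"
          using norm_triangle_ineq[of "\<eta> (z - D n)" "\<eta> (D n)"] by (simp add: blinfun.diff_right)
        also have "\<dots> \<le> norm \<eta> * norm (z - D n) + r * norm (D n)"
          using * by (intro add_mono norm_blinfun) auto
        also have "norm (D n) \<le> norm z + norm (z - D n)"
          using norm_triangle_ineq2[of "D n" z] by (simp add: norm_minus_commute)
        finally have "norm (\<eta> z) \<le> norm \<eta> * norm (z - D n) + r * (norm z + norm (z - D n))"
          using r by (simp add: mult_left_mono)
        also have "\<dots> = r * norm z + (norm \<eta> + r) * norm (z - D n)" by (simp add: algebra_simps)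
        also have "\<dots> \<le> r * norm z + m * (e / m)"
          using n r by (intro add_left_mono mult_mono) (auto simp: m_def)
        finally show "norm (\<eta> z) \<le> r * norm z + e" using m by simp
      qed
    qed
  qed
  show thesis
  proof (rule that[of \<xi> \<gamma>])
    show "\<xi> \<in> borel_measurable M"
    proof (rule borel_measurable_of_cballs[OF E'])
      fix \<zeta>0 :: "'z \<Rightarrow>\<^sub>L real" and r :: real assume r: "r > 0"
      have "norm (\<xi> t - \<zeta>0) \<le> r \<longleftrightarrow> good t \<and> (\<forall>n. \<bar>h n t / w t - \<zeta>0 (D n)\<bar> \<le> r * norm (D n)) \<or>
          \<not> good t \<and> norm \<zeta>0 \<le> r" for t
        using norm_le_iff[of r "\<xi> t - \<zeta>0"] r \<zeta>(1)[of t] by (auto simp: \<xi>_def blinfun.diff_left)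
      then have "{t \<in> space M. norm (\<xi> t - \<zeta>0) \<le> r} = {t \<in> space M.
          good t \<and> (\<forall>n. \<bar>h n t / w t - \<zeta>0 (D n)\<bar> \<le> r * norm (D n)) \<or> \<not> good t \<and> norm \<zeta>0 \<le> r}"
        by simp
      also have "\<dots> \<in> sets M" by measurable
      finally show "{t \<in> space M. norm (\<xi> t - \<zeta>0) \<le> r} \<in> sets M" .
    qed
    show "integrable M \<gamma>" by (rule \<gamma>(2))
    show "AE t in M. norm (\<xi> t) * w t \<le> \<gamma> t"
      using AE_good
    proof eventually_elim
      case (elim t)
      then show ?case using \<zeta>(2)[OF elim] w_pos[of t] by (simp add: \<xi>_def pos_le_divide_eq)
    qed
    fix n A assume A: "A \<in> sets M"
    have [measurable]: "A \<in> sets M" by (rule A)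
    have "AE t in M. \<xi> t (weighted A (D n) t) = indicator A t * h n t"
      using AE_good
    proof eventually_elim
      case (elim t)
      then show ?case using \<zeta>(1)[OF elim, of n] w_pos[of t] by (simp add: \<xi>_def weighted_def blinfun.scaleR_right)
    qed
    moreover have "(\<lambda>t. \<xi> t (weighted A (D n) t)) \<in> borel_measurable M"
      by (intro measurable_pairing \<open>\<xi> \<in> borel_measurable M\<close> Lp_measurable[OF p weighted_Lp[OF A]])
    ultimately have "(LINT t|M. \<xi> t (weighted A (D n) t)) = (LINT t|M. indicator A t * h n t)"
      by (intro integral_cong_AE) auto
    then show "(LINT t|M. \<xi> t (weighted A (D n) t)) = \<phi> (weighted A (D n))" using h(3)[OF A, of n] by simp
  qed
qed

end

text \<open>With a factor \<open>\<theta> < 1\<close> a nearly norming direction exists among the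
  countably many \<open>sgn (D n)\<close>, and the first suitable one depends measurably on
  \<open>t\<close>.\<close>

lemma near_norming_selection:
  fixes \<xi> :: "'t \<Rightarrow> 'z::{real_normed_vector, second_countable_topology} \<Rightarrow>\<^sub>L real"
  assumes \<xi>: "\<xi> \<in> borel_measurable M" and \<theta>: "0 < \<theta>" "\<theta> < 1"
  obtains u where "u \<in> borel_measurable M" "\<And>t. norm (u t) \<le> 1" "\<And>t. \<theta> * norm (\<xi> t) \<le> \<xi> t (u t)"
proof -
  obtain D :: "nat \<Rightarrow> 'z" where D: "\<And>z e. e > 0 \<Longrightarrow> \<exists>n. norm (z - D n) < e"
    using countable_dense_real_normed by blast
  have [measurable]: "(\<lambda>t. \<xi> t z) \<in> borel_measurable M" for z
    by (rule measurable_pairing[OF \<xi>]) simp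
  have [measurable]: "\<xi> \<in> borel_measurable M" by (rule \<xi>)
  define P where "P n t \<longleftrightarrow> \<theta> * norm (\<xi> t) \<le> \<xi> t (sgn (D n))" for n t
  have P: "{t \<in> space M. P n t} \<in> sets M" for n unfolding P_def by measurable
  have ex: "\<exists>n. P n t" for t
  proof (rule ccontr)
    assume no: "\<not> (\<exists>n. P n t)"
    have less: "\<xi> t (D n) \<le> \<theta> * norm (\<xi> t) * norm (D n)" for n
    proof -
      have "\<xi> t (D n) = norm (D n) * \<xi> t (sgn (D n))"
        by (cases "D n = 0") (simp_all add: sgn_div_norm blinfun.scaleR_right)
      also have "\<dots> \<le> norm (D n) * (\<theta> * norm (\<xi> t))"
        using no by (intro mult_left_mono) (auto simp: P_def not_le less_imp_le)
      finally show ?thesis by (simp add: mult_ac)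
    qed
    \<comment> \<open>If every direction \<open>sgn (D n)\<close> fails, density gives
      \<open>norm (\<xi> t) \<le> \<theta> * norm (\<xi> t)\<close>. Then
      \<open>\<xi> t = 0\<close>, for which every direction is suitable.\<close>
    have "\<xi> t z \<le> \<theta> * norm (\<xi> t) * norm z" for z
    proof (rule field_le_epsilon)
      fix e :: real assume e: "e > 0"
      define m where "m = norm (\<xi> t) + \<theta> * norm (\<xi> t) + 1"
      have m: "m > 0" using \<theta> by (simp add: m_def add_nonneg_pos)
      obtain n where n: "norm (z - D n) < e / m" using D[of "e / m" z] e m by auto
      have "\<xi> t (z - D n) \<le> norm (\<xi> t) * norm (z - D n)"
        using norm_blinfun[of "\<xi> t" "z - D n"] by simp
      moreover have "\<theta> * norm (\<xi> t) * norm (D n) \<le> \<theta> * norm (\<xi> t) * (norm z + norm (z - D n))"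
        using norm_triangle_ineq2[of "D n" z] \<theta> by (intro mult_left_mono) (auto simp: norm_minus_commute)
      ultimately have "\<xi> t z \<le> \<theta> * norm (\<xi> t) * norm z + (m - 1) * norm (z - D n)"
        using less[of n] by (simp add: m_def blinfun.diff_right algebra_simps)
      also have "(m - 1) * norm (z - D n) \<le> m * norm (z - D n)" by (intro mult_right_mono) auto
      also have "m * norm (z - D n) \<le> e" using n m by (simp add: pos_less_divide_eq mult.commute)
      finally show "\<xi> t z \<le> \<theta> * norm (\<xi> t) * norm z + e" by simp
    qed
    then have "norm (\<xi> t) \<le> \<theta> * norm (\<xi> t)" using \<theta> by (intro norm_blinfun_le_of_le) auto
    then have "\<xi> t = 0" using \<theta> by (metis mult_less_cancel_right2 norm_eq_zero norm_ge_zero not_le order_le_less)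
    then have "P 0 t" by (simp add: P_def)
    with no show False by blast
  qed
  show thesis
  proof (rule that[of "\<lambda>t. sgn (D (LEAST n. P n t))"])
    show "(\<lambda>t. sgn (D (LEAST n. P n t))) \<in> borel_measurable M"
      by (rule measurable_first_index[OF P, where D = "\<lambda>n _. sgn (D n)"]) simp
    show "norm (sgn (D (LEAST n. P n t))) \<le> 1" for t by (simp add: norm_sgn)
    show "\<theta> * norm (\<xi> t) \<le> \<xi> t (sgn (D (LEAST n. P n t)))" for t
      using LeastI_ex[OF ex[of t]] unfolding P_def .
  qed
qed

lemma integral_pairing_le:
  fixes \<xi> :: "'t \<Rightarrow> 'z::{real_normed_vector, second_countable_topology} \<Rightarrow>\<^sub>L real"
  assumes \<xi>: "\<xi> \<in> borel_measurable M" and f: "f \<in> borel_measurable M"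
    and int: "integrable M (\<lambda>t. norm (\<xi> t) * norm (f t))"
  shows "integrable M (\<lambda>t. \<xi> t (f t))" "\<bar>LINT t|M. \<xi> t (f t)\<bar> \<le> (LINT t|M. norm (\<xi> t) * norm (f t))"
proof -
  have le: "norm (\<xi> t (f t)) \<le> norm (\<xi> t) * norm (f t)" for t by (rule norm_blinfun)
  show i: "integrable M (\<lambda>t. \<xi> t (f t))"
    by (rule Bochner_Integration.integrable_bound[OF int measurable_pairing[OF \<xi> f]])
      (use le in \<open>simp add: order_trans[OF _ abs_ge_self]\<close>)
  have "\<bar>LINT t|M. \<xi> t (f t)\<bar> \<le> (LINT t|M. \<bar>\<xi> t (f t)\<bar>)" using integral_abs_bound by simp
  also have "\<dots> \<le> (LINT t|M. norm (\<xi> t) * norm (f t))"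
    using i le by (intro integral_mono int) auto
  finally show "\<bar>LINT t|M. \<xi> t (f t)\<bar> \<le> (LINT t|M. norm (\<xi> t) * norm (f t))" .
qed

section \<open>Representation of the functional by its density\<close>

locale Lp_functional_density = Lp_functional M p \<phi> K w
  for M :: "'t measure" and p :: real
    and \<phi> :: "('t \<Rightarrow> 'z::{real_normed_vector, second_countable_topology}) \<Rightarrow> real"
    and K :: real and w :: "'t \<Rightarrow> real" +
  fixes \<xi> :: "'t \<Rightarrow> 'z \<Rightarrow>\<^sub>L real" and \<gamma> :: "'t \<Rightarrow> real" and D :: "nat \<Rightarrow> 'z"
  assumes D: "\<And>z e. e > 0 \<Longrightarrow> \<exists>n. norm (z - D n) < e"
    and \<xi>_meas: "\<xi> \<in> borel_measurable M" and \<gamma>_int: "integrable M \<gamma>"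
    and \<xi>_\<gamma>: "AE t in M. norm (\<xi> t) * w t \<le> \<gamma> t"
    and \<xi>_\<phi>: "\<And>n A. A \<in> sets M \<Longrightarrow> (LINT t|M. \<xi> t (weighted A (D n) t)) = \<phi> (weighted A (D n))"
begin

lemma \<xi>_dominated:
  assumes [measurable]: "f \<in> borel_measurable M" and c: "0 \<le> c" and f: "\<And>t. norm (f t) \<le> c * w t"
  shows "integrable M (\<lambda>t. norm (\<xi> t) * norm (f t))" "(LINT t|M. norm (\<xi> t) * norm (f t)) \<le> c * integral\<^sup>L M \<gamma>"
proof -
  have [measurable]: "\<xi> \<in> borel_measurable M" by (rule \<xi>_meas)
  have le: "AE t in M. norm (\<xi> t) * norm (f t) \<le> c * \<gamma> t"
    using \<xi>_\<gamma>
  proof eventually_elim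
    case (elim t)
    have "norm (\<xi> t) * norm (f t) \<le> norm (\<xi> t) * (c * w t)" by (intro mult_left_mono f) auto
    also have "\<dots> = c * (norm (\<xi> t) * w t)" by simp
    also have "\<dots> \<le> c * \<gamma> t" using elim c by (rule mult_left_mono)
    finally show ?case .
  qed
  show i: "integrable M (\<lambda>t. norm (\<xi> t) * norm (f t))"
  proof (rule Bochner_Integration.integrable_bound)
    show "integrable M (\<lambda>t. c * \<gamma> t)" using \<gamma>_int by simp
    show "AE t in M. norm (norm (\<xi> t) * norm (f t)) \<le> norm (c * \<gamma> t)"
      using le by eventually_elim (simp add: order_trans[OF _ abs_ge_self])
  qed simp
  have "(LINT t|M. norm (\<xi> t) * norm (f t)) \<le> (LINT t|M. c * \<gamma> t)"
    using \<gamma>_int le by (intro integral_mono_AE i) auto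
  then show "(LINT t|M. norm (\<xi> t) * norm (f t)) \<le> c * integral\<^sup>L M \<gamma>" by simp
qed

text \<open>\<open>f\<close> is approximated by \<open>w t *\<^sub>R D (\<nu> t)\<close> with
  pointwise error below \<open>e * w t\<close>, and truncated to \<open>\<nu> t < N\<close>, where
  the formula holds by linearity. The remainder is small on both sides: for \<phi> by its norm
  bound, for the integral by \<gamma> and by integrability of
  \<open>norm (\<xi> t) * norm (f t)\<close>. That integrability is a hypothesis because the formula
  itself serves to prove that \<xi> belongs to L^q.\<close>

lemma representation:
  assumes f: "f \<in> Lp_space M p" and int: "integrable M (\<lambda>t. norm (\<xi> t) * norm (f t))"
  shows "\<phi> f = (LINT t|M. \<xi> t (f t))"
proof -
  have [measurable]: "\<xi> \<in> borel_measurable M" "f \<in> borel_measurable M"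
    using \<xi>_meas Lp_measurable[OF p f] by auto
  \<comment> \<open>The error \<open>e * w\<close> changes \<phi> by at most
    \<open>e * (K * Lp_norm M p w)\<close> and the integral by at most \<open>e\<close> times the
    integral of \<gamma>.\<close>
  define c where "c = K * Lp_norm M p w + integral\<^sup>L M \<gamma>"
  have bound: "\<bar>\<phi> f - (LINT t|M. \<xi> t (f t))\<bar> \<le> c * e" if e: "e > 0" for e
  proof -
    define P where "P n t \<longleftrightarrow> norm (f t - w t *\<^sub>R D n) < e * w t" for n t
    have [measurable]: "Measurable.pred M (P n)" for n unfolding P_def[abs_def] by measurable
    define \<nu> where "\<nu> t = (LEAST n. P n t)" for t
    have [measurable]: "\<nu> \<in> measurable M (count_space UNIV)" unfolding \<nu>_def[abs_def] by measurable
    have ex: "\<exists>n. P n t" for t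
    proof -
      obtain n where n: "norm ((1 / w t) *\<^sub>R f t - D n) < e" using D[OF e] by blast
      have "f t - w t *\<^sub>R D n = w t *\<^sub>R ((1 / w t) *\<^sub>R f t - D n)"
        using w_pos[of t] by (simp add: scaleR_diff_right)
      then have "norm (f t - w t *\<^sub>R D n) = w t * norm ((1 / w t) *\<^sub>R f t - D n)"
        using w_pos[of t] by (simp only: norm_scaleR abs_of_pos)
      also have "\<dots> < w t * e" using n w_pos[of t] by simp
      finally show ?thesis by (auto simp: P_def mult.commute)
    qed
    have \<nu>: "norm (f t - w t *\<^sub>R D (\<nu> t)) < e * w t" for t
      using LeastI_ex[OF ex[of t]] unfolding \<nu>_def P_def .
    define A where "A i = {t \<in> space M. \<nu> t = i}" for i
    define C where "C N = {t \<in> space M. N \<le> \<nu> t}" for N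
    have A [measurable]: "A i \<in> sets M" for i unfolding A_def by measurable
    have C [measurable]: "C N \<in> sets M" for N unfolding C_def by measurable
    define F where "F N t = (\<Sum>i<N. weighted (A i) (D i) t)" for N t
    have wL: "weighted (A i) (D i) \<in> Lp_space M p" for i by (rule weighted_Lp[OF A])
    have wI: "integrable M (\<lambda>t. norm (\<xi> t) * norm (weighted (A i) (D i) t))" for i
      by (rule \<xi>_dominated(1)[OF Lp_measurable[OF p wL], of "norm (D i)"])
        (use w_pos in \<open>auto simp: weighted_def indicator_def mult.commute less_imp_le\<close>)
    have F: "F N \<in> Lp_space M p \<and> integrable M (\<lambda>t. \<xi> t (F N t)) \<and> \<phi> (F N) = (LINT t|M. \<xi> t (F N t))" for N
    proof (induction N)
      case 0
      then show ?case using Lp_zero[OF p] \<phi>_zero by (simp add: F_def[abs_def])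
    next
      case (Suc N)
      have eq: "F (Suc N) = (\<lambda>t. F N t + weighted (A N) (D N) t)" by (simp add: F_def[abs_def])
      have wi: "integrable M (\<lambda>t. \<xi> t (weighted (A N) (D N) t))"
        by (rule integral_pairing_le(1)[OF \<xi>_meas Lp_measurable[OF p wL] wI])
      show ?case
        unfolding eq using Suc wi Lp_add[OF p _ wL] \<phi>_add[OF _ wL] \<xi>_\<phi>[OF A]
        by (simp add: blinfun.add_right)
    qed
    have FL [measurable]: "F N \<in> borel_measurable M" for N using F Lp_measurable[OF p] by blast
    have F_eq: "F N t = (if \<nu> t < N then w t *\<^sub>R D (\<nu> t) else 0)" if t: "t \<in> space M" for N t
    proof -
      have "F N t = (\<Sum>i<N. if i = \<nu> t then w t *\<^sub>R D i else 0)"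
        unfolding F_def using t by (intro sum.cong) (auto simp: weighted_def A_def indicator_def)
      then show ?thesis by (simp add: sum.delta)
    qed
    define \<rho> where "\<rho> N t = f t - F N t" for N t
    have \<rho>L: "\<rho> N \<in> Lp_space M p" for N unfolding \<rho>_def[abs_def] using Lp_diff[OF p f] F by blast
    have [measurable]: "\<rho> N \<in> borel_measurable M" for N by (rule Lp_measurable[OF p \<rho>L])
    have \<rho>_le: "norm (\<rho> N t) \<le> norm (indicator (C N) t *\<^sub>R f t) + e * w t" if t: "t \<in> space M" for N t
      using \<nu>[of t] w_pos[of t] e t by (cases "\<nu> t < N") (auto simp: \<rho>_def F_eq C_def)
    \<comment> \<open>As an element of L^1 this function falls under
      \<open>Lp_norm_tendsto_zero\<close>, which then covers the remainder of the integral as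
      well.\<close>
    define g where "g t = norm (\<xi> t) * norm (f t)" for t
    have g: "g \<in> Lp_space M (ereal 1)" using int by (simp add: Lp_iff g_def[abs_def])
    have main: "\<bar>\<phi> f - (LINT t|M. \<xi> t (f t))\<bar>
        \<le> K * Lp_norm M p (\<lambda>t. indicator (C N) t *\<^sub>R f t) + Lp_norm M 1 (\<lambda>t. indicator (C N) t *\<^sub>R g t) + c * e" for N
    proof -
      have fN: "f = (\<lambda>t. \<rho> N t + F N t)" by (simp add: \<rho>_def)
      have 1: "\<phi> f = \<phi> (\<rho> N) + \<phi> (F N)" using \<phi>_add[OF \<rho>L, of "F N" N] F by (subst fN) blast
      have fi: "integrable M (\<lambda>t. \<xi> t (f t))" by (rule integral_pairing_le(1)[OF \<xi>_meas _ int]) measurable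
      have 2: "(LINT t|M. \<xi> t (f t)) = (LINT t|M. \<xi> t (\<rho> N t)) + (LINT t|M. \<xi> t (F N t))"
      proof -
        have "integrable M (\<lambda>t. \<xi> t (\<rho> N t))"
          unfolding \<rho>_def blinfun.diff_right using fi F by (intro Bochner_Integration.integrable_diff) auto
        then show ?thesis
          using F[of N] by (subst fN) (simp add: blinfun.add_right)
      qed
      have iC: "integrable M (\<lambda>t. indicator (C N) t *\<^sub>R g t)"
        by (rule integrable_mult_indicator[OF C]) (use int in \<open>simp add: g_def[abs_def]\<close>)
      have ew: "integrable M (\<lambda>t. norm (\<xi> t) * norm (e * w t))"
        "(LINT t|M. norm (\<xi> t) * norm (e * w t)) \<le> e * integral\<^sup>L M \<gamma>"
      proof -
        have le: "AE t in M. norm (\<xi> t) * norm (e * w t) \<le> e * \<gamma> t"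
          using \<xi>_\<gamma>
        proof eventually_elim
          case (elim t)
          then show ?case using e w_pos[of t] mult_left_mono[OF elim, of e] by (simp add: abs_mult mult_ac)
        qed
        show i: "integrable M (\<lambda>t. norm (\<xi> t) * norm (e * w t))"
        proof (rule Bochner_Integration.integrable_bound)
          show "integrable M (\<lambda>t. e * \<gamma> t)" using \<gamma>_int by simp
          show "AE t in M. norm (norm (\<xi> t) * norm (e * w t)) \<le> norm (e * \<gamma> t)"
            using le by eventually_elim (simp add: order_trans[OF _ abs_ge_self])
        qed simp
        have "(LINT t|M. norm (\<xi> t) * norm (e * w t)) \<le> (LINT t|M. e * \<gamma> t)"
          using \<gamma>_int le by (intro integral_mono_AE i) auto
        then show "(LINT t|M. norm (\<xi> t) * norm (e * w t)) \<le> e * integral\<^sup>L M \<gamma>" by simp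
      qed
      have le: "norm (\<xi> t) * norm (\<rho> N t) \<le> indicator (C N) t *\<^sub>R g t + norm (\<xi> t) * norm (e * w t)"
        if t: "t \<in> space M" for t
      proof -
        have "norm (\<xi> t) * norm (\<rho> N t) \<le> norm (\<xi> t) * (norm (indicator (C N) t *\<^sub>R f t) + e * w t)"
          by (intro mult_left_mono \<rho>_le[OF t]) auto
        also have "\<dots> = indicator (C N) t *\<^sub>R g t + norm (\<xi> t) * norm (e * w t)"
          using e w_pos[of t] by (simp add: g_def distrib_left)
        finally show ?thesis .
      qed
      have i\<rho>: "integrable M (\<lambda>t. norm (\<xi> t) * norm (\<rho> N t))"
      proof (rule Bochner_Integration.integrable_bound)
        show "integrable M (\<lambda>t. indicator (C N) t *\<^sub>R g t + norm (\<xi> t) * norm (e * w t))"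
          by (intro Bochner_Integration.integrable_add iC ew)
        show "AE t in M. norm (norm (\<xi> t) * norm (\<rho> N t))
            \<le> norm (indicator (C N) t *\<^sub>R g t + norm (\<xi> t) * norm (e * w t))"
          using le by (intro AE_I2) (simp add: order_trans[OF _ abs_ge_self])
      qed simp
      have "\<bar>LINT t|M. \<xi> t (\<rho> N t)\<bar> \<le> (LINT t|M. norm (\<xi> t) * norm (\<rho> N t))"
        by (rule integral_pairing_le(2)[OF \<xi>_meas _ i\<rho>]) measurable
      also have "\<dots> \<le> (LINT t|M. indicator (C N) t *\<^sub>R g t + norm (\<xi> t) * norm (e * w t))"
        by (intro integral_mono i\<rho> Bochner_Integration.integrable_add iC ew le)
      also have "\<dots> \<le> (LINT t|M. indicator (C N) t *\<^sub>R g t) + e * integral\<^sup>L M \<gamma>"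
        using iC ew by simp
      also have "(LINT t|M. indicator (C N) t *\<^sub>R g t) = Lp_norm M 1 (\<lambda>t. indicator (C N) t *\<^sub>R g t)"
      proof -
        have "0 \<le> indicator (C N) t *\<^sub>R g t" for t by (simp add: g_def)
        then show ?thesis
          by (simp add: Lp_norm_def abs_mult g_def integral_nonneg_AE)
      qed
      finally have 3: "\<bar>LINT t|M. \<xi> t (\<rho> N t)\<bar>
          \<le> Lp_norm M 1 (\<lambda>t. indicator (C N) t *\<^sub>R g t) + e * integral\<^sup>L M \<gamma>" .
      have fC: "(\<lambda>t. indicator (C N) t *\<^sub>R f t) \<in> Lp_space M p" by (rule Lp_indicator(1)[OF p f C])
      have nf: "(\<lambda>t. norm (indicator (C N) t *\<^sub>R f t)) \<in> Lp_space M p"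
        by (rule Lp_dominated(1)[OF p fC]) simp_all
      have nf': "Lp_norm M p (\<lambda>t. norm (indicator (C N) t *\<^sub>R f t)) = Lp_norm M p (\<lambda>t. indicator (C N) t *\<^sub>R f t)"
        by (rule Lp_cong_norm[OF p fC]) simp_all
      have "Lp_norm M p (\<rho> N) \<le> Lp_norm M p (\<lambda>t. norm (indicator (C N) t *\<^sub>R f t) + e *\<^sub>R w t)"
      proof (rule Lp_dominated(2)[OF p Lp_add[OF p nf Lp_scale(1)[OF p w]]])
        show "AE t in M. norm (\<rho> N t) \<le> norm (norm (indicator (C N) t *\<^sub>R f t) + e *\<^sub>R w t)"
          using \<rho>_le by (intro AE_I2) (simp add: order_trans[OF _ abs_ge_self])
      qed measurable
      also have "\<dots> \<le> Lp_norm M p (\<lambda>t. indicator (C N) t *\<^sub>R f t) + e * Lp_norm M p w"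
        using Lp_triangle[OF p nf Lp_scale(1)[OF p w, of e]] Lp_scale(2)[OF p w, of e] nf' e by simp
      finally have "K * Lp_norm M p (\<rho> N) \<le> K * (Lp_norm M p (\<lambda>t. indicator (C N) t *\<^sub>R f t) + e * Lp_norm M p w)"
        using K by (rule mult_left_mono)
      then have 4: "\<bar>\<phi> (\<rho> N)\<bar> \<le> K * Lp_norm M p (\<lambda>t. indicator (C N) t *\<^sub>R f t) + e * (K * Lp_norm M p w)"
        using \<phi>_bound[OF \<rho>L, of N] by (simp add: algebra_simps)
      have "c * e = e * (K * Lp_norm M p w) + e * integral\<^sup>L M \<gamma>" by (simp add: c_def algebra_simps)
      then show ?thesis using 1 2 3 4 F[of N] by linarith
    qed
    have ev: "\<forall>\<^sub>F N in sequentially. t \<notin> C N" for t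
      using eventually_gt_at_top[of "\<nu> t"] by eventually_elim (simp add: C_def)
    have "(\<lambda>N. K * Lp_norm M p (\<lambda>t. indicator (C N) t *\<^sub>R f t) + Lp_norm M 1 (\<lambda>t. indicator (C N) t *\<^sub>R g t) + c * e)
        \<longlonglongrightarrow> K * 0 + 0 + c * e"
      unfolding one_ereal_def
      by (intro tendsto_add tendsto_mult tendsto_const Lp_norm_tendsto_zero[OF p f C]
          Lp_norm_tendsto_zero[OF _ g C] AE_I2 ev order_refl)
    then have "\<bar>\<phi> f - (LINT t|M. \<xi> t (f t))\<bar> \<le> K * 0 + 0 + c * e"
      by (rule LIMSEQ_le_const) (intro exI allI impI main)
    then show ?thesis by simp
  qed
  have "\<bar>\<phi> f - (LINT t|M. \<xi> t (f t))\<bar> \<le> 0 + e" if e: "e > 0" for e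
  proof -
    have c: "\<bar>c\<bar> + 1 > 0" by linarith
    have "\<bar>\<phi> f - (LINT t|M. \<xi> t (f t))\<bar> \<le> c * (e / (\<bar>c\<bar> + 1))" using e c by (intro bound) simp
    also have "\<dots> \<le> (\<bar>c\<bar> + 1) * (e / (\<bar>c\<bar> + 1))" using e c by (intro mult_right_mono) auto
    also have "\<dots> = e" using c by simp
    finally show ?thesis by simp
  qed
  then have "\<bar>\<phi> f - (LINT t|M. \<xi> t (f t))\<bar> \<le> 0" by (rule field_le_epsilon)
  then show ?thesis by simp
qed

text \<open>Testing \<phi> on \<open>a t *\<^sub>R u t\<close> with a nearly norming
  \<open>u\<close> gives the estimate up to the factor \<theta>, which then tends to 1. The bound of
  \<open>a\<close> by a multiple of \<open>w\<close> makes the representation formula applicable to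
  the test function.\<close>

lemma near_norming_bound:
  assumes a: "a \<in> borel_measurable M" "\<And>t. 0 \<le> a t" "\<And>t. a t \<le> c * w t" and c: "0 \<le> c"
  shows "integrable M (\<lambda>t. norm (\<xi> t) * a t)" "a \<in> Lp_space M p"
    "(LINT t|M. norm (\<xi> t) * a t) \<le> K * Lp_norm M p a"
proof -
  have [measurable]: "\<xi> \<in> borel_measurable M" "a \<in> borel_measurable M" using \<xi>_meas a by auto
  show aL: "a \<in> Lp_space M p"
    by (rule Lp_dominated(1)[OF p Lp_scale(1)[OF p w, of c] a(1)])
      (use a in \<open>auto intro!: AE_I2 simp: order_trans[OF _ abs_ge_self]\<close>)
  have test: "integrable M (\<lambda>t. norm (\<xi> t) * a t) \<and> \<theta> * (LINT t|M. norm (\<xi> t) * a t) \<le> K * Lp_norm M p a"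
    if \<theta>: "0 < \<theta>" "\<theta> < 1" for \<theta>
  proof -
    obtain u where u: "u \<in> borel_measurable M" "\<And>t. norm (u t) \<le> 1" "\<And>t. \<theta> * norm (\<xi> t) \<le> \<xi> t (u t)"
      using near_norming_selection[OF \<xi>_meas \<theta>] by blast
    have [measurable]: "u \<in> borel_measurable M" by (rule u)
    define f where "f t = a t *\<^sub>R u t" for t
    have [measurable]: "f \<in> borel_measurable M" unfolding f_def[abs_def] by measurable
    have fa: "norm (f t) \<le> a t" for t
      using u(2)[of t] a(2)[of t] by (simp add: f_def mult_left_le)
    note dom = Lp_dominated[OF p aL, of f]
    have fL: "f \<in> Lp_space M p" by (rule dom) (use fa a(2) in auto)
    have fle: "Lp_norm M p f \<le> Lp_norm M p a" by (rule dom) (use fa a(2) in auto)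
    have fi: "integrable M (\<lambda>t. norm (\<xi> t) * norm (f t))"
      by (rule \<xi>_dominated(1)[OF _ c]) (use order_trans[OF fa a(3)] in auto)
    have \<xi>f: "integrable M (\<lambda>t. \<xi> t (f t))" by (rule integral_pairing_le(1)[OF \<xi>_meas _ fi]) measurable
    have le: "\<theta> * (norm (\<xi> t) * a t) \<le> \<xi> t (f t)" for t
      using mult_right_mono[OF u(3)[of t] a(2)[of t]] by (simp add: f_def blinfun.scaleR_right mult_ac)
    have "integrable M (\<lambda>t. \<theta> * (norm (\<xi> t) * a t))"
    proof (rule Bochner_Integration.integrable_bound[OF \<xi>f])
      show "AE t in M. norm (\<theta> * (norm (\<xi> t) * a t)) \<le> norm (\<xi> t (f t))"
        using le \<theta> a(2) by (intro AE_I2) (simp add: order_trans[OF _ abs_ge_self])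
    qed simp
    moreover from this have "(LINT t|M. \<theta> * (norm (\<xi> t) * a t)) \<le> (LINT t|M. \<xi> t (f t))"
      using le by (intro integral_mono \<xi>f) auto
    moreover have "(LINT t|M. \<xi> t (f t)) \<le> K * Lp_norm M p a"
      using representation[OF fL fi] \<phi>_bound[OF fL] mult_left_mono[OF fle K] by linarith
    ultimately show ?thesis using \<theta> by simp
  qed
  show "integrable M (\<lambda>t. norm (\<xi> t) * a t)" using test[of "1/2"] by simp
  define I where "I = (LINT t|M. norm (\<xi> t) * a t)"
  \<comment> \<open>The double shift keeps the factor strictly between 0 and 1 also for
    \<open>n = 0\<close>.\<close>
  have "(\<lambda>n. (1 - 1 / real (Suc (Suc n))) * I) \<longlonglongrightarrow> (1 - 0) * I"
    by (intro tendsto_intros LIMSEQ_Suc[OF LIMSEQ_Suc[OF lim_1_over_n]])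
  then have "(1 - 0) * I \<le> K * Lp_norm M p a"
  proof (rule LIMSEQ_le_const2)
    show "\<exists>N. \<forall>n\<ge>N. (1 - 1 / real (Suc (Suc n))) * I \<le> K * Lp_norm M p a"
    proof (intro exI allI impI)
      fix n :: nat
      show "(1 - 1 / real (Suc (Suc n))) * I \<le> K * Lp_norm M p a"
        unfolding I_def using test[of "1 - 1 / real (Suc (Suc n))"] by simp
    qed
  qed
  then show "(LINT t|M. norm (\<xi> t) * a t) \<le> K * Lp_norm M p a" by (simp add: I_def)
qed

end

section \<open>The density belongs to L^q\<close>

context Lp_functional_density
begin

text \<open>The test function \<open>a\<close> equals \<open>w\<close> where
  \<open>norm (\<xi> t) > K + e\<close> and 0 elsewhere. Comparing \<open>(K + e)\<close> times its
  integral with \<open>K\<close> times its integral shows that the integral vanishes, and positivity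
  of \<open>w\<close> makes the set null.\<close>

lemma density_Lq_infinity:
  assumes p1: "p = 1"
  shows "AE t in M. norm (\<xi> t) \<le> K"
proof -
  have [measurable]: "\<xi> \<in> borel_measurable M" by (rule \<xi>_meas)
  have "AE t in M. norm (\<xi> t) \<le> K + 1 / real (Suc j)" for j
  proof -
    define e where "e = 1 / real (Suc j)"
    have e: "e > 0" by (simp add: e_def)
    define B where "B = {t \<in> space M. K + e < norm (\<xi> t)}"
    have B [measurable]: "B \<in> sets M" unfolding B_def by measurable
    define a where "a t = indicator B t * w t" for t
    have am: "a \<in> borel_measurable M" unfolding a_def[abs_def] by measurable
    have a: "0 \<le> a t" "a t \<le> 1 * w t" for t using w_pos[of t] by (auto simp: a_def indicator_def)
    note nb = near_norming_bound[OF am a]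
    have aint: "integrable M a" using nb(2) a p1 by (simp add: Lp_space_def)
    have "Lp_norm M p a = integral\<^sup>L M a"
      using a p1 by (simp add: Lp_norm_def integral_nonneg_AE)
    then have "(LINT t|M. norm (\<xi> t) * a t) \<le> K * integral\<^sup>L M a" using nb(3) by simp
    moreover have "(LINT t|M. (K + e) * a t) \<le> (LINT t|M. norm (\<xi> t) * a t)"
    proof (rule integral_mono[OF _ nb(1)])
      show "integrable M (\<lambda>t. (K + e) * a t)" using aint by simp
      show "(K + e) * a t \<le> norm (\<xi> t) * a t" for t
        using a(1)[of t] by (cases "t \<in> B") (auto simp: a_def B_def intro!: mult_right_mono)
    qed simp
    ultimately have "e * integral\<^sup>L M a \<le> 0" using aint by (simp add: algebra_simps)
    then have "integral\<^sup>L M a \<le> 0" using e by (simp add: mult_le_0_iff)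
    then have "integral\<^sup>L M a = 0" using a by (intro antisym integral_nonneg_AE) auto
    then have "AE t in M. a t = 0" using integral_nonneg_eq_0_iff_AE[OF aint] a by simp
    then show ?thesis
      using AE_space
    proof eventually_elim
      case (elim t)
      then show ?case using w_pos[of t] by (auto simp: a_def B_def indicator_def e_def split: if_splits)
    qed
  qed
  then have "AE t in M. \<forall>j. norm (\<xi> t) \<le> K + 1 / real (Suc j)" by (simp add: AE_all_countable)
  then show ?thesis
  proof eventually_elim
    case (elim t)
    show ?case
    proof (rule field_le_epsilon)
      fix e :: real assume "e > 0"
      then obtain j where "1 / real (Suc j) < e" using nat_approx_posE by blast
      then show "norm (\<xi> t) \<le> K + e" using elim[rule_format, of j] by linarith
    qed
  qed
qed

text \<open>The test function is the extremal one in Hoelder's inequality,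
  \<open>norm (\<xi> t) powr (r - 1)\<close>: its power with exponent \<open>p\<close> is
  \<open>norm (\<xi> t) powr r\<close>, so the bound reads \<open>I \<le> K * I powr (1 / p)\<close>
  and gives \<open>I powr (1 / r) \<le> K\<close>. Restriction to \<open>B m\<close> bounds the test
  function by a multiple of \<open>w\<close> and makes the integral \<open>I\<close> finite; Fatou's
  lemma removes the restriction.\<close>

lemma density_Lq:
  assumes r: "1 < r" "1 / p + 1 / r = 1"
  shows "integrable M (\<lambda>t. norm (\<xi> t) powr r)" "(LINT t|M. norm (\<xi> t) powr r) \<le> K powr r"
proof -
  have [measurable]: "\<xi> \<in> borel_measurable M" by (rule \<xi>_meas)
  have p0: "p > 0" using p by simp
  have rp: "(r - 1) * p = r" using r p0 by (simp add: field_simps)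
  define B where "B m = {t \<in> space M. norm (\<xi> t) powr (r - 1) \<le> real m * w t}" for m :: nat
  have B [measurable]: "B m \<in> sets M" for m unfolding B_def by measurable
  have part: "integrable M (\<lambda>t. indicator (B m) t * norm (\<xi> t) powr r)"
    "(LINT t|M. indicator (B m) t * norm (\<xi> t) powr r) \<le> K powr r" for m
  proof -
    define a where "a t = indicator (B m) t * norm (\<xi> t) powr (r - 1)" for t
    have am: "a \<in> borel_measurable M" unfolding a_def[abs_def] by measurable
    have a: "0 \<le> a t" "a t \<le> real m * w t" for t using w_pos[of t] by (auto simp: a_def B_def indicator_def)
    note nb = near_norming_bound[OF am a]
    have eq: "norm (\<xi> t) * a t = indicator (B m) t * norm (\<xi> t) powr r" for t
      using powr_mult_base[of "norm (\<xi> t)" "r - 1"] by (simp add: a_def)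
    show int: "integrable M (\<lambda>t. indicator (B m) t * norm (\<xi> t) powr r)" using nb(1) by (simp add: eq)
    define I where "I = (LINT t|M. indicator (B m) t * norm (\<xi> t) powr r)"
    have I: "0 \<le> I" unfolding I_def by (intro integral_nonneg_AE) auto
    have "norm (a t) powr p = indicator (B m) t * norm (\<xi> t) powr r" for t
      by (simp add: a_def indicator_def powr_powr rp)
    then have "Lp_norm M p a = I powr (1 / p)" by (simp add: Lp_norm_def I_def)
    then have le: "I \<le> K * I powr (1 / p)" using nb(3) by (simp add: eq I_def)
    have "I \<le> K powr r"
    proof (cases "I = 0")
      case False
      then have I0: "I > 0" using I by simp
      have "I powr (1 / p) * I powr (1 / r) = I" using I0 r by (simp add: powr_add[symmetric])
      then have "I powr (1 / p) * I powr (1 / r) \<le> I powr (1 / p) * K" using le by (simp add: mult.commute)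
      then have "I powr (1 / r) \<le> K" using I0 by simp
      then have "(I powr (1 / r)) powr r \<le> K powr r" using r by (intro powr_mono2) auto
      then show ?thesis using I0 r by (simp add: powr_powr)
    qed simp
    then show "(LINT t|M. indicator (B m) t * norm (\<xi> t) powr r) \<le> K powr r" by (simp add: I_def)
  qed
  define U where "U m t = ennreal (indicator (B m) t * norm (\<xi> t) powr r)" for m t
  have U: "U m \<in> borel_measurable M" for m unfolding U_def[abs_def] by measurable
  have lim: "liminf (\<lambda>m. U m t) = ennreal (norm (\<xi> t) powr r)" if t: "t \<in> space M" for t
  proof -
    have "\<forall>\<^sub>F m in sequentially. U m t = ennreal (norm (\<xi> t) powr r)"
      using eventually_gt_at_top[of "nat \<lceil>norm (\<xi> t) powr (r - 1) / w t\<rceil>"]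
    proof eventually_elim
      case (elim m)
      then have "norm (\<xi> t) powr (r - 1) / w t \<le> real m" by linarith
      then have "t \<in> B m" using w_pos[of t] t by (simp add: B_def pos_divide_le_eq)
      then show ?case by (simp add: U_def)
    qed
    then show ?thesis by (intro lim_imp_Liminf tendsto_eventually) auto
  qed
  have Um: "integral\<^sup>N M (U m) \<le> ennreal (K powr r)" for m
    unfolding U_def by (subst nn_integral_eq_integral) (use part in \<open>auto intro: ennreal_leI\<close>)
  have "(\<integral>\<^sup>+t. ennreal (norm (\<xi> t) powr r) \<partial>M) = (\<integral>\<^sup>+t. liminf (\<lambda>m. U m t) \<partial>M)"
    by (intro nn_integral_cong) (simp add: lim)
  also have "\<dots> \<le> liminf (\<lambda>m. integral\<^sup>N M (U m))" by (rule nn_integral_liminf[OF U])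
  also have "\<dots> \<le> ennreal (K powr r)"
    using Liminf_mono[of "\<lambda>m. integral\<^sup>N M (U m)" "\<lambda>_. ennreal (K powr r)" sequentially] Um
    by (simp add: Liminf_const)
  finally have fin: "(\<integral>\<^sup>+t. ennreal (norm (\<xi> t) powr r) \<partial>M) \<le> ennreal (K powr r)" .
  show int: "integrable M (\<lambda>t. norm (\<xi> t) powr r)"
    by (rule integrableI_bounded) (use fin in \<open>auto simp: le_less_trans[OF _ ennreal_less_top]\<close>)
  have "ennreal (LINT t|M. norm (\<xi> t) powr r) \<le> ennreal (K powr r)"
    using fin by (subst (asm) nn_integral_eq_integral[OF int]) auto
  then show "(LINT t|M. norm (\<xi> t) powr r) \<le> K powr r" by (simp add: ennreal_le_iff)
qed

lemma density_Lq_space: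
  assumes q: "conjugate_exponent p q"
  shows "\<xi> \<in> Lp_space M q" "Lp_norm M q \<xi> \<le> K"
proof -
  have [measurable]: "\<xi> \<in> borel_measurable M" by (rule \<xi>_meas)
  have "\<xi> \<in> Lp_space M q \<and> Lp_norm M q \<xi> \<le> K"
  proof (cases "p = 1")
    case True
    then have q': "q = \<infinity>" using q by (simp add: conjugate_exponent_def)
    have "esssup M (\<lambda>t. ennreal (norm (\<xi> t))) \<le> ennreal K"
    proof (rule esssup_I)
      show "AE t in M. ennreal (norm (\<xi> t)) \<le> ennreal K"
        using density_Lq_infinity[OF True] by eventually_elim (rule ennreal_leI)
    qed measurable
    then show ?thesis
      using K by (auto simp: Lp_space_def Lp_norm_def q' le_less_trans[OF _ ennreal_less_top] enn2real_leI)
  next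
    case False
    with p have "1 < p" by simp
    with q obtain r where r: "q = ereal r" "1 < r" "1 / p + 1 / r = 1" using conjugate_exponent_finite by blast
    note d = density_Lq[OF r(2,3)]
    have "1 \<le> r" using r by simp
    then show ?thesis
      using d Lp_norm_le_iff[OF \<open>1 \<le> r\<close> K, of M \<xi>] by (simp add: r Lp_iff)
  qed
  then show "\<xi> \<in> Lp_space M q" "Lp_norm M q \<xi> \<le> K" by auto
qed

end

text \<open>A given bound \<open>K\<close> is carried through to the norm of \<xi>; for subgradients
  of the distance function \<open>K = 1\<close> yields the norm estimate.\<close>

theorem Lp_dual_representation:
  fixes M :: "'t measure" and p :: real
    and \<phi> :: "('t \<Rightarrow> 'z::{real_normed_vector, second_countable_topology}) \<Rightarrow> real"
  assumes p: "1 \<le> p" and sf: "sigma_finite_measure M" and refl: "reflexive_space TYPE('z)"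
    and q: "conjugate_exponent p q" and \<phi>: "\<phi> \<in> dual_space (Lp_space M p) (Lp_norm M p)"
    and K: "0 \<le> K" "\<And>f. f \<in> Lp_space M p \<Longrightarrow> \<bar>\<phi> f\<bar> \<le> K * Lp_norm M p f"
  obtains \<xi> where "\<xi> \<in> Lp_space M q" "Lp_norm M q \<xi> \<le> K" "\<phi> = Lp_pairing M p \<xi>"
proof -
  obtain w :: "'t \<Rightarrow> real" where w: "w \<in> Lp_space M (ereal p)" "Lp_norm M (ereal p) w \<le> 1" "\<And>t. w t > 0"
    using Lp_weight[OF p sf] by blast
  interpret Lp_functional M p \<phi> K w
  proof (rule Lp_functional.intro)
    show "\<phi> (\<lambda>t. f t + g t) = \<phi> f + \<phi> g" if "f \<in> Lp_space M p" "g \<in> Lp_space M p" for f g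
    proof -
      have "\<phi> (f + g) = \<phi> f + \<phi> g" using \<phi> that unfolding dual_space_def by blast
      then show ?thesis by (simp only: plus_fun_def)
    qed
    show "\<phi> (\<lambda>t. r *\<^sub>R f t) = r * \<phi> f" if "f \<in> Lp_space M p" for r f
    proof -
      have "\<phi> (r *\<^sub>R f) = r * \<phi> f" using \<phi> that unfolding dual_space_def by blast
      then show ?thesis by (simp only: scaleR_fun_def)
    qed
  qed (rule p sf K(1) w(1) w(3) | erule K(2))+
  obtain D :: "nat \<Rightarrow> 'z" where D: "\<And>z e. e > 0 \<Longrightarrow> \<exists>n. norm (z - D n) < e"
    using countable_dense_real_normed by blast
  show thesis
  proof (rule density_functional[OF refl D])
    fix \<xi> :: "'t \<Rightarrow> 'z \<Rightarrow>\<^sub>L real" and \<gamma>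
    assume \<xi>: "\<xi> \<in> borel_measurable M" "integrable M \<gamma>" "AE t in M. norm (\<xi> t) * w t \<le> \<gamma> t"
      and \<xi>_\<phi>: "\<And>n A. A \<in> sets M \<Longrightarrow> (LINT t|M. \<xi> t (weighted A (D n) t)) = \<phi> (weighted A (D n))"
    interpret Lp_functional_density M p \<phi> K w \<xi> \<gamma> D
      by unfold_locales (rule \<xi> | erule D | erule \<xi>_\<phi>)+
    have \<xi>q: "\<xi> \<in> Lp_space M q" "Lp_norm M q \<xi> \<le> K" using density_Lq_space[OF q] by auto
    have "\<phi> = Lp_pairing M p \<xi>"
    proof (rule extensionalityI[of _ "Lp_space M p"])
      show "\<phi> \<in> extensional (Lp_space M p)" using \<phi> by (simp add: dual_space_def)
      show "Lp_pairing M p \<xi> \<in> extensional (Lp_space M p)" by (simp add: Lp_pairing_def)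
      show "\<phi> f = Lp_pairing M p \<xi> f" if f: "f \<in> Lp_space M p" for f
        using representation[OF f Lp_holder(1)[OF p q \<xi>q(1) f]] f by (simp add: Lp_pairing_def)
    qed
    with \<xi>q show thesis by (rule that)
  qed
qed

lemma Lp_pairing_dual_space:
  fixes \<xi> :: "'t \<Rightarrow> 'z::{real_normed_vector, second_countable_topology} \<Rightarrow>\<^sub>L real"
  assumes p: "1 \<le> p" and q: "conjugate_exponent p q" and \<xi>: "\<xi> \<in> Lp_space M q"
  shows "Lp_pairing M p \<xi> \<in> dual_space (Lp_space M p) (Lp_norm M p)"
proof -
  have \<xi>m: "\<xi> \<in> borel_measurable M" using \<xi> by (simp add: Lp_space_def)
  note holder = Lp_holder[OF p q \<xi>]
  note le = integral_pairing_le[OF \<xi>m Lp_measurable[OF p] holder(1)]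
  have add: "Lp_pairing M p \<xi> (f + g) = Lp_pairing M p \<xi> f + Lp_pairing M p \<xi> g"
    if fg: "f \<in> Lp_space M p" "g \<in> Lp_space M p" for f g
    using Lp_add[OF p fg] fg le(1)[OF fg(1) fg(1)] le(1)[OF fg(2) fg(2)]
    by (simp add: Lp_pairing_def plus_fun_def blinfun.add_right)
  have scale: "Lp_pairing M p \<xi> (r *\<^sub>R f) = r * Lp_pairing M p \<xi> f" if f: "f \<in> Lp_space M p" for f r
    using Lp_scale(1)[OF p f, of r] f le(1)[OF f f]
    by (simp add: Lp_pairing_def scaleR_fun_def blinfun.scaleR_right)
  have "\<bar>Lp_pairing M p \<xi> f\<bar> \<le> Lp_norm M q \<xi> * Lp_norm M p f" if f: "f \<in> Lp_space M p" for f
    using le(2)[OF f f] holder(2)[OF f] f by (simp add: Lp_pairing_def)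
  then have "\<exists>C. \<forall>f\<in>Lp_space M p. \<bar>Lp_pairing M p \<xi> f\<bar> \<le> C * Lp_norm M p f" by blast
  moreover have "Lp_pairing M p \<xi> \<in> extensional (Lp_space M p)" by (simp add: Lp_pairing_def)
  ultimately show ?thesis using add scale unfolding dual_space_def by blast
qed

section \<open>Pointwise tangents are tangents to the set of selections\<close>

context dense_selections
begin

text \<open>A selection \<open>y\<close> near \<open>x\<close> is corrected only on
  \<open>E k - G\<close>, where the pointwise estimate has radius \<open>d = 1 / (k + 1)\<close> and
  \<open>y t\<close> is within that radius of \<open>x t\<close>. Off \<open>E k\<close> the norm of
  \<open>v\<close> is small for large \<open>k\<close>, and on \<open>G\<close> it is small because
  \<open>y\<close> is close to \<open>x\<close> in L^p.\<close>

lemma clarke_tangent_cone_Sel_of_pointwise: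
  fixes p :: real
  assumes p: "1 \<le> p" and sf: "sigma_finite_measure M" and x: "x \<in> Sel M p S"
    and v: "v \<in> Lp_space M p" and vT: "AE t in M. v t \<in> clarke_tangent_cone UNIV norm (S t) (x t)"
  shows "v \<in> clarke_tangent_cone (Lp_space M p) (Lp_norm M p) (Sel M p S) x"
proof -
  obtain w :: "'t \<Rightarrow> real" where w: "w \<in> Lp_space M (ereal p)" "Lp_norm M (ereal p) w \<le> 1" "\<And>t. w t > 0"
    using Lp_weight[OF p sf] by blast
  have xL: "x \<in> Lp_space M p" and xS: "AE t in M. x t \<in> S t" using x by (auto simp: Sel_def)
  have [measurable]: "x \<in> borel_measurable M" "v \<in> borel_measurable M" "w \<in> borel_measurable M"
    "s n \<in> borel_measurable M" for n using Lp_measurable[OF p] xL v w s_meas by auto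
  have "\<exists>\<delta>>0. \<exists>\<kappa>>0. \<forall>y\<in>Sel M p S. Lp_norm M p (y - x) \<le> \<delta> \<longrightarrow>
      (\<forall>\<eta>\<in>{0..\<kappa>}. \<exists>b\<in>Lp_space M p. Lp_norm M p b \<le> 1 \<and> y + \<eta> *\<^sub>R (v + \<epsilon> *\<^sub>R b) \<in> Sel M p S)"
    if \<epsilon>: "\<epsilon> > 0" for \<epsilon>
  proof -
    \<comment> \<open>A selection within \<open>2 * c t * \<eta>\<close> of
      \<open>y t + \<eta> *\<^sub>R v t\<close> then needs a correction of norm at most
      \<open>2 * c t / \<epsilon> = w t / 2\<close>, half of the admissible norm.\<close>
    define c where "c t = \<epsilon> / 4 * w t" for t
    have c_pos: "c t > 0" for t using \<epsilon> w(3) by (simp add: c_def)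
    have [measurable]: "c \<in> borel_measurable M" unfolding c_def[abs_def] by measurable
    define E where "E k = {t \<in> space M. tangent_within (S t) (x t) (v t) (c t) (1 / real (Suc k))}" for k
    have E [measurable]: "E k \<in> sets M" for k unfolding E_def by (intro measurable_tangent_within) measurable
    have "AE t in M. \<forall>\<^sub>F k in sequentially. t \<notin> space M - E k"
      using vT xS AE_space
    proof eventually_elim
      case (elim t)
      have "tangent_bound (S t) (x t) (v t) (c t)" using elim c_pos[of t] clarke_tangent_cone_iff[OF elim(2)] by blast
      then obtain k where k: "tangent_within (S t) (x t) (v t) (c t) (1 / real (Suc k))"
        unfolding tangent_bound_iff_nat ..
      have "t \<in> E j" if "k \<le> j" for j
        unfolding E_def using elim tangent_within_antimono[OF k, of "1 / real (Suc j)"] that by (simp add: frac_le)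
      then show ?case unfolding eventually_sequentially by blast
    qed
    then have "(\<lambda>k. Lp_norm M p (\<lambda>t. indicator (space M - E k) t *\<^sub>R v t)) \<longlonglongrightarrow> 0"
      by (intro Lp_norm_tendsto_zero[OF p v]) auto
    then have "\<forall>\<^sub>F k in sequentially. Lp_norm M p (\<lambda>t. indicator (space M - E k) t *\<^sub>R v t) < \<epsilon> / 4"
      using \<epsilon> by (intro order_tendstoD) auto
    then obtain k where k: "Lp_norm M p (\<lambda>t. indicator (space M - E k) t *\<^sub>R v t) < \<epsilon> / 4"
      using eventually_happens'[OF sequentially_bot] by blast
    define d where "d = 1 / real (Suc k)"
    have d: "d > 0" by (simp add: d_def)
    obtain \<delta> where \<delta>: "\<delta> > 0" "\<And>g :: 't \<Rightarrow> 'z. g \<in> Lp_space M p \<Longrightarrow> Lp_norm M p g \<le> \<delta> \<Longrightarrow>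
        Lp_norm M p (\<lambda>t. indicator {t \<in> space M. d \<le> norm (g t)} t *\<^sub>R v t) \<le> \<epsilon> / 4"
      using Lp_norm_abs_cont[OF p v d, of "\<epsilon> / 4"] \<epsilon> by auto
    have "\<exists>b\<in>Lp_space M p. Lp_norm M p b \<le> 1 \<and> y + \<eta> *\<^sub>R (v + \<epsilon> *\<^sub>R b) \<in> Sel M p S"
      if y: "y \<in> Sel M p S" "Lp_norm M p (y - x) \<le> \<delta>" and \<eta>: "0 \<le> \<eta>" "\<eta> \<le> d / 2" for y \<eta>
    proof (cases "\<eta> = 0")
      case True
      have eq: "y + \<eta> *\<^sub>R (v + \<epsilon> *\<^sub>R (\<lambda>_. 0)) = y" by (simp add: True fun_eq_iff)
      have "y + \<eta> *\<^sub>R (v + \<epsilon> *\<^sub>R (\<lambda>_. 0)) \<in> Sel M p S" unfolding eq by (rule y(1))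
      moreover have "Lp_norm M p (\<lambda>_. 0 :: 'z) \<le> 1" by (simp add: Lp_norm_zero[OF p])
      ultimately show ?thesis using Lp_zero[OF p] by blast
    next
      case False
      with \<eta> have \<eta>0: "\<eta> > 0" by simp
      have yL: "y \<in> Lp_space M p" and yS: "AE t in M. y t \<in> S t" using y(1) by (auto simp: Sel_def)
      have [measurable]: "y \<in> borel_measurable M" using Lp_measurable[OF p yL] .
      define G where "G = {t \<in> space M. d \<le> norm (y t - x t)}"
      have G [measurable]: "G \<in> sets M" unfolding G_def by measurable
      have yx: "(\<lambda>t. y t - x t) \<in> Lp_space M p" by (rule Lp_diff[OF p yL xL])
      have Gv: "Lp_norm M p (\<lambda>t. indicator G t *\<^sub>R v t) \<le> \<epsilon> / 4"
        using \<delta>(2)[OF yx] y(2) by (simp add: G_def fun_diff_def)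
      define P where "P n t \<longleftrightarrow> dist (s n t) (y t + \<eta> *\<^sub>R v t) < 2 * c t * \<eta>" for n t
      have P: "{t \<in> space M. P n t} \<in> sets M" for n unfolding P_def by measurable
      \<comment> \<open>Where \<open>y\<close> is kept, \<open>b\<close> equals
        \<open>- v / \<epsilon>\<close>: the whole step is undone.\<close>
      define y' where "y' t = (if t \<in> E k - G then s (LEAST n. P n t) t else y t)" for t
      have [measurable]: "(\<lambda>t. s (LEAST n. P n t) t) \<in> borel_measurable M"
        by (rule measurable_first_index[OF P s_meas])
      have [measurable]: "y' \<in> borel_measurable M" unfolding y'_def[abs_def] by measurable
      have y'S: "AE t in M. y' t \<in> S t"
        using yS AE_space by eventually_elim (auto simp: y'_def s_in)
      define b where "b t = (1 / (\<eta> * \<epsilon>)) *\<^sub>R (y' t - (y t + \<eta> *\<^sub>R v t))" for t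
      have bm: "b \<in> borel_measurable M" unfolding b_def[abs_def] by measurable
      have y'b: "y t + \<eta> *\<^sub>R (v t + \<epsilon> *\<^sub>R b t) = y' t" for t
        using \<eta>0 \<epsilon> by (simp add: b_def scaleR_add_right)
      define h1 where "h1 t = norm (indicator (space M - E k) t *\<^sub>R v t)" for t
      define h2 where "h2 t = norm (indicator G t *\<^sub>R v t)" for t
      \<comment> \<open>A majorant of \<open>b\<close> that adds the contributions of corrected and
        uncorrected points. Its norm is at most \<open>1 / 2 + (1 / \<epsilon>) * (\<epsilon> / 4 +
        \<epsilon> / 4) = 1\<close>.\<close>
      define H where "H t = (1 / 2) *\<^sub>R w t + (1 / \<epsilon>) *\<^sub>R (h1 t + h2 t)" for t
      have b_le: "AE t in M. norm (b t) \<le> norm (H t)"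
        using yS AE_space
      proof eventually_elim
        case (elim t)
        have nn: "0 \<le> h1 t" "0 \<le> h2 t" "0 < w t" using w(3) by (auto simp: h1_def h2_def)
        have Hn: "norm (H t) = w t / 2 + (h1 t + h2 t) / \<epsilon>" using nn \<epsilon> by (simp add: H_def)
        show ?case
        proof (cases "t \<in> E k - G")
          case True
          then have tw: "tangent_within (S t) (x t) (v t) (c t) d" and near: "norm (y t - x t) < d"
            using elim by (auto simp: E_def G_def d_def)
          have "\<eta> < d" using \<eta> d by linarith
          then have "infdist (y t + \<eta> *\<^sub>R v t) (S t) \<le> c t * \<eta>"
            using tw elim(1) near \<eta>0 unfolding tangent_within_def by blast
          also have "\<dots> < 2 * c t * \<eta>" using c_pos[of t] \<eta>0 by simp
          finally have "\<exists>n. P n t"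
            using infdist_less_iff[OF elim(2)] by (simp add: P_def dist_commute)
          then have "P (LEAST n. P n t) t" by (rule LeastI_ex)
          then have less: "norm (y' t - (y t + \<eta> *\<^sub>R v t)) < 2 * c t * \<eta>" using True by (simp add: P_def y'_def dist_norm)
          have "norm (b t) = norm (y' t - (y t + \<eta> *\<^sub>R v t)) / (\<eta> * \<epsilon>)" using \<eta>0 \<epsilon> by (simp add: b_def)
          also have "\<dots> \<le> 2 * c t * \<eta> / (\<eta> * \<epsilon>)" using less \<eta>0 \<epsilon> by (intro divide_right_mono) auto
          also have "\<dots> = w t / 2" using \<eta>0 \<epsilon> by (simp add: c_def)
          finally show ?thesis unfolding Hn using nn \<epsilon> by (simp add: add_increasing2)
        next
          case False
          have "y' t = y t" by (simp only: y'_def if_not_P[OF False])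
          then have "norm (b t) = norm (v t) / \<epsilon>" using \<eta>0 \<epsilon> by (simp add: b_def)
          also have "norm (v t) \<le> h1 t + h2 t"
            using False elim nn by (auto simp: h1_def h2_def indicator_def)
          finally have "norm (b t) \<le> (h1 t + h2 t) / \<epsilon>" using \<epsilon> by (simp add: divide_right_mono)
          then show ?thesis unfolding Hn using nn by simp
        qed
      qed
      have Ek: "space M - E k \<in> sets M" by simp
      have h1L: "h1 \<in> Lp_space M p" "Lp_norm M p h1 \<le> \<epsilon> / 4"
        using Lp_dominated[OF p Lp_indicator(1)[OF p v Ek], of h1] k by (auto simp: h1_def[abs_def])
      have h2L: "h2 \<in> Lp_space M p" "Lp_norm M p h2 \<le> \<epsilon> / 4"
        using Lp_dominated[OF p Lp_indicator(1)[OF p v G], of h2] Gv by (auto simp: h2_def[abs_def])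
      note h12 = Lp_add[OF p h1L(1) h2L(1)]
      have HL: "H \<in> Lp_space M p" unfolding H_def[abs_def]
        by (rule Lp_add[OF p Lp_scale(1)[OF p w(1)] Lp_scale(1)[OF p h12]])
      have "Lp_norm M p H \<le> (1 / 2) * Lp_norm M p w + (1 / \<epsilon>) * Lp_norm M p (\<lambda>t. h1 t + h2 t)"
        unfolding H_def[abs_def]
        using Lp_triangle[OF p Lp_scale(1)[OF p w(1), of "1 / 2"] Lp_scale(1)[OF p h12, of "1 / \<epsilon>"]]
          Lp_scale(2)[OF p w(1), of "1 / 2"] Lp_scale(2)[OF p h12, of "1 / \<epsilon>"] \<epsilon> by simp
      also have "\<dots> \<le> (1 / 2) * 1 + (1 / \<epsilon>) * (\<epsilon> / 4 + \<epsilon> / 4)"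
        using Lp_triangle[OF p h1L(1) h2L(1)] h1L(2) h2L(2) w(2) \<epsilon> by (intro add_mono mult_left_mono) auto
      also have "\<dots> = 1" using \<epsilon> by (simp add: field_simps)
      finally have H1: "Lp_norm M p H \<le> 1" .
      have bL: "b \<in> Lp_space M p" by (rule Lp_dominated(1)[OF p HL bm b_le])
      have b1: "Lp_norm M p b \<le> 1" using Lp_dominated(2)[OF p HL bm b_le] H1 by simp
      have "(\<lambda>t. y t + \<eta> *\<^sub>R (v t + \<epsilon> *\<^sub>R b t)) \<in> Lp_space M p"
        by (intro Lp_add[OF p yL] Lp_scale(1)[OF p] Lp_add[OF p v] bL)
      then have "y' \<in> Lp_space M p" by (simp add: y'b)
      moreover have "y + \<eta> *\<^sub>R (v + \<epsilon> *\<^sub>R b) = y'" using y'b by (simp add: fun_eq_iff)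
      ultimately show ?thesis using bL b1 y'S by (auto simp: Sel_def)
    qed
    then show ?thesis using \<delta>(1) d by (intro exI[of _ \<delta>] exI[of _ "d / 2"] conjI ballI impI) auto
  qed
  then show ?thesis using v by (simp add: clarke_tangent_cone_def)
qed

end

section \<open>Normal cones and the distance function\<close>

lemma eventually_seminorm_nhds_at_right:
  assumes "\<delta> > 0" "\<kappa> > 0"
    and P: "\<And>y \<eta>. y \<in> V \<Longrightarrow> N (y - x) < \<delta> \<Longrightarrow> 0 < \<eta> \<Longrightarrow> \<eta> < \<kappa> \<Longrightarrow> P (y, \<eta>)"
  shows "eventually P (seminorm_nhds V N x \<times>\<^sub>F at_right (0 :: real))"
  unfolding eventually_prod_filter
proof (intro exI conjI allI impI)
  show "eventually (\<lambda>y. y \<in> V \<and> N (y - x) < \<delta>) (seminorm_nhds V N x)"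
    unfolding seminorm_nhds_def eventually_inf_principal eventually_filtercomap
  proof (intro exI conjI allI impI)
    show "eventually (\<lambda>r. r < \<delta>) (nhds 0)"
      using eventually_nhds_in_open[of "{..<\<delta>}" 0] assms(1) by simp
  qed auto
  show "eventually (\<lambda>\<eta>. 0 < \<eta> \<and> \<eta> < \<kappa>) (at_right 0)"
    by (rule eventually_at_rightI[of 0 \<kappa>]) (use assms(2) in auto)
qed (use P in auto)

lemma clarke_derivative_le:
  assumes "\<delta> > 0" "\<kappa> > 0"
    and "\<And>y \<eta>. y \<in> V \<Longrightarrow> N (y - x) < \<delta> \<Longrightarrow> 0 < \<eta> \<Longrightarrow> \<eta> < \<kappa> \<Longrightarrow> f (y + \<eta> *\<^sub>R v) - f y \<le> c * \<eta>"
  shows "clarke_derivative V N f x v \<le> ereal c"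
  unfolding clarke_derivative_def
  by (rule Limsup_bounded, rule eventually_seminorm_nhds_at_right[OF assms(1,2)])
    (use assms(3) in \<open>simp add: pos_divide_le_eq\<close>)

text \<open>The distance function is 1-Lipschitz, which bounds \<phi> by \<open>N\<close>. Along a
  tangent its Clarke derivative at \<open>x\<close> is at most 0: the base points \<open>y\<close>
  need not lie in \<open>C\<close>, but an almost nearest point \<open>c\<close> of \<open>C\<close>
  is again close to \<open>x\<close>, and tangency applies at \<open>c\<close>.\<close>

lemma clarke_subdifferential_distance:
  fixes V :: "'v::real_vector set" and N :: "'v \<Rightarrow> real"
  assumes V: "subspace V" and nonneg: "\<And>v. 0 \<le> N v"
    and tri: "\<And>u v. u \<in> V \<Longrightarrow> v \<in> V \<Longrightarrow> N (u + v) \<le> N u + N v"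
    and scale: "\<And>r v. v \<in> V \<Longrightarrow> N (r *\<^sub>R v) = \<bar>r\<bar> * N v"
    and C: "C \<subseteq> V" "x \<in> C"
    and \<phi>: "\<phi> \<in> clarke_subdifferential V N (distance_function N C) x"
  shows "\<phi> \<in> clarke_normal_cone V N C x" and "\<And>v. v \<in> V \<Longrightarrow> \<bar>\<phi> v\<bar> \<le> N v"
proof -
  let ?d = "distance_function N C"
  have \<phi>_dual: "\<phi> \<in> dual_space V N" and \<phi>_le: "\<And>v. v \<in> V \<Longrightarrow> ereal (\<phi> v) \<le> clarke_derivative V N ?d x v"
    using \<phi> by (auto simp: clarke_subdifferential_def)
  have bdd: "bdd_below ((\<lambda>c. N (y - c)) ` C)" for y using nonneg by (intro bdd_belowI2[where m = 0]) auto
  have d_le: "?d y \<le> N (y - c)" if "c \<in> C" for y c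
    unfolding distance_function_def by (rule cINF_lower[OF bdd that])
  have d_ex: "\<exists>c\<in>C. N (y - c) < ?d y + e" if e: "e > 0" for y e
    using cINF_less_iff[of C "\<lambda>c. N (y - c)" "?d y + e"] bdd C(2) e
    unfolding distance_function_def by fastforce
  note mem = subspace_add[OF V] subspace_diff[OF V] subspace_scale[OF V]
  have lip: "\<phi> v \<le> N v" if v: "v \<in> V" for v
  proof -
    have "clarke_derivative V N ?d x v \<le> ereal (N v)"
    proof (rule clarke_derivative_le[of 1 1])
      fix y and \<eta> :: real assume y: "y \<in> V" and \<eta>: "0 < \<eta>"
      have "?d (y + \<eta> *\<^sub>R v) \<le> ?d y + N v * \<eta> + e" if e: "e > 0" for e
      proof -
        obtain c where c: "c \<in> C" "N (y - c) < ?d y + e" using d_ex[OF e] by blast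
        have "?d (y + \<eta> *\<^sub>R v) \<le> N ((y - c) + \<eta> *\<^sub>R v)"
          using d_le[OF c(1), of "y + \<eta> *\<^sub>R v"] by (simp add: algebra_simps)
        also have "\<dots> \<le> N (y - c) + N (\<eta> *\<^sub>R v)" using y v c C by (intro tri mem) auto
        also have "N (\<eta> *\<^sub>R v) = N v * \<eta>" using scale[OF v, of \<eta>] \<eta> by simp
        finally show ?thesis using c(2) by simp
      qed
      then have "?d (y + \<eta> *\<^sub>R v) \<le> ?d y + N v * \<eta>" by (rule field_le_epsilon)
      then show "?d (y + \<eta> *\<^sub>R v) - ?d y \<le> N v * \<eta>" by simp
    qed auto
    then show ?thesis using \<phi>_le[OF v] order_trans ereal_less_eq(3) by blast
  qed
  show "\<bar>\<phi> v\<bar> \<le> N v" if v: "v \<in> V" for v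
  proof -
    have "\<phi> ((-1) *\<^sub>R v) = -1 * \<phi> v" using \<phi>_dual v unfolding dual_space_def by blast
    moreover have "N ((-1) *\<^sub>R v) = N v" using scale[OF v, of "-1"] by simp
    ultimately show ?thesis using lip[OF v] lip[OF mem(3)[OF v, of "-1"]] by (simp add: abs_le_iff)
  qed
  have "\<phi> v \<le> 0" if v: "v \<in> clarke_tangent_cone V N C x" for v
  proof (rule field_le_epsilon)
    fix e :: real assume e: "e > 0"
    \<comment> \<open>One half of \<open>e\<close> pays for the almost nearest point
      \<open>c\<close>, the other for the correction \<open>b\<close>.\<close>
    define \<epsilon> where "\<epsilon> = e / 2"
    have \<epsilon>: "\<epsilon> > 0" using e by (simp add: \<epsilon>_def)
    have vV: "v \<in> V" using v by (simp add: clarke_tangent_cone_def)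
    have "\<exists>\<delta>>0. \<exists>\<kappa>>0. \<forall>y\<in>C. N (y - x) \<le> \<delta> \<longrightarrow>
        (\<forall>\<eta>\<in>{0..\<kappa>}. \<exists>b\<in>V. N b \<le> 1 \<and> y + \<eta> *\<^sub>R (v + \<epsilon> *\<^sub>R b) \<in> C)"
      using v \<epsilon> unfolding clarke_tangent_cone_def by blast
    then obtain \<delta> \<kappa> where \<delta>: "\<delta> > 0" "\<kappa> > 0"
      and near: "\<And>y \<eta>. y \<in> C \<Longrightarrow> N (y - x) \<le> \<delta> \<Longrightarrow> 0 \<le> \<eta> \<Longrightarrow> \<eta> \<le> \<kappa> \<Longrightarrow>
        \<exists>b\<in>V. N b \<le> 1 \<and> y + \<eta> *\<^sub>R (v + \<epsilon> *\<^sub>R b) \<in> C"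
      by (metis atLeastAtMost_iff)
    have "clarke_derivative V N ?d x v \<le> ereal e"
    \<comment> \<open>\<open>N (c - x)\<close> is at most \<open>N (y - c) + N (y - x)\<close>,
      which is below \<open>2 * N (y - x) + \<epsilon> * \<eta>\<close>; the radii bound the two
      terms by \<open>\<delta> / 2\<close> each.\<close>
    proof (rule clarke_derivative_le[of "\<delta> / 4" "min \<kappa> (\<delta> / (2 * \<epsilon>))"])
      fix y \<eta> assume y: "y \<in> V" "N (y - x) < \<delta> / 4" and \<eta>: "0 < \<eta>" "\<eta> < min \<kappa> (\<delta> / (2 * \<epsilon>))"
      have \<epsilon>\<eta>: "\<epsilon> * \<eta> > 0" "\<epsilon> * \<eta> < \<delta> / 2" using \<epsilon> \<eta> by (auto simp: field_simps)
      obtain c where c: "c \<in> C" "N (y - c) < ?d y + \<epsilon> * \<eta>" using d_ex[OF \<epsilon>\<eta>(1)] by blast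
      have cV: "c \<in> V" "x \<in> V" using c C by auto
      have "N (c - x) \<le> N (c - y) + N (y - x)"
        using tri[of "c - y" "y - x"] mem y cV by simp
      moreover have "N (c - y) = N (y - c)" using scale[of "y - c" "-1"] mem y cV by simp
      ultimately have "N (c - x) \<le> \<delta>" using c(2) d_le[OF C(2), of y] y(2) \<epsilon>\<eta>(2) by linarith
      then obtain b where b: "b \<in> V" "N b \<le> 1" "c + \<eta> *\<^sub>R (v + \<epsilon> *\<^sub>R b) \<in> C"
        using near[OF c(1), of \<eta>] \<eta> by auto
      have "?d (y + \<eta> *\<^sub>R v) \<le> N ((y - c) + (- (\<eta> * \<epsilon>)) *\<^sub>R b)"
        using d_le[OF b(3), of "y + \<eta> *\<^sub>R v"] by (simp add: algebra_simps)
      also have "\<dots> \<le> N (y - c) + N ((- (\<eta> * \<epsilon>)) *\<^sub>R b)" using y cV b by (intro tri mem) auto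
      also have "N ((- (\<eta> * \<epsilon>)) *\<^sub>R b) = \<epsilon> * \<eta> * N b" using scale[OF b(1), of "- (\<eta> * \<epsilon>)"] \<eta> \<epsilon> by (simp add: mult.commute)
      also have "\<dots> \<le> \<epsilon> * \<eta>" using mult_left_mono[OF b(2), of "\<epsilon> * \<eta>"] \<epsilon>\<eta> by simp
      finally have "?d (y + \<eta> *\<^sub>R v) - ?d y \<le> 2 * (\<epsilon> * \<eta>)" using c(2) by simp
      then show "?d (y + \<eta> *\<^sub>R v) - ?d y \<le> e * \<eta>" by (simp add: \<epsilon>_def)
    qed (use \<delta> \<epsilon> in auto)
    then show "\<phi> v \<le> 0 + e" using \<phi>_le[OF vV] order_trans ereal_less_eq(3) by fastforce
  qed
  then show "\<phi> \<in> clarke_normal_cone V N C x" using \<phi>_dual by (simp add: clarke_normal_cone_def)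
qed

text \<open>Members of a Castaing representation of the tangent cones are cut to sets where \<xi> is
  positive on them and set to 0, also a tangent, elsewhere. Normality makes the integral of the
  resulting nonnegative pairing at most 0, so these sets are null. The additional bound by
  \<open>real m * w t\<close> makes the test functions p-integrable and leaves countably many null
  sets; density of the values gives the inequality on the whole cone.\<close>

lemma (in dense_selections) clarke_normal_cone_Sel_representation:
  fixes p :: real
  assumes p: "1 \<le> p" and sf: "sigma_finite_measure M" and refl: "reflexive_space TYPE('z)"
    and q: "conjugate_exponent p q" and x: "x \<in> Sel M p S"
    and \<phi>: "\<phi> \<in> clarke_normal_cone (Lp_space M p) (Lp_norm M p) (Sel M p S) x"
    and K: "0 \<le> K" "\<And>f. f \<in> Lp_space M p \<Longrightarrow> \<bar>\<phi> f\<bar> \<le> K * Lp_norm M p f"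
  obtains \<xi> where "\<xi> \<in> Lp_space M q" "Lp_norm M q \<xi> \<le> K" "\<phi> = Lp_pairing M p \<xi>"
    "AE t in M. blinfun_apply (\<xi> t) \<in> clarke_normal_cone UNIV norm (S t) (x t)"
proof -
  have xL: "x \<in> Lp_space M p" and xS: "AE t in M. x t \<in> S t" using x by (auto simp: Sel_def)
  have xm: "x \<in> borel_measurable M" by (rule Lp_measurable[OF p xL])
  have "\<phi> \<in> dual_space (Lp_space M p) (Lp_norm M p)" using \<phi> by (simp add: clarke_normal_cone_def)
  then obtain \<xi> where \<xi>: "\<xi> \<in> Lp_space M q" "Lp_norm M q \<xi> \<le> K" "\<phi> = Lp_pairing M p \<xi>"
    using Lp_dual_representation[OF p sf refl q _ K] by metis
  obtain u where u: "\<And>n. u n \<in> borel_measurable M"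
    "\<And>n t. t \<in> space M \<Longrightarrow> x t \<in> S t \<Longrightarrow> u n t \<in> clarke_tangent_cone UNIV norm (S t) (x t)"
    "\<And>t v e. t \<in> space M \<Longrightarrow> x t \<in> S t \<Longrightarrow> v \<in> clarke_tangent_cone UNIV norm (S t) (x t) \<Longrightarrow>
      e > 0 \<Longrightarrow> \<exists>n::nat. dist (u n t) v < e"
    using castaing_clarke_tangent_cone[OF refl xm] by metis
  obtain w :: "'t \<Rightarrow> real" where w: "w \<in> Lp_space M (ereal p)" "\<And>t. w t > 0"
    using Lp_weight[OF p sf] by blast
  have \<xi>m: "\<xi> \<in> borel_measurable M" using \<xi>(1) by (simp add: Lp_space_def)
  have [measurable]: "w \<in> borel_measurable M" "u n \<in> borel_measurable M" for n
    using Lp_measurable[OF p w(1)] u(1) by auto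
  have [measurable]: "(\<lambda>t. \<xi> t (u n t)) \<in> borel_measurable M" for n by (rule measurable_pairing[OF \<xi>m u(1)])
  have xSm [measurable]: "{t \<in> space M. x t \<in> S t} \<in> sets M" by (rule measurable_member[OF xm])
  have cut: "AE t in M. \<not> (0 < \<xi> t (u n t) \<and> norm (u n t) \<le> real m * w t)" for n m
  proof -
    define A where "A = {t \<in> space M. x t \<in> S t} \<inter> {t \<in> space M. 0 < \<xi> t (u n t) \<and> norm (u n t) \<le> real m * w t}"
    have A [measurable]: "A \<in> sets M" unfolding A_def by (intro sets.Int xSm) measurable
    define v where "v t = indicator A t *\<^sub>R u n t" for t
    have vm: "v \<in> borel_measurable M" unfolding v_def[abs_def] by measurable
    have vL: "v \<in> Lp_space M p"
      by (rule Lp_dominated(1)[OF p Lp_scale(1)[OF p w(1), of "real m"] vm])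
        (use w(2) in \<open>auto simp: v_def A_def indicator_def less_imp_le abs_mult\<close>)
    have "AE t in M. v t \<in> clarke_tangent_cone UNIV norm (S t) (x t)"
      using xS AE_space
    proof eventually_elim
      case (elim t)
      then show ?case using u(2)[OF elim(2,1)] zero_in_clarke_tangent_cone[OF elim(1)]
        by (cases "t \<in> A") (auto simp: v_def)
    qed
    from clarke_tangent_cone_Sel_of_pointwise[OF p sf x vL this]
    have "\<phi> v \<le> 0" using \<phi> by (simp add: clarke_normal_cone_def)
    then have le0: "(LINT t|M. \<xi> t (v t)) \<le> 0" using vL by (simp add: \<xi>(3) Lp_pairing_def)
    have int: "integrable M (\<lambda>t. \<xi> t (v t))"
      by (rule integral_pairing_le(1)[OF \<xi>m vm Lp_holder(1)[OF p q \<xi>(1) vL]])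
    have nn: "0 \<le> \<xi> t (v t)" for t
      by (auto simp: v_def A_def indicator_def)
    have "(LINT t|M. \<xi> t (v t)) = 0" using le0 nn by (intro antisym integral_nonneg_AE) auto
    then have "AE t in M. \<xi> t (v t) = 0" using integral_nonneg_eq_0_iff_AE[OF int] nn by simp
    then show ?thesis
      using xS AE_space
    proof eventually_elim
      case (elim t)
      then show ?case by (cases "t \<in> A") (auto simp: v_def A_def)
    qed
  qed
  then have "AE t in M. \<forall>n m. \<not> (0 < \<xi> t (u n t) \<and> norm (u n t) \<le> real m * w t)"
    by (simp only: AE_all_countable) blast
  then have "AE t in M. blinfun_apply (\<xi> t) \<in> clarke_normal_cone UNIV norm (S t) (x t)"
    using xS AE_space
  proof eventually_elim
    case (elim t)
    have un: "\<xi> t (u n t) \<le> 0" for n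
    proof (rule ccontr)
      assume "\<not> \<xi> t (u n t) \<le> 0"
      moreover obtain m :: nat where "norm (u n t) / w t \<le> real m" using real_arch_simple by blast
      then have "norm (u n t) \<le> real m * w t" using w(2)[of t] by (simp add: pos_divide_le_eq)
      ultimately show False using elim(1) by auto
    qed
    have "\<xi> t v \<le> 0" if v: "v \<in> clarke_tangent_cone UNIV norm (S t) (x t)" for v
    proof (rule field_le_epsilon)
      fix e :: real assume e: "e > 0"
      define k where "k = norm (\<xi> t) + 1"
      have k: "k > 0" unfolding k_def using norm_ge_zero[of "\<xi> t"] by linarith
      obtain n where n: "dist (u n t) v < e / k" using u(3)[OF elim(3,2) v, of "e / k"] e k by auto
      have "\<xi> t (v - u n t) \<le> norm (\<xi> t) * norm (v - u n t)" using norm_blinfun[of "\<xi> t" "v - u n t"] by simp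
      also have "\<dots> \<le> k * (e / k)"
        using n k by (intro mult_mono) (auto simp: k_def dist_norm norm_minus_commute)
      finally show "\<xi> t v \<le> 0 + e" using un[of n] k by (simp add: blinfun.diff_right)
    qed
    moreover have "blinfun_apply (\<xi> t) \<in> dual_space UNIV norm" by (simp add: dual_space_UNIV_norm)
    ultimately show ?case by (simp add: clarke_normal_cone_def)
  qed
  with \<xi> show thesis by (rule that)
qed

text \<open>Changing \<xi> on a null set does not change its functional, so the cones in the dual
  are compared with images under \<open>Lp_pairing\<close>.\<close>

theorem corollary5p1:
  fixes M :: "'t measure"
    and S :: "'t \<Rightarrow> 'z::{banach, second_countable_topology} set"
    and x :: "'t \<Rightarrow> 'z"
    and p :: real and q :: ereal
  assumes "complete_measure M" and "sigma_finite_measure M"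
    and "reflexive_space TYPE('z)"
    and "1 \<le> p" and "conjugate_exponent p q"
    and "\<And>t. t \<in> space M \<Longrightarrow> S t \<noteq> {} \<and> closed (S t)"
    and "measurable_multifunction M S"
    and "x \<in> Sel M p S"
  shows "clarke_normal_cone (Lp_space M p) (Lp_norm M p) (Sel M p S) x =
           Lp_pairing M p `
             {\<xi> \<in> Lp_space M q.
                AE t in M. blinfun_apply (\<xi> t) \<in> clarke_normal_cone UNIV norm (S t) (x t)}
      \<and> clarke_subdifferential (Lp_space M p) (Lp_norm M p)
            (distance_function (Lp_norm M p) (Sel M p S)) x \<subseteq>
           Lp_pairing M p `
             {\<xi> \<in> Lp_space M q. Lp_norm M q \<xi> \<le> 1 \<and>
                (AE t in M. blinfun_apply (\<xi> t) \<in> clarke_normal_cone UNIV norm (S t) (x t))}"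
proof -
  note sf = assms(2) and refl = assms(3) and p = assms(4) and q = assms(5) and x = assms(8)
  obtain s :: "nat \<Rightarrow> 't \<Rightarrow> 'z" where "dense_selections M S s"
  proof (rule castaing_representation[of M S])
    show "{t \<in> space M. S t \<inter> U \<noteq> {}} \<in> sets M" if "open U" for U
      using assms(7) that by (simp add: measurable_multifunction_def)
    show "S t \<noteq> {}" "closed (S t)" if "t \<in> space M" for t using assms(6)[OF that] by auto
    fix s :: "nat \<Rightarrow> 't \<Rightarrow> 'z"
    assume s: "\<And>n. s n \<in> borel_measurable M" "\<And>n t. t \<in> space M \<Longrightarrow> s n t \<in> S t"
      "\<And>t z e. t \<in> space M \<Longrightarrow> z \<in> S t \<Longrightarrow> e > 0 \<Longrightarrow> \<exists>n. dist (s n t) z < e"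
    have "dense_selections M S s" by unfold_locales (use s assms(6) in auto)
    then show thesis by (rule that)
  qed
  then interpret dense_selections M S s .
  let ?V = "Lp_space M p :: ('t \<Rightarrow> 'z) set" and ?N = "Lp_norm M p :: ('t \<Rightarrow> 'z) \<Rightarrow> real"
  have "Lp_pairing M p \<xi> \<in> clarke_normal_cone ?V ?N (Sel M p S) x"
    if \<xi>: "\<xi> \<in> Lp_space M q"
      and normal: "AE t in M. blinfun_apply (\<xi> t) \<in> clarke_normal_cone UNIV norm (S t) (x t)" for \<xi>
  proof -
    have "Lp_pairing M p \<xi> v \<le> 0" if v: "v \<in> clarke_tangent_cone ?V ?N (Sel M p S) x" for v
    proof -
      have "AE t in M. \<xi> t (v t) \<le> 0"
        using normal clarke_tangent_cone_Sel_pointwise[OF p sf x v]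
        by eventually_elim (simp add: clarke_normal_cone_def)
      then have "AE t in M. 0 \<le> - \<xi> t (v t)" by eventually_elim simp
      then have "0 \<le> (LINT t|M. - \<xi> t (v t))" by (rule integral_nonneg_AE)
      moreover have "v \<in> ?V" using v by (simp add: clarke_tangent_cone_def)
      ultimately show ?thesis by (simp add: Lp_pairing_def)
    qed
    then show ?thesis using Lp_pairing_dual_space[OF p q \<xi>] by (simp add: clarke_normal_cone_def)
  qed
  moreover have "\<exists>\<xi>. \<xi> \<in> Lp_space M q \<and> \<phi> = Lp_pairing M p \<xi> \<and>
      (AE t in M. blinfun_apply (\<xi> t) \<in> clarke_normal_cone UNIV norm (S t) (x t))"
    if \<phi>: "\<phi> \<in> clarke_normal_cone ?V ?N (Sel M p S) x" for \<phi>
  proof -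
    obtain K where K: "\<forall>f\<in>?V. \<bar>\<phi> f\<bar> \<le> K * ?N f"
      using \<phi> unfolding clarke_normal_cone_def dual_space_def by blast
    \<comment> \<open>The bound in \<open>dual_space\<close> carries no sign condition;
      \<open>max K 0\<close> supplies the nonnegative bound required for the representation.\<close>
    have "\<bar>\<phi> f\<bar> \<le> max K 0 * ?N f" if f: "f \<in> ?V" for f
      using K[rule_format, OF f] mult_right_mono[of K "max K 0" "?N f"] Lp_norm_nonneg[OF p, of M f] by simp
    then show ?thesis
      using clarke_normal_cone_Sel_representation[OF p sf refl q x \<phi>, of "max K 0"] by fastforce
  qed
  moreover have "\<exists>\<xi>. \<xi> \<in> Lp_space M q \<and> Lp_norm M q \<xi> \<le> 1 \<and> \<phi> = Lp_pairing M p \<xi> \<and>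
      (AE t in M. blinfun_apply (\<xi> t) \<in> clarke_normal_cone UNIV norm (S t) (x t))"
    if \<phi>: "\<phi> \<in> clarke_subdifferential ?V ?N (distance_function ?N (Sel M p S)) x" for \<phi>
  proof -
    have V: "subspace ?V"
      unfolding subspace_def using Lp_zero[OF p] Lp_add[OF p] Lp_scale(1)[OF p]
      by (auto simp: plus_fun_def scaleR_fun_def zero_fun_def)
    have tri: "?N (f + g) \<le> ?N f + ?N g" if "f \<in> ?V" "g \<in> ?V" for f g
      using Lp_triangle[OF p that] by (simp add: plus_fun_def)
    have scale: "?N (r *\<^sub>R f) = \<bar>r\<bar> * ?N f" if "f \<in> ?V" for r f
      using Lp_scale(2)[OF p that] by (simp add: scaleR_fun_def)
    have "Sel M p S \<subseteq> ?V" by (auto simp: Sel_def)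
    note sub = clarke_subdifferential_distance[OF V Lp_norm_nonneg[OF p] tri scale this x \<phi>]
    have "\<bar>\<phi> f\<bar> \<le> 1 * ?N f" if "f \<in> ?V" for f using sub(2)[OF _ _ _ that] by simp
    then show ?thesis
      using clarke_normal_cone_Sel_representation[OF p sf refl q x sub(1), of 1] by fastforce
  qed
  ultimately show ?thesis by blast
qed

end
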